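(* Let $B$ be any non-amenable countable group with only two conjugacy classes, and let $A_\infty$ be the finitary alternating group on $\mathbb{N}$. Then $G=A_{\infty}\times B$ has the ISR property.
   Context: $A_\infty$ is the group of all even permutations of $\mathbb{N}$ with finite support. For a countable discrete group $G$, $L(G)$ is the group von Neumann algebra generated by the left translation unitaries $u_g$ on $\ell^2(G)$; for a subgroup $H\le G$, $L(H)$ is identified with the von Neumann subalgebra of $L(G)$ generated by $\{u_h:h\in H\}$. A (unital) von Neumann subalgebra $P\subseteq L(G)$ is $G$-invariant if $u_gPu_g^*=P$ for all $g\in G$. $G$ has the ISR property if every $G$-invariant von Neumann subalgebra $P\subseteq L(G)$ equals $L(H)$ for some normal subgroup $H\lhd G$. *)

theory Defs
  imports
    "HOL-Algebra.Coset"
    "HOL-Combinatorics.Permutations"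
    "HOL-Analysis.Infinite_Sum"
    "HOL-Library.FuncSet"
begin

section \<open>Groups\<close>

(* permutation p says that p is a finite product of transpositions, i.e. a bijection of finite
   support; evenperm is only meaningful for such p. *)
definition alt_inf :: "(nat \<Rightarrow> nat) monoid" where
  "alt_inf = \<lparr>carrier = {p. permutation p \<and> evenperm p}, monoid.mult = (\<circ>), one = id\<rparr>"

definition conjugacy_classes :: "('a, 'm) monoid_scheme \<Rightarrow> 'a set set" where
  "conjugacy_classes G =
     {{h \<otimes>\<^bsub>G\<^esub> g \<otimes>\<^bsub>G\<^esub> inv\<^bsub>G\<^esub> h | h. h \<in> carrier G} | g. g \<in> carrier G}"

(* Amenability in von Neumann's sense: a left-invariant finitely additive probability measure on
   all subsets of the discrete group. *)
definition amenable :: "('a, 'm) monoid_scheme \<Rightarrow> bool" where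
  "amenable G \<longleftrightarrow>
     (\<exists>\<mu> :: 'a set \<Rightarrow> real.
        \<mu> (carrier G) = 1 \<and>
        (\<forall>A. A \<subseteq> carrier G \<longrightarrow> 0 \<le> \<mu> A) \<and>
        (\<forall>A B. A \<subseteq> carrier G \<longrightarrow> B \<subseteq> carrier G \<longrightarrow> A \<inter> B = {} \<longrightarrow> \<mu> (A \<union> B) = \<mu> A + \<mu> B) \<and>
        (\<forall>g A. g \<in> carrier G \<longrightarrow> A \<subseteq> carrier G \<longrightarrow> \<mu> (g <#\<^bsub>G\<^esub> A) = \<mu> A))"

section \<open>Bounded operators on the Hilbert space of square-summable functions\<close>

(* Functions on S are extended by 0, so that equality of vectors is equality of functions. *)
definition ell2 :: "'a set \<Rightarrow> ('a \<Rightarrow> complex) set" where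
  "ell2 S = {f. (\<forall>x. x \<notin> S \<longrightarrow> f x = 0) \<and> (\<lambda>x. (cmod (f x))\<^sup>2) summable_on S}"

definition ell2_inner :: "'a set \<Rightarrow> ('a \<Rightarrow> complex) \<Rightarrow> ('a \<Rightarrow> complex) \<Rightarrow> complex" where
  "ell2_inner S f g = (\<Sum>\<^sub>\<infinity>x\<in>S. f x * cnj (g x))"

definition ell2_norm :: "'a set \<Rightarrow> ('a \<Rightarrow> complex) \<Rightarrow> real" where
  "ell2_norm S f = sqrt (\<Sum>\<^sub>\<infinity>x\<in>S. (cmod (f x))\<^sup>2)"

type_synonym 'a operator = "('a \<Rightarrow> complex) \<Rightarrow> ('a \<Rightarrow> complex)"

(* Operators are extensional (undefined off ell2 S), so that equality of operators is equality
   of functions; accordingly they are composed with FuncSet.compose. *)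
definition bounded_operators :: "'a set \<Rightarrow> 'a operator set" where
  "bounded_operators S =
     {T \<in> ell2 S \<rightarrow>\<^sub>E ell2 S.
        (\<forall>f\<in>ell2 S. \<forall>g\<in>ell2 S. T (\<lambda>x. f x + g x) = (\<lambda>x. T f x + T g x)) \<and>
        (\<forall>c. \<forall>f\<in>ell2 S. T (\<lambda>x. c * f x) = (\<lambda>x. c * T f x)) \<and>
        (\<exists>K. \<forall>f\<in>ell2 S. ell2_norm S (T f) \<le> K * ell2_norm S f)}"

definition op_id :: "'a set \<Rightarrow> 'a operator" where
  "op_id S = (\<lambda>f\<in>ell2 S. f)"

definition op_add :: "'a set \<Rightarrow> 'a operator \<Rightarrow> 'a operator \<Rightarrow> 'a operator" where
  "op_add S T R = (\<lambda>f\<in>ell2 S. \<lambda>x. T f x + R f x)"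

definition op_scale :: "'a set \<Rightarrow> complex \<Rightarrow> 'a operator \<Rightarrow> 'a operator" where
  "op_scale S c T = (\<lambda>f\<in>ell2 S. \<lambda>x. c * T f x)"

definition op_comp :: "'a set \<Rightarrow> 'a operator \<Rightarrow> 'a operator \<Rightarrow> 'a operator" where
  "op_comp S T R = compose (ell2 S) T R"

definition op_adjoint :: "'a set \<Rightarrow> 'a operator \<Rightarrow> 'a operator" where
  "op_adjoint S T =
     (THE T'. T' \<in> bounded_operators S \<and>
        (\<forall>f\<in>ell2 S. \<forall>g\<in>ell2 S. ell2_inner S (T f) g = ell2_inner S f (T' g)))"

section \<open>Von Neumann algebras\<close>

definition commutant :: "'a set \<Rightarrow> 'a operator set \<Rightarrow> 'a operator set" where
  "commutant S M = {T \<in> bounded_operators S. \<forall>R\<in>M. op_comp S T R = op_comp S R T}"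

(* A unital *-subalgebra of the bounded operators that equals its bicommutant. *)
definition von_neumann_algebra :: "'a set \<Rightarrow> 'a operator set \<Rightarrow> bool" where
  "von_neumann_algebra S M \<longleftrightarrow>
     M \<subseteq> bounded_operators S \<and>
     op_id S \<in> M \<and>
     (\<forall>T\<in>M. \<forall>R\<in>M. op_add S T R \<in> M) \<and>
     (\<forall>c. \<forall>T\<in>M. op_scale S c T \<in> M) \<and>
     (\<forall>T\<in>M. \<forall>R\<in>M. op_comp S T R \<in> M) \<and>
     (\<forall>T\<in>M. op_adjoint S T \<in> M) \<and>
     commutant S (commutant S M) = M"

definition vN_generated :: "'a set \<Rightarrow> 'a operator set \<Rightarrow> 'a operator set" where
  "vN_generated S X = \<Inter>{M. von_neumann_algebra S M \<and> X \<subseteq> M}"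

section \<open>Group von Neumann algebras and the ISR property\<close>

definition left_translation :: "('a, 'm) monoid_scheme \<Rightarrow> 'a \<Rightarrow> 'a operator" where
  "left_translation G g =
     (\<lambda>f\<in>ell2 (carrier G). \<lambda>x. if x \<in> carrier G then f (inv\<^bsub>G\<^esub> g \<otimes>\<^bsub>G\<^esub> x) else 0)"

(* L(H) for a subgroup H of G, as a subalgebra of L(G); in particular L(G) itself is
   group_vN G (carrier G). *)
definition group_vN :: "('a, 'm) monoid_scheme \<Rightarrow> 'a set \<Rightarrow> 'a operator set" where
  "group_vN G H = vN_generated (carrier G) (left_translation G ` H)"

definition invariant_subalgebra :: "('a, 'm) monoid_scheme \<Rightarrow> 'a operator set \<Rightarrow> bool" where
  "invariant_subalgebra G P \<longleftrightarrow>
     von_neumann_algebra (carrier G) P \<and>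
     P \<subseteq> group_vN G (carrier G) \<and>
     (\<forall>g\<in>carrier G.
        (\<lambda>T. op_comp (carrier G) (op_comp (carrier G) (left_translation G g) T)
               (op_adjoint (carrier G) (left_translation G g))) ` P = P)"

definition ISR_property :: "('a, 'm) monoid_scheme \<Rightarrow> bool" where
  "ISR_property G \<longleftrightarrow>
     (\<forall>P. invariant_subalgebra G P \<longrightarrow> (\<exists>H. H \<lhd> G \<and> P = group_vN G H))"

end

theory Submission
  imports Defs "HOL-Analysis.Analysis"
begin

text \<open>
  Let \<open>e\<close> be the projection onto the closure of \<open>P \<delta>\<close>, where \<open>\<delta>\<close> is the unit vector at the identity, and
  \<open>xi g = e (ket g)\<close>, the vector of the conditional expectation of \<open>u\<^sub>g\<close>. Everything reduces to showing
  that \<open>xi g\<close> is \<open>0\<close> or \<open>ket g\<close>. Invariance gives \<open>E(u\<^sub>g) p = (u\<^sub>g p u\<^sub>g\<^sup>*) E(u\<^sub>g)\<close> for \<open>p \<in> P\<close>, so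
  \<open>u\<^sub>g\<^sup>* E(u\<^sub>g)\<close> lies in the relative commutant \<open>N\<close> of \<open>P\<close>, and it suffices that this element is scalar.

  \<^item> Since \<open>xi g\<close> is fixed by the centralizer of \<open>g\<close>, its permutation parts are supported in the support
    of the permutation part of \<open>g\<close>. Conjugating two commuting invariant subalgebras until these supports
    meet in a single point shows that one of the two algebras lies in \<open>L(B)\<close>.
  \<^item> An abelian invariant subalgebra \<open>Q\<close> thus lies in \<open>L(B)\<close>, where \<open>\<parallel>xi b\<parallel>\<^sup>2 = c\<close> does not depend on
    \<open>b \<noteq> 1\<close>. If \<open>c > 0\<close>, averaging over conjugates gives \<open>c \<tau>(z\<^sup>2) \<le> \<tau>(z)\<^sup>2\<close> for \<open>z = x\<^sup>* x\<close>, \<open>x \<in> Q\<close>. Applied to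
    products of nearly independent conjugates this improves \<open>c\<close> to \<open>1\<close>, which forces \<open>Q\<close> to be
    scalar. Hence \<open>P\<close> and \<open>N\<close> are factors, and then \<open>E\<^sub>P(u\<^sub>g)\<close> or \<open>E\<^sub>N(u\<^sub>g)\<close> vanishes for every \<open>g \<noteq> 1\<close>.
  \<^item> Combining the two facts, \<open>u\<^sub>g\<^sup>* E(u\<^sub>g)\<close> turns out to be scalar in all cases.
\<close>

section \<open>The Hilbert space of square-summable functions on a type\<close>

text \<open>Operators are handled through their vectors: one that commutes with right translations
  is determined by its image of \<open>ket \<one>\<close>, and \<open>P\<close> is recovered from
  the closure of such images. The price is that \<open>xi g\<close> is at first only a vector; that
  convolution by it is bounded has to be proved, from the symmetry of the compression of
  \<open>lt g\<close> to \<open>K\<close>.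

  The improvement of \<open>c\<close> to 1 is a tensor power trick: passing from \<open>z\<close> to
  the product of \<open>z\<close> with a nearly independent conjugate squares both
  \<open>\<tau>(z^2)\<close> and \<open>\<tau>(z)^2\<close> but leaves \<open>c\<close> alone, so
  the inequality holds with \<open>c^(1/2^n)\<close> for every \<open>n\<close>.

  A single common point is the right overlap of supports. Permutations of \<open>F\<close> and of
  \<open>F'\<close> that both move the only point of \<open>F \<inter> F'\<close> do not commute,
  which tells the two orders of a product apart. Moreover \<open>s t\<close> then has only one
  factorization into permutations of \<open>F\<close> and of \<open>F'\<close>, so cancellation
  could occur only within a coset of \<open>\<Gamma>\<close>, and there asymptotic independence
  rules it out.\<close>

typedef 'a l2 = "{f :: 'a \<Rightarrow> complex. (\<lambda>x. (cmod (f x))\<^sup>2) summable_on UNIV}"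
  morphisms coef Abs_l2
  by (intro exI[of _ "\<lambda>_. 0"]) simp

lemma coef_summable: "(\<lambda>x. (cmod (coef v x))\<^sup>2) summable_on UNIV"
  using coef[of v] by simp

lemma l2_eqI: "(\<And>x. coef v x = coef w x) \<Longrightarrow> v = w"
  by (simp add: coef_inject[symmetric] ext)

lemma coef_Abs: "(\<lambda>x. (cmod (f x))\<^sup>2) summable_on UNIV \<Longrightarrow> coef (Abs_l2 f) x = f x"
  by (simp add: Abs_l2_inverse)

lemma sq_summable_add:
  fixes f g :: "'a \<Rightarrow> complex"
  assumes "(\<lambda>x. (cmod (f x))\<^sup>2) summable_on A" "(\<lambda>x. (cmod (g x))\<^sup>2) summable_on A"
  shows "(\<lambda>x. (cmod (f x + g x))\<^sup>2) summable_on A"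
proof -
  have "(\<lambda>x. 2 * (cmod (f x))\<^sup>2 + 2 * (cmod (g x))\<^sup>2) summable_on A"
    by (intro summable_on_add summable_on_cmult_right assms)
  moreover have "(cmod (f x + g x))\<^sup>2 \<le> 2 * (cmod (f x))\<^sup>2 + 2 * (cmod (g x))\<^sup>2" for x
  proof -
    have "(cmod (f x + g x))\<^sup>2 \<le> (cmod (f x) + cmod (g x))\<^sup>2"
      by (intro power_mono norm_triangle_ineq) auto
    also have "\<dots> \<le> 2 * (cmod (f x))\<^sup>2 + 2 * (cmod (g x))\<^sup>2"
      using zero_le_power2[of "cmod (f x) - cmod (g x)"] unfolding power2_sum power2_diff by linarith
    finally show ?thesis .
  qed
  ultimately show ?thesis
    by (rule summable_on_comparison_test) auto
qed

lemma sq_summable_cmult: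
  fixes f :: "'a \<Rightarrow> complex"
  assumes "(\<lambda>x. (cmod (f x))\<^sup>2) summable_on A"
  shows "(\<lambda>x. (cmod (c * f x))\<^sup>2) summable_on A"
  using summable_on_cmult_right[OF assms, of "(cmod c)\<^sup>2"] by (simp add: norm_mult power_mult_distrib)

lemma prod_abs_summable:
  fixes f g :: "'a \<Rightarrow> complex"
  assumes "(\<lambda>x. (cmod (f x))\<^sup>2) summable_on A" "(\<lambda>x. (cmod (g x))\<^sup>2) summable_on A"
  shows "(\<lambda>x. norm (f x * g x)) summable_on A"
proof (rule summable_on_comparison_test)
  show "(\<lambda>x. (cmod (f x))\<^sup>2 + (cmod (g x))\<^sup>2) summable_on A"
    by (intro summable_on_add assms)
  show "norm (f x * g x) \<le> (cmod (f x))\<^sup>2 + (cmod (g x))\<^sup>2" for x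
    using zero_le_power2[of "cmod (f x) - cmod (g x)"] zero_le_power2[of "cmod (f x)"]
      zero_le_power2[of "cmod (g x)"]
    unfolding power2_diff norm_mult by linarith
qed auto

text \<open>Linear in the first argument. The \<open>real_inner\<close> instance uses its real part,
  so complex linearity is tracked separately, through \<open>cscale\<close>,
  \<open>csubspace\<close> and \<open>bop\<close>.\<close>

definition cin :: "'a l2 \<Rightarrow> 'a l2 \<Rightarrow> complex" where
  "cin v w = (\<Sum>\<^sub>\<infinity>x. coef v x * cnj (coef w x))"

definition cscale :: "complex \<Rightarrow> 'a l2 \<Rightarrow> 'a l2" where
  "cscale c v = Abs_l2 (\<lambda>x. c * coef v x)"

lemma coef_cscale [simp]: "coef (cscale c v) x = c * coef v x"
  unfolding cscale_def by (intro coef_Abs sq_summable_cmult coef_summable)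

lemma coef_prod_abs_summable: "(\<lambda>x. norm (coef v x * cnj (coef w x))) summable_on UNIV"
  by (intro prod_abs_summable coef_summable) (simp add: coef_summable)

lemma coef_prod_summable: "(\<lambda>x. coef v x * cnj (coef w x)) summable_on UNIV"
  by (rule abs_summable_summable[OF coef_prod_abs_summable])

instantiation l2 :: (type) real_vector
begin

definition "0 = Abs_l2 (\<lambda>_. 0)"
definition "v + w = Abs_l2 (\<lambda>x. coef v x + coef w x)"
definition "- v = cscale (-1) v"
definition "v - w = v + cscale (-1) w"
definition "r *\<^sub>R v = cscale (of_real r) v"

lemma coef_zero: "coef 0 x = 0"
  unfolding zero_l2_def by (simp add: coef_Abs)

lemma coef_add: "coef (v + w) x = coef v x + coef w x"
  unfolding plus_l2_def by (intro coef_Abs sq_summable_add coef_summable)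

instance
  by standard (auto intro!: l2_eqI
      simp: coef_add coef_zero uminus_l2_def scaleR_l2_def minus_l2_def algebra_simps)

end

lemma cin_self: "cin v v = of_real (\<Sum>\<^sub>\<infinity>x. (cmod (coef v x))\<^sup>2)"
proof -
  have "cin v v = (\<Sum>\<^sub>\<infinity>x. of_real ((cmod (coef v x))\<^sup>2))"
    by (simp only: cin_def complex_norm_square)
  also have "\<dots> = of_real (\<Sum>\<^sub>\<infinity>x. (cmod (coef v x))\<^sup>2)"
    by (intro infsumI has_sum_of_real has_sum_infsum coef_summable)
  finally show ?thesis .
qed

lemma cin_sym: "cin w v = cnj (cin v w)"
  unfolding cin_def infsum_cnj[symmetric] by (simp add: mult.commute)

lemma cin_add: "cin (u + v) w = cin u w + cin v w"
  unfolding cin_def coef_add by (simp add: distrib_right infsum_add coef_prod_summable)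

lemma cin_cscale: "cin (cscale c v) w = c * cin v w"
  unfolding cin_def coef_cscale mult.assoc by (simp add: infsum_cmult_right coef_prod_summable)

instantiation l2 :: (type) real_inner
begin

definition "inner v w = Re (cin v w)"
definition "norm v = sqrt (inner v (v :: 'a l2))"
definition "dist v w = norm (v - w :: 'a l2)"
definition "sgn v = (v :: 'a l2) /\<^sub>R norm v"
definition [code del]: "(uniformity :: ('a l2 \<times> 'a l2) filter) = (INF e\<in>{0<..}. principal {(x, y). dist x y < e})"
definition [code del]: "open (U :: 'a l2 set) \<longleftrightarrow> (\<forall>x\<in>U. \<forall>\<^sub>F (x', y) in uniformity. x' = x \<longrightarrow> y \<in> U)"

instance
proof
  fix u v w :: "'a l2" and r :: real
  show "dist u v = norm (u - v)" by (simp add: dist_l2_def)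
  show "sgn u = u /\<^sub>R norm u" by (simp add: sgn_l2_def)
  show "(uniformity :: ('a l2 \<times> 'a l2) filter) = (INF e\<in>{0<..}. principal {(x, y). dist x y < e})"
    by (simp add: uniformity_l2_def)
  show "norm u = sqrt (inner u u)" by (simp add: norm_l2_def)
  show "inner u v = inner v u" using cin_sym[of u v] by (simp add: inner_l2_def)
  show "inner (u + v) w = inner u w + inner v w" by (simp add: inner_l2_def cin_add)
  show "inner (r *\<^sub>R u) v = r * inner u v" by (simp add: inner_l2_def scaleR_l2_def cin_cscale)
  show "0 \<le> inner u u" by (simp add: inner_l2_def cin_self infsum_nonneg)
  show "inner u u = 0 \<longleftrightarrow> u = 0"
  proof
    assume "inner u u = 0"
    then have "(\<Sum>\<^sub>\<infinity>x. (cmod (coef u x))\<^sup>2) = 0" by (simp add: inner_l2_def cin_self)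
    then have "(cmod (coef u x))\<^sup>2 = 0" for x
      by (intro nonneg_infsum_le_0D[where A = UNIV]) (auto simp: coef_summable)
    then show "u = 0" by (intro l2_eqI) (simp add: coef_zero)
  next
    assume "u = 0" then show "inner u u = 0" by (simp add: inner_l2_def cin_def coef_zero)
  qed
next
  fix U :: "'a l2 set"
  show "open U \<longleftrightarrow> (\<forall>x\<in>U. \<forall>\<^sub>F (x', y) in uniformity. x' = x \<longrightarrow> y \<in> U)"
    by (simp add: open_l2_def)
qed

end

lemma coef_minus [simp]: "coef (- v) x = - coef v x"
  by (simp add: uminus_l2_def)

lemma coef_diff [simp]: "coef (v - w) x = coef v x - coef w x"
  unfolding minus_l2_def coef_add coef_cscale by simp

lemma coef_scaleR [simp]: "coef (r *\<^sub>R v) x = of_real r * coef v x"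
  by (simp add: scaleR_l2_def)

lemmas [simp] = coef_zero coef_add

lemma coef_sum [simp]: "coef (\<Sum>i\<in>I. f i) x = (\<Sum>i\<in>I. coef (f i) x)"
  by (induction I rule: infinite_finite_induct) auto

lemma norm_l2_sq: "(norm v)\<^sup>2 = (\<Sum>\<^sub>\<infinity>x. (cmod (coef v x))\<^sup>2)"
  by (simp add: norm_eq_sqrt_inner inner_l2_def cin_self infsum_nonneg)

lemma cin_self_norm: "cin v v = of_real ((norm v)\<^sup>2)"
  by (simp add: cin_self norm_l2_sq)

lemma finite_sum_le_norm_sq: "finite F \<Longrightarrow> (\<Sum>x\<in>F. (cmod (coef v x))\<^sup>2) \<le> (norm v)\<^sup>2"
  unfolding norm_l2_sq by (intro finite_sum_le_infsum coef_summable) auto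

lemma cmod_coef_le: "cmod (coef v x) \<le> norm v"
  using finite_sum_le_norm_sq[of "{x}" v] by (auto intro: power2_le_imp_le)

text \<open>A bound on all finite partial sums gives square-summability and the norm bound at once.
  Vectors prescribed by their coefficients, such as values of adjoints and of extended operators,
  are built through it.\<close>

lemma Abs_l2_bounded:
  assumes "\<And>F. finite F \<Longrightarrow> (\<Sum>x\<in>F. (cmod (f x))\<^sup>2) \<le> C\<^sup>2" and "0 \<le> C"
  shows "coef (Abs_l2 f) = f" "norm (Abs_l2 f) \<le> C"
proof -
  have s: "(\<lambda>x. (cmod (f x))\<^sup>2) summable_on UNIV"
    by (intro nonneg_bdd_above_summable_on bdd_aboveI2[where M = "C\<^sup>2"]) (auto intro: assms)
  then show c: "coef (Abs_l2 f) = f" by (auto simp: coef_Abs)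
  have "(\<Sum>\<^sub>\<infinity>x. (cmod (f x))\<^sup>2) \<le> C\<^sup>2"
    by (rule infsum_le_finite_sums[OF s]) (auto intro: assms)
  then have "(norm (Abs_l2 f))\<^sup>2 \<le> C\<^sup>2" by (simp add: norm_l2_sq c)
  then show "norm (Abs_l2 f) \<le> C" using assms(2) by (rule power2_le_imp_le)
qed

instance l2 :: (type) complete_space
proof
  fix X :: "nat \<Rightarrow> 'a l2"
  assume X: "Cauchy X"
  have "Cauchy (\<lambda>n. coef (X n) x)" for x
    unfolding Cauchy_iff
  proof (intro allI impI)
    fix e :: real assume "0 < e"
    then obtain M where "\<And>m n. m \<ge> M \<Longrightarrow> n \<ge> M \<Longrightarrow> norm (X m - X n) < e"
      using X unfolding Cauchy_iff by blast
    then show "\<exists>M. \<forall>m\<ge>M. \<forall>n\<ge>M. cmod (coef (X m) x - coef (X n) x) < e"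
      using cmod_coef_le[of "X _ - X _" x] by (metis coef_diff order_le_less_trans)
  qed
  then have "\<exists>l. (\<lambda>n. coef (X n) x) \<longlonglongrightarrow> l" for x
    using Cauchy_convergent convergent_def by blast
  then obtain f where f: "\<And>x. (\<lambda>n. coef (X n) x) \<longlonglongrightarrow> f x" by metis
  \<comment> \<open>The estimate is uniform in the finite set \<open>F\<close>: coordinatewise
    limits pass through finite sums, and uniformity then gives both summability of the limit and
    convergence in norm.\<close>
  have close: "\<exists>M. \<forall>n\<ge>M. \<forall>F. finite F \<longrightarrow> (\<Sum>x\<in>F. (cmod (coef (X n) x - f x))\<^sup>2) \<le> e\<^sup>2" if "0 < e" for e
  proof -
    obtain M where M: "\<And>m n. m \<ge> M \<Longrightarrow> n \<ge> M \<Longrightarrow> norm (X m - X n) < e"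
      using X \<open>0 < e\<close> unfolding Cauchy_iff by blast
    have "(\<Sum>x\<in>F. (cmod (coef (X n) x - f x))\<^sup>2) \<le> e\<^sup>2" if "n \<ge> M" "finite F" for n F
    proof (rule tendsto_upperbound)
      show "(\<lambda>m. \<Sum>x\<in>F. (cmod (coef (X n) x - coef (X m) x))\<^sup>2) \<longlonglongrightarrow> (\<Sum>x\<in>F. (cmod (coef (X n) x - f x))\<^sup>2)"
        by (intro tendsto_intros f)
      show "\<forall>\<^sub>F m in sequentially. (\<Sum>x\<in>F. (cmod (coef (X n) x - coef (X m) x))\<^sup>2) \<le> e\<^sup>2"
        using eventually_ge_at_top[of M]
      proof eventually_elim
        case (elim m)
        have "(\<Sum>x\<in>F. (cmod (coef (X n - X m) x))\<^sup>2) \<le> (norm (X n - X m))\<^sup>2"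
          by (rule finite_sum_le_norm_sq[OF \<open>finite F\<close>])
        also have "\<dots> \<le> e\<^sup>2" using M[OF \<open>n \<ge> M\<close> elim] by (intro power_mono) auto
        finally show ?case by simp
      qed
    qed auto
    then show ?thesis by blast
  qed
  obtain M where M: "\<And>F. finite F \<Longrightarrow> (\<Sum>x\<in>F. (cmod (coef (X M) x - f x))\<^sup>2) \<le> 1\<^sup>2"
    using close[of 1] by auto
  have "(\<lambda>x. (cmod (coef (X M) x - f x))\<^sup>2) summable_on UNIV"
    using Abs_l2_bounded(1)[OF M] coef_summable[of "Abs_l2 (\<lambda>x. coef (X M) x - f x)"] by simp
  from sq_summable_add[OF coef_summable[of "X M"] sq_summable_cmult[OF this, of "-1"]]
  have f_sum: "(\<lambda>x. (cmod (f x))\<^sup>2) summable_on UNIV" by simp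
  have "X \<longlonglongrightarrow> Abs_l2 f"
    unfolding LIMSEQ_iff
  proof (intro allI impI)
    fix e :: real assume "0 < e"
    then obtain M where M: "\<And>n F. n \<ge> M \<Longrightarrow> finite F \<Longrightarrow> (\<Sum>x\<in>F. (cmod (coef (X n) x - f x))\<^sup>2) \<le> (e/2)\<^sup>2"
      using close[of "e/2"] by auto
    have "norm (X n - Abs_l2 f) < e" if "n \<ge> M" for n
    proof -
      have "X n - Abs_l2 f = Abs_l2 (\<lambda>x. coef (X n) x - f x)"
        using \<open>0 < e\<close> by (intro l2_eqI) (simp add: coef_Abs f_sum Abs_l2_bounded(1)[OF M[OF that]])
      moreover have "norm (Abs_l2 (\<lambda>x. coef (X n) x - f x)) \<le> e/2"
        using \<open>0 < e\<close> by (intro Abs_l2_bounded(2)[OF M[OF that]]) auto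
      ultimately show ?thesis using \<open>0 < e\<close> by simp
    qed
    then show "\<exists>M. \<forall>n\<ge>M. norm (X n - Abs_l2 f) < e" by blast
  qed
  then show "convergent X" by (auto simp: convergent_def)
qed

lemma cin_add_right: "cin u (v + w) = cin u v + cin u w"
  using cin_add[of v w u] by (metis cin_sym complex_cnj_add)

lemma cin_cscale_right: "cin v (cscale c w) = cnj c * cin v w"
  using cin_cscale[of c w v] by (metis cin_sym complex_cnj_mult)

lemma minus_conv_cscale: "- v = cscale (-1) v"
  by (rule l2_eqI) simp

lemma scaleR_conv_cscale: "r *\<^sub>R v = cscale (of_real r) v"
  by (rule l2_eqI) simp

lemma cscale_one [simp]: "cscale 1 v = v"
  by (rule l2_eqI) simp

lemma cscale_cscale [simp]: "cscale a (cscale b v) = cscale (a * b) v"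
  by (rule l2_eqI) simp

lemma cscale_zero [simp]: "cscale c 0 = 0" "cscale 0 v = 0"
  by (rule l2_eqI, simp)+

lemma cscale_add: "cscale c (v + w) = cscale c v + cscale c w"
  by (rule l2_eqI) (simp add: algebra_simps)

lemma cin_minus: "cin (- v) w = - cin v w" "cin v (- w) = - cin v w"
  by (simp_all add: minus_conv_cscale cin_cscale cin_cscale_right)

lemma cin_diff: "cin (u - v) w = cin u w - cin v w" "cin w (u - v) = cin w u - cin w v"
  using cin_add[of u "- v" w] cin_add_right[of w u "- v"] by (simp_all add: cin_minus)

lemma cin_zero [simp]: "cin 0 w = 0" "cin w 0 = 0"
  by (simp_all add: cin_def)

lemma cin_sum_left: "cin (\<Sum>i\<in>I. f i) w = (\<Sum>i\<in>I. cin (f i) w)"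
  by (induction I rule: infinite_finite_induct) (auto simp: cin_add)

lemma cin_sum_right: "cin w (\<Sum>i\<in>I. f i) = (\<Sum>i\<in>I. cin w (f i))"
  by (induction I rule: infinite_finite_induct) (auto simp: cin_add_right)

lemma norm_sq_cin: "(norm v)\<^sup>2 = Re (cin v v)"
  by (simp add: cin_self_norm)

lemma norm_cscale [simp]: "norm (cscale c v) = cmod c * norm v"
proof -
  have "cin (cscale c v) (cscale c v) = of_real ((cmod c)\<^sup>2 * (norm v)\<^sup>2)"
    by (subst cin_cscale, subst cin_cscale_right)
      (simp only: cin_self_norm of_real_mult complex_norm_square mult.assoc)
  then have "(norm (cscale c v))\<^sup>2 = (cmod c * norm v)\<^sup>2"
    by (simp only: norm_sq_cin Re_complex_of_real power_mult_distrib)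
  then show ?thesis by (simp add: power2_eq_iff_nonneg)
qed

text \<open>A unimodular factor turns \<open>cin v w\<close> into its modulus, which reduces the
  claim to the real Cauchy-Schwarz inequality.\<close>

lemma cin_norm_le: "cmod (cin v w) \<le> norm v * norm w"
proof (cases "cin v w = 0")
  case False
  define c where "c = cnj (cin v w) / cmod (cin v w)"
  have c: "cmod c = 1" using False by (simp add: c_def norm_divide)
  have "c * cin v w = cmod (cin v w)"
    using False by (simp add: c_def complex_norm_square[symmetric] power2_eq_square mult.commute)
  then have "cmod (cin v w) = inner (cscale c v) w"
    by (simp add: inner_l2_def cin_cscale)
  also have "\<dots> \<le> norm (cscale c v) * norm w" by (rule norm_cauchy_schwarz)
  finally show ?thesis by (simp add: c)
qed simp

lemma bounded_bilinear_cin: "bounded_bilinear cin"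
proof
  show "\<exists>K. \<forall>a b. norm (cin a b) \<le> norm a * norm b * K"
    by (intro exI[of _ 1]) (simp add: cin_norm_le)
qed (simp_all add: cin_add cin_add_right scaleR_conv_cscale cin_cscale cin_cscale_right scaleR_conv_of_real)

lemmas tendsto_cin = bounded_bilinear.tendsto[OF bounded_bilinear_cin]
lemmas continuous_on_cin [continuous_intros] = bounded_bilinear.continuous_on[OF bounded_bilinear_cin]

lemma bounded_linear_cscale: "bounded_linear (cscale c)"
  by (rule bounded_linear_intro[where K = "cmod c"])
    (simp_all add: cscale_add scaleR_conv_cscale mult.commute)

section \<open>The standard basis\<close>

definition ket :: "'a \<Rightarrow> 'a l2" where
  "ket x = Abs_l2 (\<lambda>y. if y = x then 1 else 0)"

lemma coef_ket [simp]: "coef (ket x) y = (if y = x then 1 else 0)"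
proof -
  have *: "(\<Sum>z\<in>F. (cmod (if z = x then 1 else 0))\<^sup>2) \<le> 1\<^sup>2" if "finite F" for F
  proof -
    have "(\<Sum>z\<in>F. (cmod (if z = x then 1 else 0))\<^sup>2) = (\<Sum>z\<in>F. if z = x then 1 else 0)"
      by (intro sum.cong) auto
    then show ?thesis using that by simp
  qed
  show ?thesis unfolding ket_def by (subst Abs_l2_bounded(1)[OF *]) auto
qed

lemma cin_ket: "cin v (ket x) = coef v x"
proof -
  have "cin v (ket x) = (\<Sum>\<^sub>\<infinity>y\<in>{x}. coef v y * cnj (coef (ket x) y))"
    unfolding cin_def by (rule infsum_cong_neutral) auto
  then show ?thesis by simp
qed

lemma cin_ket_left: "cin (ket x) v = cnj (coef v x)"
  using cin_ket[of v x] by (metis cin_sym)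

lemma norm_ket [simp]: "norm (ket x) = 1"
  by (simp add: cin_ket norm_eq_sqrt_inner inner_l2_def)

subsection \<open>Orthogonal projections\<close>

definition csubspace :: "'a l2 set \<Rightarrow> bool" where
  "csubspace K \<longleftrightarrow> 0 \<in> K \<and> (\<forall>v\<in>K. \<forall>w\<in>K. v + w \<in> K) \<and> (\<forall>c. \<forall>v\<in>K. cscale c v \<in> K)"

lemma csubspaceD:
  assumes "csubspace K"
  shows "0 \<in> K" "v \<in> K \<Longrightarrow> w \<in> K \<Longrightarrow> v + w \<in> K" "v \<in> K \<Longrightarrow> cscale c v \<in> K"
    "v \<in> K \<Longrightarrow> w \<in> K \<Longrightarrow> v - w \<in> K"
proof -
  show *: "0 \<in> K" "v \<in> K \<Longrightarrow> w \<in> K \<Longrightarrow> v + w \<in> K" "v \<in> K \<Longrightarrow> cscale c v \<in> K" for v w c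
    using assms by (auto simp: csubspace_def)
  show "v \<in> K \<Longrightarrow> w \<in> K \<Longrightarrow> v - w \<in> K"
    using *(2)[of v "cscale (-1) w"] *(3)[of w "-1"] by (simp add: minus_conv_cscale[symmetric])
qed

lemma csubspace_closure:
  assumes "csubspace K" shows "csubspace (closure K)"
  unfolding csubspace_def
proof (intro conjI ballI allI)
  show "0 \<in> closure K" using csubspaceD(1)[OF assms] closure_subset by blast
  fix v c assume v: "v \<in> closure K"
  then obtain f where f: "\<And>n. f n \<in> K" "f \<longlonglongrightarrow> v" by (auto simp: closure_sequential)
  then show "cscale c v \<in> closure K"
    using bounded_linear.tendsto[OF bounded_linear_cscale f(2)] csubspaceD(3)[OF assms]
    unfolding closure_sequential by (intro exI[of _ "\<lambda>n. cscale c (f n)"]) simp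
  fix w assume "w \<in> closure K"
  then obtain g where g: "\<And>n. g n \<in> K" "g \<longlonglongrightarrow> w" by (auto simp: closure_sequential)
  then show "v + w \<in> closure K"
    using tendsto_add[OF f(2) g(2)] csubspaceD(2)[OF assms] f(1)
    unfolding closure_sequential by (intro exI[of _ "\<lambda>n. f n + g n"]) simp
qed

text \<open>The free base point \<open>v\<close> makes this the estimate behind existence and
  uniqueness of nearest points: two almost minimal points are close because their midpoint cannot do
  much better.\<close>

lemma parallelogram:
  "(norm (p - q))\<^sup>2 = 2 * (norm (v - p))\<^sup>2 + 2 * (norm (v - q))\<^sup>2 - 4 * (norm (v - (1/2) *\<^sub>R (p + q)))\<^sup>2"
  for p :: "'a :: real_inner"
  unfolding power2_norm_eq_inner
  by (simp add: inner_diff_left inner_diff_right inner_add_left inner_add_right inner_commute field_simps)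

lemma convex_midpoint: "convex K \<Longrightarrow> p \<in> K \<Longrightarrow> q \<in> K \<Longrightarrow> (1/2) *\<^sub>R (p + q) \<in> K"
  using convexD[of K p q "1/2" "1/2"] by (simp add: scaleR_add_right)

text \<open>Minimizing sequences are Cauchy by the parallelogram law. Convex sets are allowed, not
  only subspaces, since the closed hull of the conjugates of a vector is treated by the same
  result.\<close>

lemma closed_convex_nearest:
  fixes v :: "'a :: {real_inner, complete_space}"
  assumes "closed K" "convex K" and ne: "K \<noteq> {}"
  shows "\<exists>p\<in>K. \<forall>k\<in>K. norm (v - p) \<le> norm (v - k)"
proof -
  define d where "d = Inf ((\<lambda>k. (norm (v - k))\<^sup>2) ` K)"
  have bdd: "bdd_below ((\<lambda>k. (norm (v - k))\<^sup>2) ` K)" by (auto intro: bdd_belowI2[where m = 0])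
  have d_le: "d \<le> (norm (v - k))\<^sup>2" if "k \<in> K" for k
    unfolding d_def using bdd that by (intro cInf_lower) auto
  have "\<exists>k\<in>K. (norm (v - k))\<^sup>2 < d + 1 / Suc n" for n
    using cInf_lessD[of "(\<lambda>k. (norm (v - k))\<^sup>2) ` K" "d + 1 / Suc n"] ne unfolding d_def by auto
  then obtain k where k: "\<And>n. k n \<in> K" "\<And>n. (norm (v - k n))\<^sup>2 < d + 1 / Suc n" by metis
  have para: "(norm (k m - k n))\<^sup>2 \<le> 2 / Suc m + 2 / Suc n" for m n
  proof -
    have "4 * d \<le> 4 * (norm (v - (1/2) *\<^sub>R (k m + k n)))\<^sup>2"
      using d_le[OF convex_midpoint[OF assms(2) k(1) k(1)]] by simp
    then show ?thesis using parallelogram[of "k m" "k n" v] k(2)[of m] k(2)[of n] by linarith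
  qed
  have "Cauchy k"
    unfolding Cauchy_iff
  proof (intro allI impI)
    fix e :: real assume e: "0 < e"
    obtain M where M: "inverse (real (Suc M)) < e\<^sup>2 / 4" using reals_Archimedean[of "e\<^sup>2 / 4"] e by auto
    have "norm (k m - k n) < e" if "m \<ge> M" "n \<ge> M" for m n
    proof (rule power2_less_imp_less)
      have "1 / real (Suc m) \<le> 1 / real (Suc M)" "1 / real (Suc n) \<le> 1 / real (Suc M)"
        using that by (auto intro!: divide_left_mono)
      then show "(norm (k m - k n))\<^sup>2 < e\<^sup>2"
        using para[of m n] M by (simp add: inverse_eq_divide)
    qed (use e in auto)
    then show "\<exists>M. \<forall>m\<ge>M. \<forall>n\<ge>M. norm (k m - k n) < e" by blast
  qed
  then obtain p where p: "k \<longlonglongrightarrow> p" using Cauchy_convergent convergent_def by blast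
  then have pK: "p \<in> K" using closed_sequentially[OF assms(1)] k(1) by blast
  have "(\<lambda>n. (norm (v - k n))\<^sup>2) \<longlonglongrightarrow> (norm (v - p))\<^sup>2" by (intro tendsto_intros p)
  moreover have "(\<lambda>n. d + 1 / Suc n) \<longlonglongrightarrow> d + 0"
    using LIMSEQ_inverse_real_of_nat by (intro tendsto_intros) (simp add: inverse_eq_divide)
  ultimately have "(norm (v - p))\<^sup>2 \<le> d"
    using k(2) by (intro LIMSEQ_le[where Y = "\<lambda>n. d + 1 / Suc n"]) (auto intro: less_imp_le)
  then have "norm (v - p) \<le> norm (v - q)" if "q \<in> K" for q
    using order_trans[OF _ d_le[OF that]] by (auto intro: power2_le_imp_le)
  then show ?thesis using pK by blast
qed

lemma nearest_unique:
  fixes v :: "'a :: real_inner"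
  assumes "convex K" "p \<in> K" "q \<in> K" "\<And>k. k \<in> K \<Longrightarrow> norm (v - p) \<le> norm (v - k)"
    and "norm (v - q) = norm (v - p)"
  shows "q = p"
proof -
  have "(norm (v - p))\<^sup>2 \<le> (norm (v - (1/2) *\<^sub>R (p + q)))\<^sup>2"
    using assms convex_midpoint[of K p q] by (intro power_mono) auto
  then have "(norm (p - q))\<^sup>2 \<le> 0" using parallelogram[of p q v] assms(5) by simp
  then show ?thesis by simp
qed

lemma convex_csubspace: "csubspace K \<Longrightarrow> convex K"
  unfolding convex_def by (simp add: csubspaceD scaleR_conv_cscale)

text \<open>The choice \<open>t = inner u w / (norm w)^2\<close> lowers the squared norm of
  \<open>u\<close> by \<open>(inner u w)^2 / (norm w)^2\<close>, which must therefore
  vanish.\<close>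

lemma orthogonal_of_nearest:
  assumes "\<And>t::real. norm u \<le> norm (u - t *\<^sub>R w)"
  shows "inner u (w :: 'a :: real_inner) = 0"
proof (cases "w = 0")
  case False
  define t where "t = inner u w / (norm w)\<^sup>2"
  have "(norm (u - t *\<^sub>R w))\<^sup>2 = (norm u)\<^sup>2 - 2 * t * inner u w + t\<^sup>2 * (norm w)\<^sup>2"
    unfolding power2_norm_eq_inner
    by (simp add: inner_diff_left inner_diff_right inner_commute power2_eq_square)
  also have "\<dots> = (norm u)\<^sup>2 - (inner u w)\<^sup>2 / (norm w)\<^sup>2"
    using False by (simp add: t_def field_simps power2_eq_square)
  finally have "(inner u w)\<^sup>2 / (norm w)\<^sup>2 \<le> 0"
    using power_mono[OF assms[of t], of 2] by simp
  then show ?thesis using False by (simp add: divide_le_0_iff)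
qed simp

definition proj :: "'a l2 set \<Rightarrow> 'a l2 \<Rightarrow> 'a l2" where
  "proj K v = (SOME p. p \<in> K \<and> (\<forall>k\<in>K. cin (v - p) k = 0))"

locale closed_csubspace =
  fixes K :: "'a l2 set"
  assumes closed: "closed K" and sub: "csubspace K"
begin

lemma proj_works: "proj K v \<in> K \<and> (\<forall>k\<in>K. cin (v - proj K v) k = 0)"
  unfolding proj_def
proof (rule someI_ex)
  obtain p where p: "p \<in> K" "\<And>k. k \<in> K \<Longrightarrow> norm (v - p) \<le> norm (v - k)"
    using closed_convex_nearest[OF closed convex_csubspace[OF sub]] csubspaceD(1)[OF sub] by blast
  have re: "Re (cin (v - p) k) = 0" if "k \<in> K" for k
    unfolding inner_l2_def[symmetric]
  proof (rule orthogonal_of_nearest)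
    fix t :: real
    show "norm (v - p) \<le> norm (v - p - t *\<^sub>R k)"
      using p(2)[of "p + t *\<^sub>R k"] p(1) that csubspaceD[OF sub]
      by (simp add: scaleR_conv_cscale diff_diff_add)
  qed
  \<comment> \<open>The real part at \<open>\<i> k\<close> is the imaginary part at
    \<open>k\<close>.\<close>
  have "cin (v - p) k = 0" if "k \<in> K" for k
    using re[OF that] re[OF csubspaceD(3)[OF sub that, of "\<i>"]]
    by (simp add: cin_cscale_right complex_eq_iff)
  then show "\<exists>p. p \<in> K \<and> (\<forall>k\<in>K. cin (v - p) k = 0)" using p(1) by blast
qed

lemma proj_in [simp]: "proj K v \<in> K"
  using proj_works by blast

lemma proj_orth: "k \<in> K \<Longrightarrow> cin (v - proj K v) k = 0" "k \<in> K \<Longrightarrow> cin k (v - proj K v) = 0"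
proof -
  show *: "cin (v - proj K v) k = 0" if "k \<in> K" using that proj_works by blast
  show "cin k (v - proj K v) = 0" if "k \<in> K" using *[OF that] cin_sym[of k "v - proj K v"] by simp
qed

lemma cin_proj: "k \<in> K \<Longrightarrow> cin (proj K v) k = cin v k" "k \<in> K \<Longrightarrow> cin k (proj K v) = cin k v"
  using proj_orth[of k v] by (auto simp: cin_diff)

lemma proj_eqI:
  assumes "p \<in> K" "\<And>k. k \<in> K \<Longrightarrow> cin p k = cin v k"
  shows "proj K v = p"
proof -
  define q where "q = proj K v - p"
  have qK: "q \<in> K" using assms csubspaceD(4)[OF sub] by (auto simp: q_def)
  then have "cin q q = 0" using cin_proj[OF qK] assms(2)[OF qK] by (simp add: q_def cin_diff(1))
  then show ?thesis by (simp add: q_def cin_self_norm)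
qed

lemma cin_proj_swap: "cin (proj K v) w = cin v (proj K w)"
  using cin_proj(2)[of "proj K v" w] cin_proj(1)[of "proj K w" v] by simp

lemma proj_add: "proj K (v + w) = proj K v + proj K w"
  using csubspaceD[OF sub] by (intro proj_eqI) (simp_all add: cin_add cin_proj)

lemma proj_cscale: "proj K (cscale c v) = cscale c (proj K v)"
  using csubspaceD[OF sub] by (intro proj_eqI) (simp_all add: cin_cscale cin_proj)

lemma norm_sq_proj: "(norm (proj K v))\<^sup>2 = Re (cin v (proj K v))"
  using cin_proj(1)[of "proj K v" v] by (simp add: norm_sq_cin)

lemma norm_proj_le: "norm (proj K v) \<le> norm v"
proof (cases "proj K v = 0")
  case False
  have "(norm (proj K v))\<^sup>2 \<le> cmod (cin v (proj K v))" unfolding norm_sq_proj by (rule complex_Re_le_cmod)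
  also have "\<dots> \<le> norm v * norm (proj K v)" by (rule cin_norm_le)
  finally show ?thesis using False by (simp add: power2_eq_square)
qed simp

lemma bounded_linear_proj: "bounded_linear (proj K)"
  by (rule bounded_linear_intro[where K = 1])
    (simp_all add: proj_add proj_cscale scaleR_conv_cscale norm_proj_le)

end

text \<open>The difference \<open>v - proj K v\<close> is orthogonal to every \<open>ket x\<close>,
  so all its coefficients vanish. It serves as an induction rule: a closed linear property holds
  everywhere once it holds on the basis.\<close>

lemma ket_dense:
  assumes "closed K" "csubspace K" "\<And>x. ket x \<in> K"
  shows "v \<in> K"
proof -
  interpret closed_csubspace K using assms by unfold_locales
  have "v = proj K v"
    using proj_orth(1)[OF assms(3)] by (intro l2_eqI) (simp add: cin_ket)
  then show ?thesis using proj_in[of v] by simp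
qed

subsection \<open>Bounded operators\<close>

definition bop :: "('a l2 \<Rightarrow> 'b l2) \<Rightarrow> bool" where
  "bop T \<longleftrightarrow> bounded_linear T \<and> (\<forall>c v. T (cscale c v) = cscale c (T v))"

lemma bopI:
  assumes "\<And>v w. T (v + w) = T v + T w" "\<And>c v. T (cscale c v) = cscale c (T v)"
    "\<And>v. norm (T v) \<le> C * norm v"
  shows "bop T"
  unfolding bop_def
  using assms by (auto intro!: bounded_linear_intro[where K = C] simp: scaleR_conv_cscale mult.commute)

lemma bop_linear: "bop T \<Longrightarrow> bounded_linear T" by (simp add: bop_def)

lemma bop_simps:
  assumes "bop T"
  shows "T (v + w) = T v + T w" "T (cscale c v) = cscale c (T v)" "T 0 = 0" "T (v - w) = T v - T w"
    "T (\<Sum>i\<in>I. f i) = (\<Sum>i\<in>I. T (f i))"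
proof -
  interpret bounded_linear T using assms by (rule bop_linear)
  show "T (v + w) = T v + T w" "T 0 = 0" "T (v - w) = T v - T w"
    "T (\<Sum>i\<in>I. f i) = (\<Sum>i\<in>I. T (f i))"
    by (simp_all add: add zero diff sum)
  show "T (cscale c v) = cscale c (T v)" using assms by (simp add: bop_def)
qed

lemma bop_bound: "bop T \<Longrightarrow> \<exists>C\<ge>0. \<forall>v. norm (T v) \<le> C * norm v"
  using bounded_linear.nonneg_bounded[OF bop_linear, of T] by (metis mult.commute)

lemma bop_id [simp]: "bop id" "bop (\<lambda>v. v)"
  by (rule bopI[where C = 1]; simp)+

lemma bop_comp: "bop T \<Longrightarrow> bop S \<Longrightarrow> bop (T \<circ> S)"
  unfolding bop_def using bounded_linear_compose[of T S] by (simp add: o_def)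

lemma bop_add: "bop T \<Longrightarrow> bop S \<Longrightarrow> bop (\<lambda>v. T v + S v)"
  unfolding bop_def by (simp add: bounded_linear_add cscale_add)

lemma bop_cscale: "bop T \<Longrightarrow> bop (\<lambda>v. cscale c (T v))"
  unfolding bop_def
  using bounded_linear_compose[OF bounded_linear_cscale, of T c] by (simp add: o_def mult.commute)

lemma bop_eqI:
  assumes "bop T" "bop S" "\<And>x. T (ket x) = S (ket x)"
  shows "T = S"
proof
  fix v
  have "v \<in> {v. T v = S v}"
  proof (rule ket_dense)
    show "closed {v. T v = S v}"
      by (intro closed_Collect_eq linear_continuous_on bop_linear assms)
    show "csubspace {v. T v = S v}"
      unfolding csubspace_def by (simp add: bop_simps[OF assms(1)] bop_simps[OF assms(2)])
  qed (simp add: assms)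
  then show "T v = S v" by simp
qed

section \<open>Adjoints of bounded operators\<close>

definition adj :: "('a l2 \<Rightarrow> 'b l2) \<Rightarrow> 'b l2 \<Rightarrow> 'a l2" where
  "adj T w = Abs_l2 (\<lambda>x. cin w (T (ket x)))"

text \<open>Let \<open>u\<close> be the finitely supported vector formed from the wanted
  coefficients on \<open>F\<close>. Pairing \<open>w\<close> with \<open>T u\<close> gives
  \<open>(norm u)^2 \<le> norm w * C * norm u\<close>, hence a bound on every finite partial
  sum.\<close>

lemma adj_aux:
  assumes T: "bop T" and C: "0 \<le> C" "\<And>v. norm (T v) \<le> C * norm v"
  shows "coef (adj T w) = (\<lambda>x. cin w (T (ket x)))" "norm (adj T w) \<le> C * norm w"
proof -
  have *: "(\<Sum>x\<in>F. (cmod (cin w (T (ket x))))\<^sup>2) \<le> (C * norm w)\<^sup>2" if F: "finite F" for F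
  proof -
    define a where "a x = cin w (T (ket x))" for x
    define u where "u = (\<Sum>x\<in>F. cscale (a x) (ket x))"
    define s where "s = (\<Sum>x\<in>F. (cmod (a x))\<^sup>2)"
    have s0: "0 \<le> s" by (simp add: s_def sum_nonneg)
    have coef_u: "coef u y = (if y \<in> F then a y else 0)" for y
      using F by (simp add: u_def if_distrib[of "\<lambda>t. _ * t"] sum.delta cong: if_cong)
    have "(norm u)\<^sup>2 = Re (cin u u)" by (rule norm_sq_cin)
    also have "cin u u = (\<Sum>x\<in>F. a x * cnj (coef u x))"
      by (subst u_def) (simp add: cin_sum_left cin_cscale cin_ket_left)
    also have "\<dots> = of_real s"
      by (simp add: coef_u s_def complex_norm_square del: of_real_power)
    finally have nu: "(norm u)\<^sup>2 = s" by simp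
    have "complex_of_real s = (\<Sum>x\<in>F. cnj (a x) * cin w (T (ket x)))"
      by (simp add: s_def a_def[symmetric] complex_norm_square mult.commute del: of_real_power)
    also have "\<dots> = cin w (T u)"
      by (simp add: u_def bop_simps[OF T] cin_sum_right cin_cscale_right)
    finally have "cmod (complex_of_real s) = cmod (cin w (T u))" by simp
    then have "s = cmod (cin w (T u))" using s0 by simp
    also have "\<dots> \<le> norm w * (C * norm u)"
      using cin_norm_le[of w "T u"] mult_left_mono[OF C(2)[of u], of "norm w"] by simp
    finally have "norm u * norm u \<le> (C * norm w) * norm u"
      by (simp add: nu[symmetric] power2_eq_square mult_ac)
    then have "norm u \<le> C * norm w" using C(1) by (cases "norm u = 0") auto
    then have "(norm u)\<^sup>2 \<le> (C * norm w)\<^sup>2" by (intro power_mono) auto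
    then show ?thesis by (simp add: nu s_def a_def)
  qed
  have "0 \<le> C * norm w" using C by simp
  then show "coef (adj T w) = (\<lambda>x. cin w (T (ket x)))" "norm (adj T w) \<le> C * norm w"
    using Abs_l2_bounded[OF *] by (auto simp: adj_def)
qed

lemma coef_adj: "bop T \<Longrightarrow> coef (adj T w) x = cin w (T (ket x))"
  using adj_aux(1)[of T] bop_bound[of T] by metis

lemma cin_adj:
  assumes "bop T"
  shows "cin (adj T w) v = cin w (T v)"
proof -
  have "v \<in> {v. cin (adj T w) v = cin w (T v)}"
  proof (rule ket_dense)
    show "closed {v. cin (adj T w) v = cin w (T v)}"
      by (intro closed_Collect_eq continuous_intros linear_continuous_on bop_linear assms)
    show "csubspace {v. cin (adj T w) v = cin w (T v)}"
      unfolding csubspace_def by (simp add: bop_simps[OF assms] cin_add_right cin_cscale_right)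
  qed (simp add: cin_ket coef_adj[OF assms])
  then show ?thesis by simp
qed

lemma cin_adj_right: "bop T \<Longrightarrow> cin v (adj T w) = cin (T v) w"
  using cin_adj[of T w v] by (metis cin_sym)

lemma l2_eqI_cin: "(\<And>u. cin v u = cin w u) \<Longrightarrow> v = w"
  by (rule l2_eqI) (metis cin_ket)

lemma bop_adj: assumes "bop T" shows "bop (adj T)"
proof -
  obtain C where C: "C \<ge> 0" "\<And>v. norm (T v) \<le> C * norm v" using bop_bound[OF assms] by blast
  show ?thesis
  proof (rule bopI)
    show "norm (adj T v) \<le> C * norm v" for v using adj_aux(2)[OF assms C] .
    show "adj T (v + w) = adj T v + adj T w" for v w
      by (rule l2_eqI_cin) (simp add: cin_adj[OF assms] cin_add)
    show "adj T (cscale c v) = cscale c (adj T v)" for c v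
      by (rule l2_eqI_cin) (simp add: cin_adj[OF assms] cin_cscale)
  qed
qed

lemma adj_eqI:
  assumes "bop T" "\<And>v w. cin (T v) w = cin v (S w)"
  shows "adj T = S"
proof
  fix w show "adj T w = S w"
    by (rule l2_eqI_cin) (metis assms cin_adj cin_sym)
qed

lemma adj_adj: "bop T \<Longrightarrow> adj (adj T) = T"
  by (rule adj_eqI) (auto simp: bop_adj cin_adj)

lemma adj_comp: "bop T \<Longrightarrow> bop S \<Longrightarrow> adj (T \<circ> S) = adj S \<circ> adj T"
  by (rule adj_eqI) (auto simp: bop_comp cin_adj_right)

section \<open>Isometries given by permuting coordinates and by complex conjugation\<close>

definition lperm :: "('b \<Rightarrow> 'a) \<Rightarrow> 'a l2 \<Rightarrow> 'b l2" where
  "lperm p v = Abs_l2 (\<lambda>x. coef v (p x))"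

lemma coef_lperm [simp]: "bij p \<Longrightarrow> coef (lperm p v) x = coef v (p x)"
  unfolding lperm_def
  by (intro coef_Abs) (use summable_on_reindex_bij_betw[of p UNIV UNIV "\<lambda>x. (cmod (coef v x))\<^sup>2"] coef_summable[of v] in simp)

lemma cin_lperm: "bij p \<Longrightarrow> cin (lperm p v) (lperm p w) = cin v w"
  unfolding cin_def
  using infsum_reindex_bij_betw[of p UNIV UNIV "\<lambda>x. coef v x * cnj (coef w x)"] by simp

lemma norm_lperm [simp]: "bij p \<Longrightarrow> norm (lperm p v) = norm v"
  by (simp add: norm_eq_sqrt_inner inner_l2_def cin_lperm)

lemma bop_lperm: "bij p \<Longrightarrow> bop (lperm p)"
  by (rule bopI[where C = 1]) (auto intro!: l2_eqI)

definition lconj :: "'a l2 \<Rightarrow> 'a l2" where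
  "lconj v = Abs_l2 (\<lambda>x. cnj (coef v x))"

lemma coef_lconj [simp]: "coef (lconj v) x = cnj (coef v x)"
  unfolding lconj_def by (rule coef_Abs) (simp add: coef_summable)

lemma cin_lconj: "cin (lconj v) (lconj w) = cin w v"
  by (simp add: cin_def mult.commute)

lemma norm_lconj [simp]: "norm (lconj v) = norm v"
  by (simp add: norm_eq_sqrt_inner inner_l2_def cin_lconj)

lemma finite_support_expand:
  assumes "finite F" "\<And>x. x \<notin> F \<Longrightarrow> coef v x = 0"
  shows "v = (\<Sum>x\<in>F. cscale (coef v x) (ket x))"
  using assms by (intro l2_eqI) (simp add: if_distrib[of "\<lambda>t. _ * t"] sum.delta cong: if_cong)

lemma finite_support_dense: "(v :: 'a l2) \<in> closure {v. finite {x. coef v x \<noteq> 0}}"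
proof (rule ket_dense)
  have "finite {x. coef (v + w) x \<noteq> 0}"
    if "finite {x. coef v x \<noteq> 0}" "finite {x. coef w x \<noteq> 0}" for v w :: "'a l2"
    by (rule finite_subset[OF _ finite_UnI[OF that]]) auto
  moreover have "finite {x. coef (cscale c v) x \<noteq> 0}" if "finite {x. coef v x \<noteq> 0}" for c and v :: "'a l2"
    by (rule finite_subset[OF _ that]) auto
  ultimately show "csubspace (closure {v :: 'a l2. finite {x. coef v x \<noteq> 0}})"
    by (intro csubspace_closure) (auto simp: csubspace_def)
  show "ket x \<in> closure {v. finite {x. coef v x \<noteq> 0}}" for x
    using closure_subset by (rule subsetD) simp
qed simp

section \<open>Convolution operators of a group\<close>

(* The multiplicative structure lives on a whole type, so that vectors need no support condition. *)
locale ugroup = group G for G (structure) +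
  assumes carrier_UNIV [simp]: "carrier G = UNIV"
begin

lemma mult_eq_iff: "a \<otimes> x = b \<longleftrightarrow> x = inv a \<otimes> b" "x \<otimes> a = b \<longleftrightarrow> x = b \<otimes> inv a"
  by (auto simp: m_assoc) (simp_all add: m_assoc[symmetric])

lemma bij_left: "bij (\<lambda>x. a \<otimes> x)"
  by (rule o_bij[where g = "\<lambda>x. inv a \<otimes> x"]) (simp_all add: fun_eq_iff m_assoc[symmetric])

lemma bij_right: "bij (\<lambda>x. x \<otimes> a)"
  by (rule o_bij[where g = "\<lambda>x. x \<otimes> inv a"]) (simp_all add: fun_eq_iff m_assoc)

lemma bij_inv: "bij (\<lambda>x. inv x)"
  by (rule o_bij[where g = "\<lambda>x. inv x"]) (simp_all add: fun_eq_iff)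

definition lt where "lt g = lperm (\<lambda>x. inv g \<otimes> x)"
definition rt where "rt h = lperm (\<lambda>x. x \<otimes> h)"
text \<open>The modular conjugation of the trace: it sends the vector of an operator in
  \<open>LG\<close> to the vector of its adjoint.\<close>

definition J where "J v = lconj (lperm (\<lambda>x. inv x) v)"

definition cj where "cj g v = lt g (rt g v)"

lemma coef_lt [simp]: "coef (lt g v) x = coef v (inv g \<otimes> x)"
  by (simp add: lt_def bij_left)

lemma coef_rt [simp]: "coef (rt h v) x = coef v (x \<otimes> h)"
  by (simp add: rt_def bij_right)

lemma coef_J [simp]: "coef (J v) x = cnj (coef v (inv x))"
  by (simp add: J_def bij_inv)

lemma coef_cj [simp]: "coef (cj g v) x = coef v (inv g \<otimes> x \<otimes> g)"
  by (simp add: cj_def)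

lemma bop_lt [simp]: "bop (lt g)" by (simp add: lt_def bop_lperm bij_left)
lemma bop_rt [simp]: "bop (rt g)" by (simp add: rt_def bop_lperm bij_right)
lemma bop_cj [simp]: "bop (cj g)"
  using bop_comp[OF bop_lt[of g] bop_rt[of g]] by (simp add: cj_def[abs_def] o_def)

lemma norm_lt [simp]: "norm (lt g v) = norm v" by (simp add: lt_def bij_left)
lemma norm_rt [simp]: "norm (rt g v) = norm v" by (simp add: rt_def bij_right)
lemma norm_J [simp]: "norm (J v) = norm v" by (simp add: J_def bij_inv)
lemma norm_cj [simp]: "norm (cj g v) = norm v" by (simp add: cj_def)

lemma lt_ket [simp]: "lt g (ket x) = ket (g \<otimes> x)"
  by (rule l2_eqI) (auto simp: m_assoc[symmetric])

lemma rt_ket [simp]: "rt h (ket x) = ket (x \<otimes> inv h)"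
  by (rule l2_eqI) (auto simp: m_assoc)

lemma J_ket [simp]: "J (ket x) = ket (inv x)"
  by (rule l2_eqI) auto

lemma lt_lt [simp]: "lt g (lt h v) = lt (g \<otimes> h) v"
  by (rule l2_eqI) (simp add: m_assoc inv_mult_group)

lemma rt_rt [simp]: "rt g (rt h v) = rt (g \<otimes> h) v"
  by (rule l2_eqI) (simp add: m_assoc)

lemma lt_one [simp]: "lt \<one> v = v" by (rule l2_eqI) simp
lemma rt_one [simp]: "rt \<one> v = v" by (rule l2_eqI) simp

lemma lt_rt: "lt g (rt h v) = rt h (lt g v)"
  by (rule l2_eqI) (simp add: m_assoc)

lemma cj_cj [simp]: "cj g (cj h v) = cj (g \<otimes> h) v"
  by (rule l2_eqI) (simp add: m_assoc inv_mult_group)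

lemma cj_one [simp]: "cj \<one> v = v" by (rule l2_eqI) simp

lemma cj_ket: "cj g (ket x) = ket (g \<otimes> x \<otimes> inv g)"
  by (simp add: cj_def m_assoc)

lemma J_J [simp]: "J (J v) = v" by (rule l2_eqI) simp

lemma cin_J: "cin (J v) (J w) = cin w v"
  by (simp add: J_def cin_lconj cin_lperm bij_inv)

lemma cin_J_swap: "cin v (J w) = cin w (J v)"
  using cin_J[of "J v" w] by simp

lemma cin_lt: "cin (lt g v) w = cin v (lt (inv g) w)"
  using cin_lperm[OF bij_left, of "inv g" v "lt (inv g) w"] by (simp add: lt_def[symmetric])

lemma cin_rt: "cin (rt g v) w = cin v (rt (inv g) w)"
  using cin_lperm[OF bij_right, of g v "rt (inv g) w"] by (simp add: rt_def[symmetric])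

lemma cin_cj: "cin (cj g v) w = cin v (cj (inv g) w)"
  by (simp add: cj_def cin_lt cin_rt lt_rt)

lemma adj_lt: "adj (lt g) = lt (inv g)"
  by (rule adj_eqI) (simp_all add: cin_lt)

lemma J_add: "J (v + w) = J v + J w" by (rule l2_eqI) simp

lemma J_scaleR: "J (r *\<^sub>R v) = r *\<^sub>R J v" by (rule l2_eqI) simp

lemma bounded_linear_J: "bounded_linear J"
  by (rule bounded_linear_intro[where K = 1]) (simp_all add: J_add J_scaleR)

lemmas tendsto_J = bounded_linear.tendsto[OF bounded_linear_J]

text \<open>The commutant of the right translations. Its elements act as left convolution by their
  vector \<open>T (ket \<one>)\<close>, called hat in the names of lemmas.\<close>

definition LG where
  "LG = {T. bop T \<and> (\<forall>h v. T (rt h v) = rt h (T v))}"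

definition Ad where "Ad g T = lt g \<circ> T \<circ> lt (inv g)"

lemma LG_bop: "T \<in> LG \<Longrightarrow> bop T" by (simp add: LG_def)

lemma LG_rt: "T \<in> LG \<Longrightarrow> T (rt h v) = rt h (T v)" by (simp add: LG_def)

lemma LG_ket: "T \<in> LG \<Longrightarrow> T (ket x) = rt (inv x) (T (ket \<one>))"
  using LG_rt[of T "inv x" "ket \<one>"] by simp

lemma LG_eqI: "T \<in> LG \<Longrightarrow> S \<in> LG \<Longrightarrow> T (ket \<one>) = S (ket \<one>) \<Longrightarrow> T = S"
  by (rule bop_eqI) (auto simp: LG_bop, metis LG_ket)

lemma LG_adj: assumes "T \<in> LG" shows "adj T \<in> LG"
  unfolding LG_def
proof (safe)
  show "bop (adj T)" using assms by (simp add: LG_bop bop_adj)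
  show "adj T (rt h v) = rt h (adj T v)" for h v
    by (rule l2_eqI_cin) (simp add: cin_adj LG_bop[OF assms] cin_rt LG_rt[OF assms])
qed

lemma LG_id: "id \<in> LG" by (simp add: LG_def)
lemma LG_lt: "lt g \<in> LG" by (simp add: LG_def lt_rt)
lemma LG_comp: "T \<in> LG \<Longrightarrow> S \<in> LG \<Longrightarrow> T \<circ> S \<in> LG" by (simp add: LG_def bop_comp)
lemma LG_add: "T \<in> LG \<Longrightarrow> S \<in> LG \<Longrightarrow> (\<lambda>v. T v + S v) \<in> LG"
  by (simp add: LG_def bop_add bop_simps)
lemma LG_cscale: "T \<in> LG \<Longrightarrow> (\<lambda>v. cscale c (T v)) \<in> LG"
  by (simp add: LG_def bop_cscale bop_simps)
lemma LG_Ad: "T \<in> LG \<Longrightarrow> Ad g T \<in> LG" unfolding Ad_def by (intro LG_comp LG_lt)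

lemma Ad_apply: "Ad g T v = lt g (T (lt (inv g) v))" by (simp add: Ad_def)

lemma Ad_hat: "T \<in> LG \<Longrightarrow> Ad g T (ket \<one>) = cj g (T (ket \<one>))"
  using LG_ket[of T "inv g"] by (simp add: Ad_apply cj_def)

lemma lt_Ad: "lt g (T v) = Ad g T (lt g v)" by (simp add: Ad_apply)

lemma adj_hat: "T \<in> LG \<Longrightarrow> adj T (ket \<one>) = J (T (ket \<one>))"
  by (rule l2_eqI, subst coef_adj[OF LG_bop], assumption, subst LG_ket, assumption) (simp add: cin_ket_left)

lemma adj_ket: "T \<in> LG \<Longrightarrow> adj T (ket x) = rt (inv x) (J (T (ket \<one>)))"
  using LG_ket[OF LG_adj] adj_hat by metis

lemma cin_hat_J: "T \<in> LG \<Longrightarrow> cin (T (ket \<one>)) (J w) = cin (T w) (ket \<one>)"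
  by (metis LG_bop adj_hat cin_J_swap cin_adj_right)

text \<open>Traciality of the vector state at \<open>ket \<one>\<close>: the antiunitary
  \<open>J\<close> implements the adjoint on vectors.\<close>

lemma trace_comm:
  "T \<in> LG \<Longrightarrow> S \<in> LG \<Longrightarrow> cin (T (S (ket \<one>))) (ket \<one>) = cin (S (T (ket \<one>))) (ket \<one>)"
  by (metis cin_hat_J cin_J_swap)

lemma coef_LG:
  assumes "T \<in> LG"
  shows "coef (T v) g = (\<Sum>\<^sub>\<infinity>h. coef v h * coef (T (ket \<one>)) (g \<otimes> inv h))"
proof -
  have "coef (T v) g = cin v (adj T (ket g))"
    by (simp add: cin_ket[symmetric] cin_adj_right LG_bop[OF assms])
  also have "\<dots> = (\<Sum>\<^sub>\<infinity>h. coef v h * coef (T (ket \<one>)) (g \<otimes> inv h))"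
    by (simp add: cin_def adj_ket[OF assms] inv_mult_group)
  finally show ?thesis .
qed

text \<open>Convergence of the vectors suffices, without bounds on operator norms, because a matrix
  coefficient of \<open>T\<close> is the inner product of \<open>v\<close> with a translate of
  \<open>J (T (ket \<one>))\<close>.\<close>

lemma LG_tendsto_coef:
  assumes "\<And>n. f n \<in> LG" "T \<in> LG" "(\<lambda>n. f n (ket \<one>)) \<longlonglongrightarrow> T (ket \<one>)"
  shows "(\<lambda>n. coef (f n v) g) \<longlonglongrightarrow> coef (T v) g"
proof -
  have *: "coef (S v) g = cin v (rt (inv g) (J (S (ket \<one>))))" if "S \<in> LG" for S
    using that by (simp add: cin_ket[symmetric] cin_adj_right[symmetric] LG_bop adj_ket)
  show ?thesis
    unfolding *[OF assms(1)] *[OF assms(2)]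
    by (intro tendsto_cin tendsto_const bounded_linear.tendsto[OF bop_linear[OF bop_rt]] tendsto_J assms)
qed

text \<open>The operator is written down through its adjoint, whose value at \<open>ket x\<close>
  has to be \<open>w x\<close>. Each coefficient of \<open>T v\<close> is then continuous in
  \<open>v\<close>, so the bound over a finite set \<open>A\<close> passes from finitely supported
  vectors to all vectors.\<close>

lemma LG_extend:
  assumes bound: "\<And>F f. finite F \<Longrightarrow>
    norm (\<Sum>h\<in>F. cscale (f h) (rt (inv h) \<xi>)) \<le> norm (\<Sum>h\<in>F. cscale (f h) (ket h))"
  shows "\<exists>T\<in>LG. T (ket \<one>) = \<xi>"
proof -
  define w where "w x = rt (inv x) (J \<xi>)" for x
  define T where "T v = Abs_l2 (\<lambda>x. cin v (w x))" for v
  have bd: "(\<Sum>x\<in>A. (cmod (cin v (w x)))\<^sup>2) \<le> (norm v)\<^sup>2" if A: "finite A" for A v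
  proof -
    have *: "(\<Sum>x\<in>A. (cmod (cin v (w x)))\<^sup>2) \<le> (norm v)\<^sup>2"
      if fin: "finite {x. coef v x \<noteq> 0}" for v
    proof -
      define F where "F = {x. coef v x \<noteq> 0}"
      have v: "v = (\<Sum>h\<in>F. cscale (coef v h) (ket h))"
        using fin by (intro finite_support_expand) (auto simp: F_def)
      define u where "u = (\<Sum>h\<in>F. cscale (coef v h) (rt (inv h) \<xi>))"
      have "cin v (w x) = coef u x" for x
        by (subst v) (simp add: cin_sum_left cin_cscale cin_ket_left w_def u_def inv_mult_group)
      then have "(\<Sum>x\<in>A. (cmod (cin v (w x)))\<^sup>2) \<le> (norm u)\<^sup>2"
        using finite_sum_le_norm_sq[OF A, of u] by simp
      also have "\<dots> \<le> (norm v)\<^sup>2"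
        using bound[of F "coef v"] fin v by (intro power_mono) (auto simp: u_def F_def)
      finally show ?thesis .
    qed
    have "closed {v. (\<Sum>x\<in>A. (cmod (cin v (w x)))\<^sup>2) \<le> (norm v)\<^sup>2}"
      by (intro closed_Collect_le continuous_intros)
    then have "closure {v. finite {x. coef v x \<noteq> 0}} \<subseteq> {v. (\<Sum>x\<in>A. (cmod (cin v (w x)))\<^sup>2) \<le> (norm v)\<^sup>2}"
      using * by (intro closure_minimal) auto
    then show ?thesis using finite_support_dense[of v] by blast
  qed
  have T: "coef (T v) x = cin v (w x)" "norm (T v) \<le> norm v" for v x
    using Abs_l2_bounded[OF bd] by (simp_all add: T_def)
  have "T \<in> LG"
    unfolding LG_def
  proof safe
    show "bop T"
      by (rule bopI[where C = 1]) (auto intro!: l2_eqI simp: T cin_add cin_cscale)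
    show "T (rt h v) = rt h (T v)" for h v
      by (rule l2_eqI) (simp add: T cin_rt w_def inv_mult_group)
  qed
  moreover have "T (ket \<one>) = \<xi>" by (rule l2_eqI) (simp add: T cin_ket_left w_def)
  ultimately show ?thesis by blast
qed

end

text \<open>If \<open>a 1 > a 0\<close>, repeated squaring makes \<open>a (2^k)\<close> grow at
  least like \<open>a 0 * (a 1 / a 0)^(2^k)\<close>, against the bound \<open>C\<close>. It turns a
  crude bound on all powers of a symmetric map into contractivity.\<close>

lemma power_trick:
  fixes a :: "nat \<Rightarrow> real"
  assumes sq: "\<And>n. (a n)\<^sup>2 \<le> a (2 * n) * a 0" and bd: "\<And>n. a n \<le> C" and "0 \<le> a 0"
  shows "a 1 \<le> a 0"
proof (rule ccontr)
  assume "\<not> a 1 \<le> a 0"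
  then have gt: "a 0 < a 1" by simp
  have pos: "0 < a 0"
  proof (rule ccontr)
    assume "\<not> 0 < a 0"
    then have "(a 1)\<^sup>2 \<le> 0" using sq[of 1] \<open>0 \<le> a 0\<close> by simp
    then show False using gt \<open>0 \<le> a 0\<close> by simp
  qed
  define q where "q = a 1 / a 0"
  have q: "1 < q" using gt pos by (simp add: q_def)
  have low: "a 0 * q ^ (2 ^ k) \<le> a (2 ^ k)" for k
  proof (induction k)
    case 0 show ?case using pos by (simp add: q_def)
  next
    case (Suc k)
    have "(a 0 * q ^ (2 ^ k))\<^sup>2 \<le> (a (2 ^ k))\<^sup>2"
      using Suc pos q by (intro power_mono) auto
    also have "\<dots> \<le> a (2 ^ Suc k) * a 0" using sq[of "2 ^ k"] by simp
    finally have "a 0 * (a 0 * q ^ (2 ^ Suc k)) \<le> a 0 * a (2 ^ Suc k)"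
      by (simp add: power2_eq_square mult_ac power_add[symmetric] mult_2)
    then show ?case using pos by simp
  qed
  obtain k where k: "C / a 0 < q ^ k" using real_arch_pow[OF q] by blast
  have "q ^ k \<le> q ^ (2 ^ k)" using q by (intro power_increasing) (auto intro: less_imp_le less_exp)
  with k have "C / a 0 < q ^ (2 ^ k)" by linarith
  then have "C < a 0 * q ^ (2 ^ k)" using pos by (simp add: field_simps)
  then show False using low[of k] bd[of "2 ^ k"] by linarith
qed

section \<open>Invariant subalgebras and their conditional expectations\<close>

text \<open>\<open>P_closed\<close> takes the place of the bicommutant condition: membership of an
  operator of \<open>LG\<close> is decided by its vector. The class is stable under relative
  commutants and intersections.\<close>

locale inv_alg = ugroup G for G (structure) +
  fixes P :: "('a l2 \<Rightarrow> 'a l2) set"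
  assumes P_LG: "P \<subseteq> LG"
    and P_id: "id \<in> P"
    and P_add: "T \<in> P \<Longrightarrow> S \<in> P \<Longrightarrow> (\<lambda>v. T v + S v) \<in> P"
    and P_cscale: "T \<in> P \<Longrightarrow> (\<lambda>v. cscale c (T v)) \<in> P"
    and P_comp: "T \<in> P \<Longrightarrow> S \<in> P \<Longrightarrow> T \<circ> S \<in> P"
    and P_adj: "T \<in> P \<Longrightarrow> adj T \<in> P"
    and P_Ad: "T \<in> P \<Longrightarrow> Ad g T \<in> P"
    and P_closed: "T \<in> LG \<Longrightarrow> T (ket \<one>) \<in> closure ((\<lambda>S. S (ket \<one>)) ` P) \<Longrightarrow> T \<in> P"
begin

lemma PL: "T \<in> P \<Longrightarrow> T \<in> LG" using P_LG by blast

lemma P_bop: "T \<in> P \<Longrightarrow> bop T" by (simp add: PL LG_bop)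

text \<open>The space \<open>L^2(P)\<close>; its projection \<open>e\<close> is the conditional
  expectation on the level of vectors.\<close>

definition K where "K = closure ((\<lambda>S. S (ket \<one>)) ` P)"

lemma hat_K: "T \<in> P \<Longrightarrow> T (ket \<one>) \<in> K"
  unfolding K_def by (rule subsetD[OF closure_subset]) simp

lemma ket_one_K: "ket \<one> \<in> K" using hat_K[OF P_id] by simp

sublocale cs: closed_csubspace K
proof
  show "closed K" by (simp add: K_def)
  show "csubspace K"
    unfolding K_def
  proof (rule csubspace_closure, unfold csubspace_def, intro conjI ballI allI)
    show "0 \<in> (\<lambda>S. S (ket \<one>)) ` P"
      using P_cscale[OF P_id, of 0] by (intro image_eqI[where x = "\<lambda>v. cscale 0 (id v)"]) auto
    fix v c assume "v \<in> (\<lambda>S. S (ket \<one>)) ` P"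
    then obtain T where T: "T \<in> P" "v = T (ket \<one>)" by blast
    show "cscale c v \<in> (\<lambda>S. S (ket \<one>)) ` P"
      using P_cscale[OF T(1), of c] T(2) by (intro image_eqI[where x = "\<lambda>v. cscale c (T v)"]) auto
    fix w assume "w \<in> (\<lambda>S. S (ket \<one>)) ` P"
    then obtain S where S: "S \<in> P" "w = S (ket \<one>)" by blast
    show "v + w \<in> (\<lambda>S. S (ket \<one>)) ` P"
      using P_add[OF T(1) S(1)] T(2) S(2) by (intro image_eqI[where x = "\<lambda>v. T v + S v"]) auto
  qed
qed

lemma K_induct:
  assumes "v \<in> K" "closed {v. Q v}" "\<And>T. T \<in> P \<Longrightarrow> Q (T (ket \<one>))"
  shows "Q v"
proof -
  have "K \<subseteq> {v. Q v}" unfolding K_def using assms by (intro closure_minimal) auto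
  then show ?thesis using assms(1) by blast
qed

lemma K_map:
  assumes "bounded_linear f" "\<And>T. T \<in> P \<Longrightarrow> f (T (ket \<one>)) \<in> K" "v \<in> K"
  shows "f v \<in> K"
proof (rule K_induct[OF assms(3)])
  show "closed {v. f v \<in> K}"
    using continuous_closed_vimage[OF cs.closed, of f] linear_continuous_at[OF assms(1)]
    by (simp add: vimage_def continuous_on_eq_continuous_within)
qed (rule assms)

lemma P_K: "T \<in> P \<Longrightarrow> v \<in> K \<Longrightarrow> T v \<in> K"
  by (rule K_map) (use P_bop bop_linear hat_K[OF P_comp] in auto)

lemma cj_K: "v \<in> K \<Longrightarrow> cj g v \<in> K"
  by (rule K_map) (auto simp: bop_linear Ad_hat[OF PL, symmetric] intro!: hat_K P_Ad)

lemma J_K: "v \<in> K \<Longrightarrow> J v \<in> K"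
  by (rule K_map) (auto simp: bounded_linear_J adj_hat[OF PL, symmetric] intro!: hat_K P_adj)

abbreviation e where "e \<equiv> proj K"

text \<open>\<open>K\<close> is invariant under both \<open>T\<close> and \<open>adj T\<close>, so
  its projection commutes with \<open>T\<close>.\<close>

lemma e_comm: assumes "T \<in> P" shows "e (T v) = T (e v)"
proof (rule cs.proj_eqI)
  show "T (e v) \<in> K" using assms by (simp add: P_K)
  fix k assume "k \<in> K"
  then have "adj T k \<in> K" using assms by (simp add: P_K P_adj)
  then show "cin (T (e v)) k = cin (T v) k"
    by (simp add: cin_adj_right[OF P_bop[OF assms], symmetric] cs.cin_proj)
qed

lemma e_cj: "e (cj g v) = cj g (e v)"
  by (rule cs.proj_eqI) (simp_all add: cj_K cin_cj cs.cin_proj)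

lemma e_J: "e (J v) = J (e v)"
proof (rule cs.proj_eqI)
  fix k assume k: "k \<in> K"
  have "cin (J (e v)) k = cin (J k) (e v)" using cin_J[of "e v" "J k"] by simp
  also have "\<dots> = cin (J k) v" using k by (simp add: cs.cin_proj J_K)
  also have "\<dots> = cin (J v) k" using cin_J[of "v" "J k"] by simp
  finally show "cin (J (e v)) k = cin (J v) k" .
qed (simp add: J_K)

definition xi where "xi g = e (ket g)"

lemma xi_K [simp]: "xi g \<in> K" by (simp add: xi_def)

lemma J_xi: "J (xi g) = xi (inv g)" by (simp add: xi_def e_J[symmetric])

lemma cj_xi: "cj h (xi g) = xi (h \<otimes> g \<otimes> inv h)"
  by (simp add: xi_def e_cj[symmetric] cj_ket)

lemma norm_sq_xi: "complex_of_real ((norm (xi g))\<^sup>2) = coef (xi g) g"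
proof -
  have "cin (xi g) (xi g) = coef (xi g) g"
    using cs.cin_proj(2)[of "xi g" "ket g"] by (simp add: cin_ket xi_def)
  then show ?thesis by (simp only: cin_self_norm)
qed

lemma xi_eq_0I: "coef (xi g) g = 0 \<Longrightarrow> xi g = 0"
  using norm_sq_xi[of g] by simp

lemma coef_K: "v \<in> K \<Longrightarrow> coef v g = cin v (xi g)"
  by (simp add: xi_def cs.cin_proj cin_ket)

lemma norm_xi_conj: "norm (xi (h \<otimes> g \<otimes> inv h)) = norm (xi g)"
  by (simp add: cj_xi[symmetric])

text \<open>Invariance of \<open>P\<close> enters here: \<open>lt g\<close> turns \<open>T\<close>
  into \<open>Ad g T\<close>, which is again in \<open>P\<close> and so passes through
  \<open>e\<close>.\<close>

lemma e_lt: "T \<in> P \<Longrightarrow> e (lt g (T (ket \<one>))) = Ad g T (xi g)"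
  by (simp add: lt_Ad e_comm[OF P_Ad] xi_def)

text \<open>The projection of \<open>lt g (p (ket \<one>))\<close> is \<open>Ad g p\<close> applied
  to \<open>xi g\<close>. Traciality and \<open>J (xi m) = xi (inv m)\<close> let the projection
  change place from \<open>ket g\<close> to \<open>ket (inv m)\<close>. The translation
  \<open>rt m\<close> is carried along because the compressions will be compared in semi-inner
  products built from right translations.\<close>

lemma form_symmetric_hat:
  assumes p: "p \<in> P" and q: "q \<in> P"
  shows "cin (rt m (e (lt g (p (ket \<one>))))) (q (ket \<one>)) = cin (rt m (p (ket \<one>))) (e (lt (inv g) (q (ket \<one>))))"
proof -
  define p' where "p' = Ad g p"
  define k where "k = adj q \<circ> p'"
  have p': "p' \<in> P" and k: "k \<in> P" using p q by (simp_all add: p'_def k_def P_Ad P_comp P_adj)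
  note qa = cin_adj[OF P_bop[OF q], symmetric] cin_adj_right[OF P_bop[OF q], symmetric]
  have kq: "cin (p' v) (q (ket \<one>)) = cin (k v) (ket \<one>)" for v
    by (simp add: k_def cin_adj[OF P_bop[OF q]])
  have "cin (rt m (e (lt g (p (ket \<one>))))) (q (ket \<one>)) = cin (p' (rt m (xi g))) (q (ket \<one>))"
    using p by (simp add: e_lt p'_def LG_rt[OF PL[OF P_Ad]])
  also have "\<dots> = cin (rt m (k (xi g))) (ket \<one>)"
    by (simp add: kq LG_rt[OF PL[OF k]])
  also have "\<dots> = cin (e (k (ket g))) (ket m)"
    by (simp add: cin_rt xi_def e_comm[OF k])
  also have "\<dots> = cin ((k \<circ> lt g) (ket \<one>)) (J (xi (inv m)))"
    by (simp add: cs.cin_proj_swap J_xi) (simp add: xi_def)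
  also have "\<dots> = cin (k (lt g (xi (inv m)))) (ket \<one>)"
    by (subst cin_hat_J) (simp_all add: LG_comp LG_lt PL[OF k])
  also have "\<dots> = cin (p' (lt g (xi (inv m)))) (q (ket \<one>))" by (simp add: kq)
  also have "\<dots> = cin (lt g (p (xi (inv m)))) (q (ket \<one>))" by (simp add: p'_def lt_Ad)
  also have "\<dots> = cin (e (rt m (p (ket \<one>)))) (lt (inv g) (q (ket \<one>)))"
    by (simp add: cin_lt LG_rt[OF PL[OF p], symmetric] e_comm[OF p] xi_def)
  also have "\<dots> = cin (rt m (p (ket \<one>))) (e (lt (inv g) (q (ket \<one>))))"
    by (rule cs.cin_proj_swap)
  finally show ?thesis .
qed

lemma form_symmetric:
  assumes "u \<in> K" "v \<in> K"
  shows "cin (rt m (e (lt g u))) v = cin (rt m u) (e (lt (inv g) v))"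
proof -
  note ci = continuous_intros linear_continuous_on[OF bop_linear[OF bop_rt]]
    linear_continuous_on[OF bop_linear[OF bop_lt]] continuous_on_compose2[OF linear_continuous_on[OF bop_linear[OF bop_rt[of m]]], of UNIV]
    continuous_on_compose2[OF linear_continuous_on[OF cs.bounded_linear_proj], of UNIV]
  have *: "cin (rt m (e (lt g u))) (q (ket \<one>)) = cin (rt m u) (e (lt (inv g) (q (ket \<one>))))"
    if q: "q \<in> P" for q
    using assms(1)
    by (rule K_induct) (auto intro!: closed_Collect_eq ci form_symmetric_hat[OF _ q])
  show ?thesis
    using assms(2) by (rule K_induct) (auto intro!: closed_Collect_eq ci *)
qed

text \<open>Left convolution by \<open>xi g\<close> is bounded: the compression \<open>e \<circ> lt g\<close> of \<open>K\<close> is a contraction that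
  has an adjoint for each of the semi-inner products \<open>cin (R u) (R v)\<close>, where \<open>R\<close> is a finite
  combination of right translations, so it is a contraction for them too.\<close>

lemma xi_bounded:
  assumes "finite F"
  shows "norm (\<Sum>h\<in>F. cscale (f h) (rt (inv h) (xi g))) \<le> norm (\<Sum>h\<in>F. cscale (f h) (ket h))"
proof -
  define R where "R v = (\<Sum>h\<in>F. cscale (f h) (rt (inv h) v))" for v
  define X where "X g v = e (lt g v)" for g v
  define Y where "Y v = X (inv g) (X g v)" for v
  define w where "w n = (Y ^^ n) (ket \<one>)" for n
  have X_K: "X g v \<in> K" for g v by (simp add: X_def)
  have X_le: "norm (X g v) \<le> norm v" for g v
    using cs.norm_proj_le[of "lt g v"] by (simp add: X_def)
  have form: "cin (R (X g u)) (R v) = cin (R u) (R (X (inv g) v))" if uv: "u \<in> K" "v \<in> K" for g u v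
  proof -
    \<comment> \<open>Moving one translation across leaves a single one, by
      \<open>inv b \<otimes> a\<close>, so \<open>form_symmetric\<close> applies term by
      term.\<close>
    have *: "cin (rt a u) (rt b v) = cin (rt (inv b \<otimes> a) u) v" for a b u v
      using cin_rt[of "inv b" "rt a u" v] by simp
    show ?thesis
      by (simp add: R_def cin_sum_left cin_sum_right cin_cscale cin_cscale_right * X_def form_symmetric[OF uv])
  qed
  have Y_K: "Y v \<in> K" for v by (simp add: Y_def X_K)
  have w_K: "w n \<in> K" for n
    by (induction n) (auto simp: w_def Y_K ket_one_K)
  have Y_form: "cin (R (Y u)) (R v) = cin (R u) (R (Y v))" if "u \<in> K" "v \<in> K" for u v
    using that form[of "X g u" v "inv g"] form[of u "X g v" g] by (simp add: Y_def X_K)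
  have Yn_form: "cin (R ((Y ^^ n) u)) (R v) = cin (R u) (R ((Y ^^ n) v))" if "u \<in> K" "v \<in> K" for u v n
    using that
  proof (induction n arbitrary: u v)
    case (Suc n)
    have "(Y ^^ n) u \<in> K" using Suc.prems by (cases n) (auto simp: Y_K)
    then have "cin (R ((Y ^^ Suc n) u)) (R v) = cin (R u) (R ((Y ^^ n) (Y v)))"
      using Suc by (simp add: Y_form Y_K)
    then show ?case by (simp add: funpow_swap1)
  qed simp
  \<comment> \<open>By symmetry of \<open>Y\<close>, \<open>a (2 * n)\<close> is the squared
    seminorm of \<open>w n\<close>, and Cauchy-Schwarz gives the hypothesis of
    \<open>power_trick\<close>. The resulting \<open>a 1 \<le> a 0\<close> is the square of the
    claim.\<close>
  define a where "a n = Re (cin (R (w n)) (R (ket \<one>)))" for n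
  have a2: "a (2 * n) = (norm (R (w n)))\<^sup>2" for n
  proof -
    have "w (2 * n) = (Y ^^ n) (w n)" by (simp add: w_def mult_2 funpow_add)
    then show ?thesis
      using Yn_form[OF w_K ket_one_K, of n n] by (simp add: a_def norm_sq_cin w_def)
  qed
  have a0: "a 0 = (norm (R (ket \<one>)))\<^sup>2" using a2[of 0] by (simp add: w_def)
  have a1: "a 1 = (norm (R (xi g)))\<^sup>2"
    using form[of "X g (ket \<one>)" "ket \<one>" "inv g"]
    by (simp add: a_def w_def Y_def norm_sq_cin ket_one_K X_K) (simp add: X_def xi_def)
  have R_bop: "bounded_linear R"
    unfolding R_def
    by (intro bounded_linear_sum bounded_linear_compose[OF bounded_linear_cscale] bop_linear bop_rt)
  then obtain C where C: "C \<ge> 0" "\<And>v. norm (R v) \<le> C * norm v"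
    using bounded_linear.nonneg_bounded[OF R_bop] by (metis mult.commute)
  have w_le: "norm (w n) \<le> 1" for n
  proof (induction n)
    case (Suc n)
    have "norm (Y (w n)) \<le> norm (w n)" using X_le order_trans by (simp add: Y_def) blast
    then show ?case using Suc by (simp add: w_def)
  qed (simp add: w_def)
  have le_mult: "a n \<le> norm (R (w n)) * norm (R (ket \<one>))" "\<bar>a n\<bar> \<le> norm (R (w n)) * norm (R (ket \<one>))" for n
    using norm_cauchy_schwarz[of "R (w n)" "R (ket \<one>)"] Cauchy_Schwarz_ineq2[of "R (w n)" "R (ket \<one>)"]
    by (simp_all add: a_def inner_l2_def)
  have "a 1 \<le> a 0"
  proof (rule power_trick)
    show "(a n)\<^sup>2 \<le> a (2 * n) * a 0" for n
      using power_mono[OF le_mult(2)[of n], of 2] by (simp add: a2 a0 power_mult_distrib)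
    show "0 \<le> a 0" by (simp add: a0)
    show "a n \<le> C * C" for n
    proof -
      have "norm (R (w n)) \<le> C" using C w_le[of n] mult_left_mono[OF w_le[of n] C(1)] by (metis mult.right_neutral order_trans)
      moreover have "norm (R (ket \<one>)) \<le> C" using C(2)[of "ket \<one>"] by simp
      ultimately have "norm (R (w n)) * norm (R (ket \<one>)) \<le> C * C" using C(1) by (intro mult_mono) auto
      then show ?thesis using le_mult(1)[of n] by linarith
    qed
  qed
  then have "norm (R (xi g)) \<le> norm (R (ket \<one>))"
    unfolding a0 a1 by (rule power2_le_imp_le) simp
  then show ?thesis by (simp add: R_def)
qed

definition E where "E g = (SOME T. T \<in> P \<and> T (ket \<one>) = xi g)"

lemma E: "E g \<in> P" "E g (ket \<one>) = xi g"
proof -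
  obtain T where "T \<in> LG" "T (ket \<one>) = xi g" using LG_extend[OF xi_bounded] by blast
  moreover from this have "T \<in> P" by (intro P_closed) (simp_all add: K_def[symmetric])
  ultimately show "E g \<in> P" "E g (ket \<one>) = xi g"
    unfolding E_def using someI[of "\<lambda>T. T \<in> P \<and> T (ket \<one>) = xi g" T] by auto
qed

text \<open>Traciality moves \<open>T\<close> to the other side of the inner product as
  \<open>adj T\<close>, for \<open>E g\<close> as well as for \<open>lt g\<close>. The test vector
  stays in \<open>K\<close>, and against vectors of \<open>K\<close> there is no difference between
  \<open>xi g\<close> and \<open>ket g\<close>.\<close>

lemma E_hat: assumes T: "T \<in> P" shows "E g (T (ket \<one>)) = e (lt g (T (ket \<one>)))"
proof (rule cs.proj_eqI[symmetric])
  show "E g (T (ket \<one>)) \<in> K" using hat_K[OF P_comp[OF E(1) T]] by simp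
  have swap: "cin (U (T (ket \<one>))) (S (ket \<one>)) = cin (U (ket \<one>)) (S (adj T (ket \<one>)))"
    if U: "U \<in> LG" and S: "S \<in> P" for U S
  proof -
    have "cin (U (T (ket \<one>))) (S (ket \<one>)) = cin ((adj S \<circ> U) (T (ket \<one>))) (ket \<one>)"
      by (simp add: cin_adj[OF P_bop[OF S]])
    also have "\<dots> = cin (T ((adj S \<circ> U) (ket \<one>))) (ket \<one>)"
      by (rule trace_comm[OF LG_comp[OF PL[OF P_adj[OF S]] U] PL[OF T]])
    also have "\<dots> = cin (U (ket \<one>)) (S (adj T (ket \<one>)))"
      by (simp add: cin_adj_right[OF P_bop[OF T], symmetric] cin_adj[OF P_bop[OF S]])
    finally show ?thesis .
  qed
  fix k assume "k \<in> K"
  then show "cin (E g (T (ket \<one>))) k = cin (lt g (T (ket \<one>))) k"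
  proof (rule K_induct)
    fix S assume S: "S \<in> P"
    have "S (adj T (ket \<one>)) \<in> K" by (rule P_K[OF S hat_K[OF P_adj[OF T]]])
    then show "cin (E g (T (ket \<one>))) (S (ket \<one>)) = cin (lt g (T (ket \<one>))) (S (ket \<one>))"
      by (simp add: swap[OF PL[OF E(1)] S] swap[OF LG_lt S] E(2) xi_def cs.cin_proj)
  qed (intro closed_Collect_eq continuous_intros)
qed

text \<open>Both sides have the vector \<open>e (lt g (T (ket \<one>)))\<close>.\<close>

lemma E_comm: assumes "T \<in> P" shows "E g \<circ> T = Ad g T \<circ> E g"
  using assms by (intro LG_eqI LG_comp) (simp_all add: PL E P_Ad E_hat e_lt)

end

section \<open>Relative commutants and the alternative for the two expectations\<close>

context ugroup
begin

definition cm where "cm P = {T \<in> LG. \<forall>S\<in>P. T \<circ> S = S \<circ> T}"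

lemma cmD: "T \<in> cm P \<Longrightarrow> S \<in> P \<Longrightarrow> T \<circ> S = S \<circ> T" by (simp add: cm_def)

text \<open>It makes every fact about \<open>P\<close> available for \<open>cm P\<close> and
  \<open>cm (cm P)\<close>. Closedness holds because commutation can be tested on matrix
  coefficients, which follow the convergence of vectors.\<close>

lemma inv_alg_cm:
  assumes "inv_alg G P" shows "inv_alg G (cm P)"
proof -
  interpret P: inv_alg G P by fact
  show ?thesis
  proof
    show "cm P \<subseteq> LG" by (auto simp: cm_def)
    show "id \<in> cm P" by (simp add: cm_def LG_id)
    fix T assume T: "T \<in> cm P"
    then have TL: "T \<in> LG" and Tc: "\<And>S v. S \<in> P \<Longrightarrow> T (S v) = S (T v)"
      by (auto simp: cm_def fun_eq_iff)
    show "(\<lambda>v. cscale c (T v)) \<in> cm P" for c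
      using TL Tc by (auto simp: cm_def LG_cscale fun_eq_iff bop_simps[OF P.P_bop])
    show "adj T \<in> cm P"
      unfolding cm_def
    proof safe
      fix S assume S: "S \<in> P"
      have "adj (adj S \<circ> T) = adj (T \<circ> adj S)" using Tc[OF P.P_adj[OF S]] by (simp add: fun_eq_iff o_def)
      then show "adj T \<circ> S = S \<circ> adj T"
        using S TL by (simp add: adj_comp adj_adj LG_bop bop_adj P.P_bop)
    qed (simp add: LG_adj TL)
    show "Ad g T \<in> cm P" for g
      unfolding cm_def
    proof safe
      fix S assume S: "S \<in> P"
      show "Ad g T \<circ> S = S \<circ> Ad g T"
      proof
        fix v
        have "T (Ad (inv g) S (lt (inv g) v)) = Ad (inv g) S (T (lt (inv g) v))"
          by (intro Tc P.P_Ad S)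
        then show "(Ad g T \<circ> S) v = (S \<circ> Ad g T) v"
          by (simp add: Ad_apply)
      qed
    qed (simp add: LG_Ad TL)
    fix S assume S: "S \<in> cm P"
    then have SL: "S \<in> LG" and Sc: "\<And>U v. U \<in> P \<Longrightarrow> S (U v) = U (S v)"
      by (auto simp: cm_def fun_eq_iff)
    show "(\<lambda>v. T v + S v) \<in> cm P"
      using TL Tc SL Sc by (auto simp: cm_def LG_add fun_eq_iff bop_simps[OF P.P_bop])
    show "T \<circ> S \<in> cm P"
      using TL Tc SL Sc by (auto simp: cm_def LG_comp fun_eq_iff)
  next
    fix T assume T: "T \<in> LG" and cl: "T (ket \<one>) \<in> closure ((\<lambda>S. S (ket \<one>)) ` cm P)"
    then obtain y where y: "\<And>n. y n \<in> (\<lambda>S. S (ket \<one>)) ` cm P" "y \<longlonglongrightarrow> T (ket \<one>)"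
      unfolding closure_sequential by blast
    have "\<exists>S. S \<in> cm P \<and> S (ket \<one>) = y n" for n using y(1)[of n] by force
    then obtain f where f_y: "\<And>n. f n \<in> cm P" "\<And>n. f n (ket \<one>) = y n" by metis
    then have f: "\<And>n. f n \<in> cm P" "(\<lambda>n. f n (ket \<one>)) \<longlonglongrightarrow> T (ket \<one>)"
      using y(2) by simp_all
    have fL: "f n \<in> LG" for n using f(1) by (auto simp: cm_def)
    show "T \<in> cm P"
      unfolding cm_def
    proof safe
      fix S assume S: "S \<in> P"
      show "T \<circ> S = S \<circ> T"
      proof (rule LG_eqI)
        show "(T \<circ> S) (ket \<one>) = (S \<circ> T) (ket \<one>)"
        proof (rule l2_eqI)
          fix x
          have "(\<lambda>n. coef (f n (S (ket \<one>))) x) \<longlonglongrightarrow> coef (T (S (ket \<one>))) x"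
            by (rule LG_tendsto_coef[OF fL T f(2)])
          moreover have "f n (S (ket \<one>)) = S (f n (ket \<one>))" for n
            using cmD[OF f(1) S] by (simp add: fun_eq_iff)
          moreover have "(\<lambda>n. coef (S (f n (ket \<one>))) x) \<longlonglongrightarrow> coef (S (T (ket \<one>))) x"
            unfolding cin_ket[symmetric]
            by (intro tendsto_cin tendsto_const bounded_linear.tendsto[OF bop_linear[OF P.P_bop[OF S]]] f)
          ultimately show "coef ((T \<circ> S) (ket \<one>)) x = coef ((S \<circ> T) (ket \<one>)) x"
            using LIMSEQ_unique by simp
        qed
      qed (intro LG_comp T P.PL[OF S])+
    qed (rule T)
  qed
qed

lemma inv_alg_Int:
  assumes "inv_alg G P" "inv_alg G Q" shows "inv_alg G (P \<inter> Q)"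
proof -
  interpret P: inv_alg G P by fact
  interpret Q: inv_alg G Q by fact
  show ?thesis
  proof
    fix T assume T: "T \<in> LG" "T (ket \<one>) \<in> closure ((\<lambda>S. S (ket \<one>)) ` (P \<inter> Q))"
    have "closure ((\<lambda>S. S (ket \<one>)) ` (P \<inter> Q)) \<subseteq> closure ((\<lambda>S. S (ket \<one>)) ` P)"
      "closure ((\<lambda>S. S (ket \<one>)) ` (P \<inter> Q)) \<subseteq> closure ((\<lambda>S. S (ket \<one>)) ` Q)"
      by (auto intro!: closure_mono)
    then show "T \<in> P \<inter> Q" using T P.P_closed Q.P_closed by blast
  qed (use P.P_LG in \<open>auto simp: P.P_id Q.P_id P.P_add Q.P_add P.P_cscale Q.P_cscale P.P_comp Q.P_comp
      P.P_adj Q.P_adj P.P_Ad Q.P_Ad\<close>)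
qed

definition comm_set where "comm_set P Q \<longleftrightarrow> (\<forall>T\<in>P. \<forall>S\<in>Q. T \<circ> S = S \<circ> T)"

definition trivial_alg where "trivial_alg P \<longleftrightarrow> (\<forall>T\<in>P. \<forall>g. g \<noteq> \<one> \<longrightarrow> coef (T (ket \<one>)) g = 0)"

lemma trivial_algD:
  assumes "trivial_alg P" "T \<in> P" "P \<subseteq> LG"
  shows "T v = cscale (coef (T (ket \<one>)) \<one>) v"
proof -
  have "T = (\<lambda>v. cscale (coef (T (ket \<one>)) \<one>) (id v))"
  proof (rule LG_eqI)
    show "T (ket \<one>) = cscale (coef (T (ket \<one>)) \<one>) (id (ket \<one>))"
      using assms by (intro l2_eqI) (auto simp: trivial_alg_def)
  qed (use assms LG_cscale[OF LG_id] in auto)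
  then show ?thesis by (metis id_apply)
qed

lemma (in inv_alg) shift_E_cm: "lt (inv g) \<circ> E g \<in> cm P"
  unfolding cm_def
proof safe
  fix S assume S: "S \<in> P"
  show "lt (inv g) \<circ> E g \<circ> S = S \<circ> (lt (inv g) \<circ> E g)"
  proof
    fix v
    have "E g (S v) = Ad g S (E g v)" using E_comm[OF S] by (simp add: fun_eq_iff)
    then show "(lt (inv g) \<circ> E g \<circ> S) v = (S \<circ> (lt (inv g) \<circ> E g)) v" by (simp add: Ad_apply)
  qed
qed (intro LG_comp LG_lt PL E)

text \<open>With \<open>s = lt (inv g) \<circ> p\<close>, the operator
  \<open>T = N.E g \<circ> s\<close> is central in \<open>cm P\<close>, hence scalar, and its trace
  is that of \<open>lt g\<close>, namely 0. Also \<open>p \<circ> adj p\<close> is central in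
  \<open>P\<close>, hence the scalar \<open>(norm (P.xi g))^2\<close>. Multiplying
  \<open>T = 0\<close> on the right by \<open>adj p\<close> leaves this scalar times
  \<open>N.E g \<circ> lt (inv g)\<close>, so one of the two factors is 0.\<close>

lemma xi_or_xi_cm_eq_0:
  assumes P: "inv_alg G P" and g: "g \<noteq> \<one>"
    and center: "\<And>Q. inv_alg G Q \<Longrightarrow> comm_set Q Q \<Longrightarrow> trivial_alg Q"
  shows "inv_alg.xi G P g = 0 \<or> inv_alg.xi G (cm P) g = 0"
proof -
  interpret P: inv_alg G P by fact
  interpret N: inv_alg G "cm P" by (rule inv_alg_cm[OF P])
  interpret N2: inv_alg G "cm (cm P)" by (rule inv_alg_cm[OF N.inv_alg_axioms])
  define p where "p = P.E g"
  define s where "s = lt (inv g) \<circ> p"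
  have p: "p \<in> P" "p (ket \<one>) = P.xi g" by (simp_all add: p_def P.E)
  have s: "s \<in> cm P" unfolding s_def p_def by (rule P.shift_E_cm)
  have lt_s: "lt g (s v) = p v" for v by (simp add: s_def)
  define T where "T = N.E g \<circ> s"
  have T: "T \<in> cm P" unfolding T_def by (intro N.P_comp N.E s)
  have T_hat: "T (n (ket \<one>)) = N.e (p (n (ket \<one>)))" if n: "n \<in> cm P" for n
    using N.E_hat[OF N.P_comp[OF s n], of g] by (simp add: T_def lt_s)
  have "T \<in> cm (cm P)"
    unfolding cm_def[of "cm P"]
  proof safe
    fix n assume n: "n \<in> cm P"
    show "T \<circ> n = n \<circ> T"
    proof (rule LG_eqI)
      have "p (n (ket \<one>)) = n (p (ket \<one>))" using cmD[OF n p(1)] by (metis comp_apply)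
      then show "(T \<circ> n) (ket \<one>) = (n \<circ> T) (ket \<one>)"
        using T_hat[OF n] T_hat[OF N.P_id] by (simp add: N.e_comm[OF n])
    qed (intro LG_comp N.PL[OF T] N.PL[OF n])+
  qed (rule N.PL[OF T])
  moreover have "trivial_alg (cm P \<inter> cm (cm P))"
    by (rule center[OF inv_alg_Int[OF N.inv_alg_axioms N2.inv_alg_axioms]])
      (auto simp: comm_set_def intro: cmD)
  ultimately have T_scalar: "T v = cscale (coef (T (ket \<one>)) \<one>) v" for v
    using T by (intro trivial_algD[of "cm P \<inter> cm (cm P)"]) (auto simp: N.PL)
  have T_one: "coef (T (ket \<one>)) \<one> = 0"
  proof -
    have "coef (T (ket \<one>)) \<one> = cin (N.e (p (ket \<one>))) (ket \<one>)"
      using T_hat[OF N.P_id] by (simp add: cin_ket)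
    also have "\<dots> = cin (P.xi g) (ket \<one>)" by (simp add: N.cs.cin_proj N.ket_one_K p)
    also have "\<dots> = cin (ket g) (ket \<one>)" by (simp add: P.xi_def P.cs.cin_proj P.ket_one_K)
    finally show ?thesis using g by (simp add: cin_ket)
  qed
  have T0: "N.E g (s v) = 0" for v
    using T_scalar[of v] unfolding T_one by (simp add: T_def)
  have "p \<circ> adj p \<in> P" by (intro P.P_comp P.P_adj p)
  \<comment> \<open>The same element is \<open>Ad g (s \<circ> adj s)\<close>, and \<open>s\<close>
    lies in \<open>cm P\<close>.\<close>
  moreover have "p \<circ> adj p \<in> cm P"
  proof -
    have "adj p = adj (lt g \<circ> s)" by (simp add: s_def o_def)
    then have "p \<circ> adj p = Ad g (s \<circ> adj s)"
      using N.PL[OF s] by (simp add: adj_comp LG_bop adj_lt Ad_def fun_eq_iff lt_s)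
    then show ?thesis using N.P_Ad[OF N.P_comp[OF s N.P_adj[OF s]]] by simp
  qed
  moreover have "trivial_alg (P \<inter> cm P)"
    by (rule center[OF inv_alg_Int[OF P N.inv_alg_axioms]]) (auto simp: comm_set_def intro: cmD[symmetric])
  ultimately have pp: "p (adj p v) = cscale (coef (p (adj p (ket \<one>))) \<one>) v" for v
    using trivial_algD[of "P \<inter> cm P" "p \<circ> adj p"] P.PL by auto
  have lam: "coef (p (adj p (ket \<one>))) \<one> = of_real ((norm (P.xi g))\<^sup>2)"
  proof -
    have "coef (p (adj p (ket \<one>))) \<one> = cin (adj p (ket \<one>)) (adj p (ket \<one>))"
      by (simp add: cin_ket[symmetric] cin_adj_right[OF P.P_bop[OF p(1)]])
    also have "\<dots> = of_real ((norm (P.xi g))\<^sup>2)"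
      by (simp add: cin_self_norm adj_hat[OF P.PL[OF p(1)]] p(2))
    finally show ?thesis .
  qed
  have "0 = N.E g (s (adj p (ket g)))" by (simp add: T0)
  also have "s (adj p (ket g)) = cscale (of_real ((norm (P.xi g))\<^sup>2)) (ket \<one>)"
    by (simp add: s_def pp[of "ket g"] lam bop_simps[OF bop_lt])
  finally have "cscale (of_real ((norm (P.xi g))\<^sup>2)) (N.xi g) = 0"
    by (simp add: bop_simps[OF N.P_bop[OF N.E(1)]] N.E(2))
  then have "norm (cscale (of_real ((norm (P.xi g))\<^sup>2)) (N.xi g)) = 0" by simp
  then show ?thesis by simp
qed

end

section \<open>Conjugation by a subgroup with infinite conjugacy classes\<close>

text \<open>Used for vectors fixed by a family of conjugations, which are constant along
  orbits.\<close>

lemma l2_constant_on_infinite: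
  assumes "infinite X" "\<And>x. x \<in> X \<Longrightarrow> coef v x = c"
  shows "c = 0"
proof (rule ccontr)
  assume c: "c \<noteq> 0"
  obtain n :: nat where n: "(norm v)\<^sup>2 / (cmod c)\<^sup>2 < n" using reals_Archimedean2 by blast
  obtain F where F: "finite F" "F \<subseteq> X" "card F = n"
    using infinite_arbitrarily_large[OF assms(1)] by blast
  have "(\<Sum>x\<in>F. (cmod (coef v x))\<^sup>2) = (\<Sum>x\<in>F. (cmod c)\<^sup>2)"
    using F assms(2) by (intro sum.cong) auto
  then have "n * (cmod c)\<^sup>2 \<le> (norm v)\<^sup>2"
    using finite_sum_le_norm_sq[OF F(1), of v] F by simp
  then show False using n c by (simp add: divide_less_eq)
qed

section \<open>Truncation to a set of coordinates\<close>

definition trunc :: "'a set \<Rightarrow> 'a l2 \<Rightarrow> 'a l2" where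
  "trunc F v = Abs_l2 (\<lambda>x. if x \<in> F then coef v x else 0)"

lemma trunc_aux:
  assumes "finite A"
  shows "(\<Sum>x\<in>A. (cmod (if x \<in> F then coef v x else 0))\<^sup>2) \<le> (norm v)\<^sup>2"
proof -
  have "(\<Sum>x\<in>A. (cmod (if x \<in> F then coef v x else 0))\<^sup>2) \<le> (\<Sum>x\<in>A. (cmod (coef v x))\<^sup>2)"
    by (intro sum_mono) auto
  also have "\<dots> \<le> (norm v)\<^sup>2" by (rule finite_sum_le_norm_sq[OF assms])
  finally show ?thesis .
qed

lemma coef_trunc [simp]: "coef (trunc F v) x = (if x \<in> F then coef v x else 0)"
  using Abs_l2_bounded(1)[OF trunc_aux[where F = F and v = v]] by (simp add: trunc_def)

lemma norm_trunc_le: "norm (trunc F v) \<le> norm v"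
  using Abs_l2_bounded(2)[OF trunc_aux[where F = F and v = v]] by (simp add: trunc_def)

lemma trunc_approx:
  assumes "0 < \<epsilon>"
  shows "\<exists>F. finite F \<and> x0 \<in> F \<and> norm (v - trunc F v) < \<epsilon>"
proof -
  obtain u where u: "finite {x. coef u x \<noteq> 0}" "dist u v < \<epsilon>"
    using finite_support_dense[of v] assms unfolding closure_approachable by auto
  define F where "F = insert x0 {x. coef u x \<noteq> 0}"
  have "v - trunc F v = trunc (- F) (v - u)"
    by (rule l2_eqI) (auto simp: F_def)
  then have "norm (v - trunc F v) \<le> norm (v - u)" by (simp add: norm_trunc_le)
  then show ?thesis using u by (intro exI[of _ F]) (auto simp: F_def dist_norm norm_minus_commute)
qed

locale icc_subgroup = ugroup G for G (structure) +
  fixes \<Gamma>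
  assumes sub: "subgroup \<Gamma> G"
    and infinite_orbit: "x \<in> \<Gamma> \<Longrightarrow> x \<noteq> \<one> \<Longrightarrow> infinite ((\<lambda>g. g \<otimes> x \<otimes> inv g) ` \<Gamma>)"
begin

lemmas \<Gamma>_mult = subgroup.m_closed[OF sub]
lemmas \<Gamma>_inv = subgroup.m_inv_closed[OF sub]
lemmas \<Gamma>_one = subgroup.one_closed[OF sub]

lemma cj_support:
  assumes "\<And>x. x \<notin> \<Gamma> \<Longrightarrow> coef v x = 0" "g \<in> \<Gamma>" "x \<notin> \<Gamma>"
  shows "coef (cj g v) x = 0"
proof -
  have "inv g \<otimes> x \<otimes> g \<notin> \<Gamma>"
  proof
    assume "inv g \<otimes> x \<otimes> g \<in> \<Gamma>"
    then have "g \<otimes> (inv g \<otimes> x \<otimes> g) \<otimes> inv g \<in> \<Gamma>" using assms(2) \<Gamma>_mult \<Gamma>_inv by blast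
    moreover have "g \<otimes> (inv g \<otimes> x \<otimes> g) \<otimes> inv g = x" by (simp add: m_assoc) (simp add: m_assoc[symmetric])
    ultimately show False using assms(3) by simp
  qed
  then show ?thesis using assms(1) by simp
qed

text \<open>The point of minimal norm is fixed by conjugation, hence constant on infinite orbits.\<close>

lemma zero_in_conj_hull:
  assumes supp: "\<And>x. x \<notin> \<Gamma> \<Longrightarrow> coef f x = 0" and one: "coef f \<one> = 0"
  shows "0 \<in> closure (convex hull ((\<lambda>g. cj g f) ` \<Gamma>))"
proof -
  define H where "H = convex hull ((\<lambda>g. cj g f) ` \<Gamma>)"
  define C where "C = closure H"
  have conv: "convex C" by (simp add: C_def H_def convex_closure convex_convex_hull)
  have "cj \<one> f \<in> H" unfolding H_def by (intro hull_inc imageI \<Gamma>_one)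
  then have ne: "C \<noteq> {}" by (auto simp: C_def)
  obtain p where p: "p \<in> C" "\<And>k. k \<in> C \<Longrightarrow> norm (0 - p) \<le> norm (0 - k)"
    using closed_convex_nearest[of C 0] conv ne by (auto simp: C_def)
  have lin: "linear (cj h)" for h using bop_linear[OF bop_cj] by (rule bounded_linear.linear)
  have cj_C: "cj h v \<in> C" if h: "h \<in> \<Gamma>" and v: "v \<in> C" for h v
  proof -
    have "cj h ` H = convex hull ((\<lambda>g. cj h (cj g f)) ` \<Gamma>)"
      by (simp add: H_def convex_hull_linear_image[OF lin] image_image)
    also have "\<dots> \<subseteq> H" unfolding H_def using \<Gamma>_mult[OF h] by (intro hull_mono) auto
    finally have "cj h ` H \<subseteq> closure H" using closure_subset by blast
    then have "cj h ` closure H \<subseteq> closure H"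
      by (rule image_closure_subset[rotated 2]) (auto intro: linear_continuous_on[OF bop_linear[OF bop_cj]])
    then show ?thesis using v by (auto simp: C_def)
  qed
  have fixed: "cj h p = p" if "h \<in> \<Gamma>" for h
    using nearest_unique[OF conv p(1) cj_C[OF that p(1)] p(2)] by simp
  have zero_off: "coef p x = 0" if "x \<notin> \<Gamma> \<or> x = \<one>" for x
  proof -
    have "convex {v :: 'a l2. coef v x = 0}" by (simp add: convex_def)
    moreover have "(\<lambda>g. cj g f) ` \<Gamma> \<subseteq> {v. coef v x = 0}"
      using that cj_support[OF supp] one by auto
    ultimately have "H \<subseteq> {v. coef v x = 0}" unfolding H_def by (intro hull_minimal) auto
    moreover have "closed {v :: 'a l2. coef v x = 0}"
      unfolding cin_ket[symmetric] by (intro closed_Collect_eq continuous_intros)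
    ultimately have "C \<subseteq> {v. coef v x = 0}" unfolding C_def by (rule closure_minimal)
    then show ?thesis using p(1) by auto
  qed
  have "p = 0"
  proof (rule l2_eqI)
    fix x show "coef p x = coef 0 x"
    proof (cases "x \<notin> \<Gamma> \<or> x = \<one>")
      case False
      have "coef p (g \<otimes> x \<otimes> inv g) = coef p x" if "g \<in> \<Gamma>" for g
      proof -
        have "coef (cj (inv g) p) x = coef p x" using fixed[OF \<Gamma>_inv[OF that]] by simp
        then show ?thesis by simp
      qed
      then have "coef p x = 0"
        using False by (intro l2_constant_on_infinite[OF infinite_orbit[of x], of p]) auto
      then show ?thesis by simp
    qed (simp add: zero_off)
  qed
  then show ?thesis using p(1) by (simp add: C_def H_def)
qed

text \<open>Every \<open>g\<close> that keeps some point of \<open>S\<close> inside \<open>S\<close>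
  satisfies \<open>1 \<le> inner (cj g f) f\<close> for the indicator \<open>f\<close> of
  \<open>S\<close>. If all \<open>g\<close> did so, the closed hull of the conjugates would lie in
  this half-space, yet it contains 0.\<close>

lemma separation:
  assumes "finite S" "S \<subseteq> \<Gamma>" "\<one> \<notin> S"
  shows "\<exists>g\<in>\<Gamma>. \<forall>s\<in>S. g \<otimes> s \<otimes> inv g \<notin> S"
proof (rule ccontr)
  assume contra: "\<not> ?thesis"
  define f where "f = (\<Sum>s\<in>S. ket s)"
  have f: "coef f x = (if x \<in> S then 1 else 0)" for x
    using assms(1) by (simp add: f_def)
  have ge: "1 \<le> inner (cj g f) f" if g: "g \<in> \<Gamma>" for g
  proof -
    obtain s where s: "s \<in> S" "g \<otimes> s \<otimes> inv g \<in> S" using contra g by blast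
    have cg: "inv g \<otimes> (g \<otimes> s \<otimes> inv g) \<otimes> g = s"
      by (simp add: m_assoc) (simp add: m_assoc[symmetric])
    have "inner (cj g f) f = Re (\<Sum>x\<in>S. coef (cj g f) x)"
      unfolding inner_l2_def by (subst (2) f_def) (simp add: cin_sum_right cin_ket)
    also have "\<dots> = (\<Sum>x\<in>S. Re (coef (cj g f) x))" by (rule Re_sum)
    also have "\<dots> \<ge> Re (coef (cj g f) (g \<otimes> s \<otimes> inv g))"
      using assms(1) s(2) by (intro member_le_sum) (auto simp: f)
    finally show ?thesis using s by (simp add: f cg)
  qed
  have conv: "convex {v. 1 \<le> inner v f}"
    using convex_halfspace_ge[where a = f and b = 1] by (simp add: inner_commute)
  have "(\<lambda>g. cj g f) ` \<Gamma> \<subseteq> {v. 1 \<le> inner v f}" using ge by auto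
  then have "convex hull ((\<lambda>g. cj g f) ` \<Gamma>) \<subseteq> {v. 1 \<le> inner v f}" using conv by (rule hull_minimal)
  then have "closure (convex hull ((\<lambda>g. cj g f) ` \<Gamma>)) \<subseteq> {v. 1 \<le> inner v f}"
    by (rule closure_minimal) (intro closed_Collect_le continuous_intros)
  moreover have "0 \<in> closure (convex hull ((\<lambda>g. cj g f) ` \<Gamma>))"
    using assms by (intro zero_in_conj_hull) (auto simp: f)
  ultimately show False by auto
qed

text \<open>Asymptotic independence: after truncation to finite sets, \<open>separation\<close>
  makes the conjugated support of \<open>v\<close> meet that of \<open>w\<close> at most in \<one>.
  One \<open>g\<close> serves a whole finite family, and the vectors \<open>w\<close> may live
  outside \<open>\<Gamma>\<close>.\<close>

lemma mixing:
  assumes I: "finite I" and \<epsilon>: "0 < \<epsilon>" and a: "a \<in> \<Gamma>" "a \<noteq> \<one>"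
    and v: "\<And>i x. i \<in> I \<Longrightarrow> x \<notin> \<Gamma> \<Longrightarrow> coef (v i) x = 0"
  shows "\<exists>g\<in>\<Gamma>. g \<noteq> \<one> \<and> (\<forall>i\<in>I. cmod (cin (cj g (v i)) (w i) - coef (v i) \<one> * cnj (coef (w i) \<one>)) < \<epsilon>)"
proof -
  define \<eta> where "\<eta> i = \<epsilon> / (1 + norm (v i) + norm (w i))" for i
  have \<eta>: "0 < \<eta> i" for i using \<epsilon> by (simp add: \<eta>_def add_pos_nonneg)
  have "\<exists>F. finite F \<and> \<one> \<in> F \<and> norm (v i - trunc F (v i)) < \<eta> i" for i
    by (rule trunc_approx[OF \<eta>])
  then obtain F where F: "\<And>i. finite (F i)" "\<And>i. \<one> \<in> F i" "\<And>i. norm (v i - trunc (F i) (v i)) < \<eta> i"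
    by metis
  have "\<exists>F. finite F \<and> \<one> \<in> F \<and> norm (w i - trunc F (w i)) < \<eta> i" for i
    by (rule trunc_approx[OF \<eta>])
  then obtain F' where F': "\<And>i. finite (F' i)" "\<And>i. \<one> \<in> F' i" "\<And>i. norm (w i - trunc (F' i) (w i)) < \<eta> i"
    by metis
  \<comment> \<open>Including \<open>a\<close> guarantees that the separating element is not
    \<one>.\<close>
  define S where "S = insert a (((\<Union>i\<in>I. F i) \<union> (\<Union>i\<in>I. F' i)) \<inter> \<Gamma> - {\<one>})"
  have S: "finite S" "S \<subseteq> \<Gamma>" "\<one> \<notin> S" using I F(1) F'(1) a by (auto simp: S_def)
  obtain g where g: "g \<in> \<Gamma>" "\<And>s. s \<in> S \<Longrightarrow> g \<otimes> s \<otimes> inv g \<notin> S"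
    using separation[OF S] by blast
  have "g \<noteq> \<one>" using g(2)[of a] by (auto simp: S_def)
  moreover have "cmod (cin (cj g (v i)) (w i) - coef (v i) \<one> * cnj (coef (w i) \<one>)) < \<epsilon>" if i: "i \<in> I" for i
  proof -
    define v' where "v' = trunc (F i) (v i)"
    define w' where "w' = trunc (F' i) (w i)"
    have zero: "coef (cj g v') x * cnj (coef w' x) = 0" if x: "x \<noteq> \<one>" for x
    proof (rule ccontr)
      define y where "y = inv g \<otimes> x \<otimes> g"
      assume "coef (cj g v') x * cnj (coef w' x) \<noteq> 0"
      then have nz: "y \<in> F i" "coef (v i) y \<noteq> 0" "x \<in> F' i"
        by (auto simp: v'_def w'_def y_def split: if_splits)
      have yg: "g \<otimes> y \<otimes> inv g = x" by (simp add: y_def m_assoc) (simp add: m_assoc[symmetric])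
      then have "y \<noteq> \<one>" using x by auto
      moreover have "y \<in> \<Gamma>" using nz(2) v[OF i] by auto
      moreover have "x \<in> \<Gamma>" unfolding yg[symmetric] by (intro \<Gamma>_mult \<Gamma>_inv \<open>y \<in> \<Gamma>\<close> g)
      ultimately have "y \<in> S" "g \<otimes> y \<otimes> inv g \<in> S" using nz i x by (auto simp: S_def yg)
      then show False using g(2) by blast
    qed
    have "cin (cj g v') w' = (\<Sum>\<^sub>\<infinity>x\<in>{\<one>}. coef (cj g v') x * cnj (coef w' x))"
      unfolding cin_def using zero by (intro infsum_cong_neutral) auto
    also have "\<dots> = coef (v i) \<one> * cnj (coef (w i) \<one>)" by (simp add: v'_def w'_def F(2) F'(2))
    finally have "cin (cj g (v i)) (w i) - coef (v i) \<one> * cnj (coef (w i) \<one>)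
        = cin (cj g (v i - v')) (w i) + cin (cj g v') (w i - w')"
      by (simp add: cin_diff bop_simps[OF bop_cj])
    also have "cmod \<dots> \<le> norm (v i - v') * norm (w i) + norm v' * norm (w i - w')"
      using cin_norm_le[of "cj g (v i - v')" "w i"] cin_norm_le[of "cj g v'" "w i - w'"]
      by (intro norm_triangle_le) simp
    also have "\<dots> \<le> \<eta> i * norm (w i) + norm (v i) * \<eta> i"
      using F(3)[of i] F'(3)[of i] norm_trunc_le[of "F i" "v i"]
      by (intro add_mono mult_mono) (use \<eta>[of i] in \<open>auto simp: v'_def w'_def\<close>)
    also have "\<dots> < \<eta> i * (1 + norm (v i) + norm (w i))" using \<eta>[of i] by (simp add: algebra_simps)
    also have "\<dots> = \<epsilon>"
    proof -
      have "1 + norm (v i) + norm (w i) > 0" by (simp add: add_pos_nonneg)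
      then show ?thesis by (simp add: \<eta>_def)
    qed
    finally show ?thesis .
  qed
  ultimately show ?thesis using g(1) by blast
qed

text \<open>This is \<open>zero_in_conj_hull\<close> for \<open>f\<close> without its part at
  \<one>, which conjugation fixes. The weights are indexed by the points of the convex combination,
  which explains the domain of \<open>h\<close>.\<close>

lemma conj_average:
  assumes supp: "\<And>x. x \<notin> \<Gamma> \<Longrightarrow> coef f x = 0" and \<epsilon>: "0 < \<epsilon>"
  shows "\<exists>I (h :: 'a l2 \<Rightarrow> 'a) u. finite I \<and> (\<forall>i\<in>I. h i \<in> \<Gamma> \<and> 0 \<le> u i) \<and> sum u I = 1 \<and>
    norm ((\<Sum>i\<in>I. u i *\<^sub>R cj (h i) f) - cscale (coef f \<one>) (ket \<one>)) < \<epsilon>"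
proof -
  define f' where "f' = f - cscale (coef f \<one>) (ket \<one>)"
  have "0 \<in> closure (convex hull ((\<lambda>g. cj g f') ` \<Gamma>))"
    using supp \<Gamma>_one by (intro zero_in_conj_hull) (auto simp: f'_def)
  then obtain y where y: "y \<in> convex hull ((\<lambda>g. cj g f') ` \<Gamma>)" "norm y < \<epsilon>"
    using \<epsilon> unfolding closure_approachable by (auto simp: dist_norm)
  then obtain I u where I: "finite I" "I \<subseteq> (\<lambda>g. cj g f') ` \<Gamma>" "\<forall>x\<in>I. 0 \<le> u x" "sum u I = 1"
    "(\<Sum>x\<in>I. u x *\<^sub>R x) = y"
    unfolding convex_hull_explicit by blast
  have "\<forall>x\<in>I. \<exists>g. g \<in> \<Gamma> \<and> cj g f' = x" using I(2) by auto
  then obtain h where h: "\<And>x. x \<in> I \<Longrightarrow> h x \<in> \<Gamma>" "\<And>x. x \<in> I \<Longrightarrow> cj (h x) f' = x" by metis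
  have "y = (\<Sum>x\<in>I. u x *\<^sub>R cj (h x) f')" using h I(5) by simp
  also have "\<dots> = (\<Sum>x\<in>I. u x *\<^sub>R cj (h x) f - u x *\<^sub>R cscale (coef f \<one>) (ket \<one>))"
    by (simp add: f'_def bop_simps[OF bop_cj] cj_ket scaleR_diff_right)
  also have "\<dots> = (\<Sum>x\<in>I. u x *\<^sub>R cj (h x) f) - cscale (coef f \<one>) (ket \<one>)"
    by (simp add: sum_subtractf scaleR_left.sum[symmetric] I(4))
  finally show ?thesis
    using y(2) I h by (intro exI[of _ I] exI[of _ h] exI[of _ u]) auto
qed

subsection \<open>Abelian invariant subalgebras\<close>

text \<open>Regard \<open>z = adj T \<circ> T\<close> as a random variable with mean
  \<open>r T\<close> and second moment \<open>t T\<close>. Always \<open>(r T)^2 \<le> t T\<close>;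
  the proof obtains the reverse inequality, which makes \<open>z\<close> constant.\<close>

lemma abelian_trivial:
  assumes Q: "inv_alg G Q" and ab: "comm_set Q Q"
    and supp: "\<And>T x. T \<in> Q \<Longrightarrow> x \<notin> \<Gamma> \<Longrightarrow> coef (T (ket \<one>)) x = 0"
    and conj: "\<And>x y. x \<in> \<Gamma> \<Longrightarrow> y \<in> \<Gamma> \<Longrightarrow> x \<noteq> \<one> \<Longrightarrow> y \<noteq> \<one> \<Longrightarrow> \<exists>g. y = g \<otimes> x \<otimes> inv g"
  shows "trivial_alg Q"
proof (rule ccontr)
  assume nontriv: "\<not> trivial_alg Q"
  interpret Q: inv_alg G Q by fact
  have comm: "T (S v) = S (T v)" if "T \<in> Q" "S \<in> Q" for T S v
    using ab that unfolding comm_set_def by (metis comp_apply)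
  obtain T0 a where T0: "T0 \<in> Q" "a \<noteq> \<one>" "coef (T0 (ket \<one>)) a \<noteq> 0"
    using nontriv by (auto simp: trivial_alg_def)
  then have a: "a \<in> \<Gamma>" "a \<noteq> \<one>" using supp by auto
  \<comment> \<open>All elements of \<open>\<Gamma>\<close> other than \<one> are conjugate, so
    \<open>c\<close> is common to them; \<open>c > 0\<close> since the inner product with
    \<open>xi a\<close> is the coefficient at \<open>a\<close>.\<close>
  define c where "c = (norm (Q.xi a))\<^sup>2"
  have "Q.xi a \<noteq> 0" using T0 Q.coef_K[OF Q.hat_K[OF T0(1)], of a] by auto
  then have c0: "0 < c" by (simp add: c_def)
  have c: "(norm (Q.xi b))\<^sup>2 = c" if "b \<in> \<Gamma>" "b \<noteq> \<one>" for b
    using conj[OF a(1) that(1) a(2) that(2)] Q.norm_xi_conj by (auto simp: c_def)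
  define sq where "sq T = adj T \<circ> T" for T :: "'a l2 \<Rightarrow> 'a l2"
  have sq: "sq T \<in> Q" "cin (sq T v) w = cin (T v) (T w)" "cin v (sq T w) = cin (T v) (T w)" if "T \<in> Q" for T v w
    using that by (simp_all add: sq_def Q.P_comp Q.P_adj cin_adj cin_adj_right Q.P_bop)
  have self: "cin (sq T v) w = cin v (sq T w)" if "T \<in> Q" for T v w
    by (simp only: sq(2)[OF that] sq(3)[OF that])
  define r where "r T = (norm (T (ket \<one>)))\<^sup>2" for T :: "'a l2 \<Rightarrow> 'a l2"
  define t where "t T = (norm (sq T (ket \<one>)))\<^sup>2" for T
  have r_nonneg: "0 \<le> r T" for T by (simp add: r_def)
  have coef_z: "coef (sq T (ket \<one>)) \<one> = of_real (r T)" if "T \<in> Q" for T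
    using that by (simp add: cin_ket[symmetric] sq cin_self_norm r_def)
  define V where "V T = sq T (sq T (ket \<one>))" for T
  have coef_V: "coef (V T) \<one> = of_real (t T)" if T: "T \<in> Q" for T
  proof -
    have "coef (V T) \<one> = cin (sq T (sq T (ket \<one>))) (ket \<one>)" by (simp add: V_def cin_ket)
    also have "\<dots> = cin (sq T (ket \<one>)) (sq T (ket \<one>))"
      by (simp only: sq(2)[OF T] sq(3)[OF T])
    finally show ?thesis by (simp add: cin_self_norm t_def)
  qed
  have Ad_sq: "sq (Ad g T) v = Ad g (sq T) v" if "T \<in> Q" for g T v
    using that by (simp add: sq_def Ad_def adj_comp adj_lt bop_comp Q.P_bop)
  \<comment> \<open>Commutativity turns \<open>E b \<circ> y \<circ> y\<close> into
    \<open>E b \<circ> y' \<circ> y\<close>, whose vector is the projection of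
    \<open>lt b (y' (y (ket \<one>)))\<close>. The inequality says that projections contract; the
    factors are then reordered so that \<open>sq (Q.E b)\<close> faces the square of
    \<open>sq y\<close>.\<close>
  have ineq: "Re (cin (sq (Q.E b) (ket \<one>)) (cj h (V T))) \<le>
      Re (cin (cj b (cj h (sq T (ket \<one>)))) (cj h (sq T (ket \<one>))))" if T: "T \<in> Q" for b h T
  proof -
    define y where "y = Ad h T"
    define y' where "y' = Ad b y"
    have y: "y \<in> Q" "y' \<in> Q" using T by (simp_all add: y_def y'_def Q.P_Ad)
    have sqy: "sq y (ket \<one>) = cj h (sq T (ket \<one>))"
      using T sq(1) by (simp add: y_def Ad_sq Ad_hat Q.PL)
    have sqy': "sq y' (ket \<one>) = cj b (sq y (ket \<one>))"
      using y sq(1) by (simp add: y'_def Ad_sq Ad_hat Q.PL)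
    have Vy: "sq y (sq y (ket \<one>)) = cj h (V T)"
    proof -
      have "sq y (sq y (ket \<one>)) = Ad h (sq T \<circ> sq T) (ket \<one>)"
        using T by (simp add: y_def Ad_sq) (simp add: Ad_apply)
      also have "\<dots> = cj h (V T)"
        using T sq(1) by (subst Ad_hat) (simp_all add: Q.PL Q.P_comp V_def)
      finally show ?thesis .
    qed
    have "Q.E b (y (y (ket \<one>))) = Q.E b ((y' \<circ> y) (ket \<one>))"
    proof -
      have "Q.E b (y (y (ket \<one>))) = y' (Q.E b (y (ket \<one>)))"
        using Q.E_comm[OF y(1), of b] unfolding y'_def by (metis comp_apply)
      then show ?thesis by (simp add: comm[OF Q.E(1) y(2)])
    qed
    also have "\<dots> = Q.e (lt b ((y' \<circ> y) (ket \<one>)))" by (rule Q.E_hat[OF Q.P_comp[OF y(2,1)]])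
    finally have le: "norm (Q.E b (y (y (ket \<one>)))) \<le> norm (y' (y (ket \<one>)))"
      using Q.cs.norm_proj_le[of "lt b (y' (y (ket \<one>)))"] by simp
    note sqE = sq(1)[OF Q.E(1)[of b]] and sqQ = sq(1)[OF y(1)] sq(1)[OF y(2)]
    have "cin (Q.E b (y (y (ket \<one>)))) (Q.E b (y (y (ket \<one>)))) = cin (sq (Q.E b) (y (y (ket \<one>)))) (y (y (ket \<one>)))"
      by (simp only: sq(2)[OF Q.E(1)])
    also have "\<dots> = cin (y (y (sq (Q.E b) (ket \<one>)))) (y (y (ket \<one>)))"
      by (simp only: comm[OF sqE y(1)])
    also have "\<dots> = cin (sq y (y (sq (Q.E b) (ket \<one>)))) (y (ket \<one>))"
      by (simp only: sq(2)[OF y(1)])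
    also have "\<dots> = cin (y (sq y (sq (Q.E b) (ket \<one>)))) (y (ket \<one>))"
      by (simp only: comm[OF sqQ(1) y(1)])
    also have "\<dots> = cin (sq (Q.E b) (ket \<one>)) (sq y (sq y (ket \<one>)))"
      by (simp only: sq(2)[OF y(1), symmetric] self[OF y(1)])
    finally have "cin (Q.E b (y (y (ket \<one>)))) (Q.E b (y (y (ket \<one>)))) = cin (sq (Q.E b) (ket \<one>)) (cj h (V T))"
      by (simp only: Vy)
    moreover
    have "cin (y' (y (ket \<one>))) (y' (y (ket \<one>))) = cin (sq y' (y (ket \<one>))) (y (ket \<one>))"
      by (simp only: sq(2)[OF y(2)])
    then have "cin (y' (y (ket \<one>))) (y' (y (ket \<one>))) = cin (y (sq y' (ket \<one>))) (y (ket \<one>))"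
      by (simp only: comm[OF sqQ(2) y(1)])
    then have "cin (y' (y (ket \<one>))) (y' (y (ket \<one>))) = cin (cj b (sq y (ket \<one>))) (sq y (ket \<one>))"
      by (simp only: sq(2)[OF y(1), symmetric] self[OF y(1)] sqy')
    ultimately show ?thesis
      using power_mono[OF le norm_ge_zero, of 2] by (simp add: norm_sq_cin sqy)
  qed
  have base: "c * t T \<le> (r T)\<^sup>2" if T: "T \<in> Q" for T
  proof (rule field_le_epsilon)
    fix \<epsilon>' :: real assume "0 < \<epsilon>'"
    define \<epsilon> where "\<epsilon> = \<epsilon>' / 2"
    have \<epsilon>: "0 < \<epsilon>" using \<open>0 < \<epsilon>'\<close> by (simp add: \<epsilon>_def)
    have V_supp: "coef (V T) x = 0" if "x \<notin> \<Gamma>" for x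
      using supp[OF Q.P_comp[OF sq(1)[OF T] sq(1)[OF T]] that] by (simp add: V_def)
    \<comment> \<open>The averaging family is fixed before \<open>b\<close>: since
      \<open>norm p \<le> 1\<close> whatever \<open>b\<close> is, its error is controlled uniformly,
      and a single \<open>b\<close> can then be chosen for the finitely many
      \<open>\<zeta> i\<close>.\<close>
    obtain I u and h :: "'a l2 \<Rightarrow> 'a" where I: "finite I" "\<And>i. i \<in> I \<Longrightarrow> h i \<in> \<Gamma>" "\<And>i. i \<in> I \<Longrightarrow> 0 \<le> u i"
      "sum u I = 1" "norm ((\<Sum>i\<in>I. u i *\<^sub>R cj (h i) (V T)) - cscale (of_real (t T)) (ket \<one>)) < \<epsilon>"
      using conj_average[OF V_supp \<epsilon>] unfolding coef_V[OF T] by blast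
    define d where "d = (\<Sum>i\<in>I. u i *\<^sub>R cj (h i) (V T)) - cscale (of_real (t T)) (ket \<one>)"
    define \<zeta> where "\<zeta> i = cj (h i) (sq T (ket \<one>))" for i
    have \<zeta>_supp: "coef (\<zeta> i) x = 0" if "i \<in> I" "x \<notin> \<Gamma>" for i x
      unfolding \<zeta>_def by (rule cj_support[OF supp[OF sq(1)[OF T]] I(2)]) (use that in auto)
    obtain b where b: "b \<in> \<Gamma>" "b \<noteq> \<one>"
      "\<And>i. i \<in> I \<Longrightarrow> cmod (cin (cj b (\<zeta> i)) (\<zeta> i) - coef (\<zeta> i) \<one> * cnj (coef (\<zeta> i) \<one>)) < \<epsilon>"
      using mixing[where v = \<zeta> and w = \<zeta>, OF I(1) \<epsilon> a \<zeta>_supp] by blast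
    define p where "p = sq (Q.E b) (ket \<one>)"
    have "coef (\<zeta> i) \<one> = of_real (r T)" for i by (simp add: \<zeta>_def coef_z[OF T])
    then have up: "Re (cin (cj b (\<zeta> i)) (\<zeta> i)) \<le> (r T)\<^sup>2 + \<epsilon>" if "i \<in> I" for i
      using b(3)[OF that] abs_Re_le_cmod[of "cin (cj b (\<zeta> i)) (\<zeta> i) - of_real (r T) * of_real (r T)"]
      by (simp add: power2_eq_square)
    have "p = Q.E (inv b) (Q.E b (ket \<one>))"
    proof -
      have "adj (Q.E b) = Q.E (inv b)"
        by (rule LG_eqI) (simp_all add: adj_hat Q.PL Q.P_adj Q.E Q.J_xi)
      then show ?thesis by (simp add: p_def sq_def)
    qed
    then have "norm p \<le> norm (Q.E b (ket \<one>))"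
      using Q.cs.norm_proj_le by (simp add: Q.E_hat[OF Q.E(1)]) (metis norm_lt)
    also have "\<dots> \<le> 1" using Q.cs.norm_proj_le[of "ket b"] by (simp add: Q.E Q.xi_def)
    finally have p1: "norm p \<le> 1" .
    have pc: "cin p (ket \<one>) = of_real c"
      using c[OF b(1,2)] by (simp add: p_def sq(2)[OF Q.E(1)] cin_self_norm Q.E del: of_real_power)
    have "Re (cin p d) \<ge> - \<epsilon>"
    proof -
      have "cmod (cin p d) \<le> norm p * norm d" by (rule cin_norm_le)
      also have "\<dots> \<le> 1 * \<epsilon>" using p1 I(5) \<epsilon> by (intro mult_mono) (auto simp: d_def)
      finally show ?thesis using abs_Re_le_cmod[of "cin p d"] by linarith
    qed
    moreover have "cin p d = (\<Sum>i\<in>I. of_real (u i) * cin p (cj (h i) (V T))) - of_real (t T) * of_real c"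
      by (simp add: d_def cin_diff cin_sum_right scaleR_conv_cscale cin_cscale_right pc)
    ultimately have "c * t T - \<epsilon> \<le> (\<Sum>i\<in>I. u i * Re (cin p (cj (h i) (V T))))"
      by (simp add: mult.commute)
    also have "\<dots> \<le> (\<Sum>i\<in>I. u i * ((r T)\<^sup>2 + \<epsilon>))"
    proof (intro sum_mono mult_left_mono)
      fix i assume i: "i \<in> I"
      show "Re (cin p (cj (h i) (V T))) \<le> (r T)\<^sup>2 + \<epsilon>"
        using ineq[OF T, of b "h i"] up[OF i] by (simp add: p_def \<zeta>_def)
    qed (rule I)
    also have "\<dots> = (r T)\<^sup>2 + \<epsilon>" by (simp add: sum_distrib_right[symmetric] I(4))
    finally show "c * t T \<le> (r T)\<^sup>2 + \<epsilon>'" by (simp add: \<epsilon>_def)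
  qed
  \<comment> \<open>The exponent doubles by applying the hypothesis to
    \<open>S k = T \<circ> Ad (g k) T\<close>, whose mean and second moment tend to
    \<open>(r T)^2\<close> and \<open>(t T)^2\<close>; the constant \<open>c\<close> does not
    change.\<close>
  have step: "c * t T ^ (2 ^ n) \<le> ((r T)\<^sup>2) ^ (2 ^ n)" if "T \<in> Q" for T n
    using that
  proof (induction n arbitrary: T)
    case 0 then show ?case using base by simp
  next
    case (Suc n)
    note T = \<open>T \<in> Q\<close>
    define z where "z = sq T (ket \<one>)"
    have z: "coef z x = 0" if "x \<notin> \<Gamma>" for x using supp[OF sq(1)[OF T] that] by (simp add: z_def)
    have Vs: "coef (V T) x = 0" if "x \<notin> \<Gamma>" for x
      using supp[OF Q.P_comp[OF sq(1)[OF T] sq(1)[OF T]] that] by (simp add: V_def)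
    \<comment> \<open>The Boolean index makes one sequence \<open>g\<close> work for both
      \<open>z\<close> and \<open>V T\<close>.\<close>
    define v where "v i = (if i then z else V T)" for i
    have "\<exists>g. \<forall>i. cmod (cin (cj g (v i)) (v i) - coef (v i) \<one> * cnj (coef (v i) \<one>)) < 1 / real (Suc k)" for k
    proof -
      have "\<And>i x. x \<notin> \<Gamma> \<Longrightarrow> coef (v i) x = 0" by (simp add: v_def z Vs)
      then show ?thesis using mixing[of UNIV "1 / real (Suc k)" a v v] a by simp blast
    qed
    then obtain g where g: "\<And>k i. cmod (cin (cj (g k) (v i)) (v i) - coef (v i) \<one> * cnj (coef (v i) \<one>)) < 1 / real (Suc k)"
      by metis
    have lim: "(\<lambda>k. Re (cin (cj (g k) (v i)) (v i))) \<longlonglongrightarrow> Re (coef (v i) \<one> * cnj (coef (v i) \<one>))" for i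
    proof -
      have "(\<lambda>k. 1 / real (Suc k)) \<longlonglongrightarrow> 0" using LIMSEQ_inverse_real_of_nat by (simp add: inverse_eq_divide)
      moreover have "\<forall>\<^sub>F k in sequentially. norm (cin (cj (g k) (v i)) (v i) - coef (v i) \<one> * cnj (coef (v i) \<one>)) \<le> 1 / real (Suc k)"
        by (rule always_eventually) (rule allI, rule less_imp_le, rule g)
      ultimately have "(\<lambda>k. cin (cj (g k) (v i)) (v i) - coef (v i) \<one> * cnj (coef (v i) \<one>)) \<longlonglongrightarrow> 0"
        by (rule Lim_null_comparison[rotated])
      then show ?thesis by (intro tendsto_Re) (rule LIM_zero_cancel)
    qed
    define S where "S k = T \<circ> Ad (g k) T" for k
    have SQ: "S k \<in> Q" for k by (simp add: S_def Q.P_comp Q.P_Ad T)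
    have sqS: "sq (S k) u = sq T (Ad (g k) (sq T) u)" for k u
    proof -
      have "sq (S k) u = adj (Ad (g k) T) (adj T (T (Ad (g k) T u)))"
        by (simp add: sq_def S_def adj_comp Q.P_bop T Q.P_Ad)
      also have "\<dots> = adj T (T (sq (Ad (g k) T) u))"
        using T by (simp add: sq_def comm[OF Q.P_adj[OF Q.P_Ad[OF T]] Q.P_adj[OF T]]
            comm[OF Q.P_adj[OF Q.P_Ad[OF T]] T])
      finally show ?thesis using T by (simp add: Ad_sq) (simp add: sq_def)
    qed
    have Adz: "Ad (g k) (sq T) (ket \<one>) = cj (g k) z" for k
      by (simp add: Ad_hat Q.PL sq(1)[OF T] z_def)
    have rS: "r (S k) = Re (cin (cj (g k) z) z)" for k
    proof -
      have "r (S k) = Re (cin (sq (S k) (ket \<one>)) (ket \<one>))" by (simp add: r_def norm_sq_cin sq(2)[OF SQ])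
      also have "cin (sq (S k) (ket \<one>)) (ket \<one>) = cin (cj (g k) z) z"
        by (simp add: sqS Adz sq(2)[OF T]) (simp add: sq(3)[OF T, symmetric] z_def)
      finally show ?thesis .
    qed
    have tS: "t (S k) = Re (cin (cj (g k) (V T)) (V T))" for k
    proof -
      let ?A = "Ad (g k) (sq T)" and ?B = "sq T"
      have A: "?A \<in> Q" and B: "?B \<in> Q" using sq(1)[OF T] Q.P_Ad by auto
      have selfB: "cin (?B u) w = cin u (?B w)" for u w by (rule self[OF T])
      have selfA: "cin (?A u) w = cin u (?A w)" for u w
        by (simp only: Ad_sq[OF T, symmetric] self[OF Q.P_Ad[OF T]])
      have "cin (?B (?A (ket \<one>))) (?B (?A (ket \<one>))) = cin (?A (?A (ket \<one>))) (?B (?B (ket \<one>)))"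
        by (metis selfA selfB comm[OF A B])
      moreover have "?A (?A (ket \<one>)) = cj (g k) (V T)"
      proof -
        have "?A (?A (ket \<one>)) = Ad (g k) (sq T \<circ> sq T) (ket \<one>)" by (simp add: Ad_apply)
        also have "\<dots> = cj (g k) (V T)"
          using sq(1)[OF T] by (subst Ad_hat) (simp_all add: Q.PL Q.P_comp V_def)
        finally show ?thesis .
      qed
      ultimately show ?thesis by (simp add: t_def norm_sq_cin sqS V_def)
    qed
    have rlim: "(\<lambda>k. r (S k)) \<longlonglongrightarrow> (r T)\<^sup>2"
      using lim[of True] by (simp add: v_def rS z_def coef_z[OF T] power2_eq_square)
    have tlim: "(\<lambda>k. t (S k)) \<longlonglongrightarrow> (t T)\<^sup>2"
      using lim[of False] by (simp add: v_def tS coef_V[OF T] power2_eq_square)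
    have "c * ((t T)\<^sup>2) ^ (2 ^ n) \<le> (((r T)\<^sup>2)\<^sup>2) ^ (2 ^ n)"
    proof (rule LIMSEQ_le)
      show "(\<lambda>k. c * t (S k) ^ 2 ^ n) \<longlonglongrightarrow> c * ((t T)\<^sup>2) ^ (2 ^ n)" by (intro tendsto_intros tlim)
      show "(\<lambda>k. ((r (S k))\<^sup>2) ^ 2 ^ n) \<longlonglongrightarrow> (((r T)\<^sup>2)\<^sup>2) ^ (2 ^ n)" by (intro tendsto_intros rlim)
      show "\<exists>N. \<forall>k\<ge>N. c * t (S k) ^ 2 ^ n \<le> ((r (S k))\<^sup>2) ^ 2 ^ n" using Suc.IH[OF SQ] by blast
    qed
    then show ?case by (simp add: power_mult[symmetric])
  qed
  \<comment> \<open>Otherwise \<open>q < 1\<close>, whereas \<open>step\<close> keeps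
    \<open>q^(2^n)\<close> above the positive constant \<open>c\<close>.\<close>
  have t_le: "t T \<le> (r T)\<^sup>2" if T: "T \<in> Q" for T
  proof (rule ccontr)
    assume "\<not> t T \<le> (r T)\<^sup>2"
    then have gt: "(r T)\<^sup>2 < t T" by simp
    define q where "q = (r T)\<^sup>2 / t T"
    have tpos: "0 < t T" using gt zero_le_power2[of "r T"] by linarith
    have q: "0 \<le> q" "q < 1" using gt tpos by (simp_all add: q_def)
    obtain n where n: "q ^ n < c" using real_arch_pow_inv[OF c0 q(2)] by blast
    have "q ^ (2 ^ n) \<le> q ^ n" using q by (intro power_decreasing) (auto intro: less_imp_le less_exp)
    then have "q ^ (2 ^ n) < c" using n by linarith
    then have "((r T)\<^sup>2) ^ (2 ^ n) < c * t T ^ (2 ^ n)"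
      using tpos by (simp add: q_def power_divide divide_less_eq)
    then show False using step[OF T, of n] by linarith
  qed
  have scalar: "coef (sq T (ket \<one>)) g = 0" if T: "T \<in> Q" and g: "g \<noteq> \<one>" for T g
  proof -
    define z where "z = sq T (ket \<one>)"
    have "cin (z - cscale (of_real (r T)) (ket \<one>)) (z - cscale (of_real (r T)) (ket \<one>))
        = of_real (t T - (r T)\<^sup>2)"
      using coef_z[OF T] cin_self_norm[of z]
      by (simp add: cin_diff cin_cscale cin_cscale_right cin_ket cin_ket_left t_def z_def power2_eq_square)
    then have "(norm (z - cscale (of_real (r T)) (ket \<one>)))\<^sup>2 \<le> 0"
      using t_le[OF T] by (simp add: norm_sq_cin)
    then have "z = cscale (of_real (r T)) (ket \<one>)" by simp
    then show ?thesis using g by (simp add: z_def)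
  qed
  have "trivial_alg Q"
    unfolding trivial_alg_def
  proof (intro ballI allI impI)
    fix T g assume T: "T \<in> Q" and g: "g \<noteq> \<one>"
    \<comment> \<open>So far only elements \<open>sq S\<close> are known to be scalar. Polarization
      with \<open>S = 1 + \<alpha> T\<close>, at \<open>\<alpha> = 1\<close> and
      \<open>\<alpha> = \<i>\<close>, recovers \<open>T\<close>.\<close>
    have *: "cnj \<alpha> * cin (ket \<one>) (T (ket g)) + \<alpha> * coef (T (ket \<one>)) g = 0" if \<alpha>: "cmod \<alpha> = 1" for \<alpha>
    proof -
      define S where "S v = id v + cscale \<alpha> (T v)" for v
      have S: "S \<in> Q" unfolding S_def by (intro Q.P_add Q.P_cscale Q.P_id T)
      have "0 = cin (S (ket \<one>)) (S (ket g))"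
        using scalar[OF S g] by (simp add: cin_ket[symmetric] sq(2)[OF S])
      also have "\<dots> = cin (ket \<one>) (ket g) + cnj \<alpha> * cin (ket \<one>) (T (ket g)) + \<alpha> * coef (T (ket \<one>)) g
          + \<alpha> * cnj \<alpha> * cin (T (ket \<one>)) (T (ket g))"
        by (simp add: S_def cin_add cin_add_right cin_cscale cin_cscale_right cin_ket algebra_simps)
      also have "cin (T (ket \<one>)) (T (ket g)) = 0"
        using scalar[OF T g] by (simp add: cin_ket[symmetric] sq(2)[OF T])
      finally show ?thesis using g by (simp add: cin_ket)
    qed
    from *[of 1] *[of \<i>] show "coef (T (ket \<one>)) g = 0"
      by (simp add: complex_eq_iff)
  qed
  then show False using nontriv by simp
qed

end

section \<open>Products with the finitary alternating group\<close>

text \<open>A type of its own, so that the group lives on \<open>UNIV\<close>, as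
  \<open>ugroup\<close> demands.\<close>

typedef alt = "{p :: nat \<Rightarrow> nat. permutation p \<and> evenperm p}" morphisms perm Abs_alt
  by (rule exI[of _ id]) simp

lemma perm: "permutation (perm a)" "evenperm (perm a)"
  using perm[of a] by auto

lemma perm_Abs: "permutation p \<Longrightarrow> evenperm p \<Longrightarrow> perm (Abs_alt p) = p"
  by (simp add: Abs_alt_inverse)

lemma alt_eqI: "perm a = perm b \<Longrightarrow> a = b"
  by (simp add: perm_inject)

definition alt_group :: "alt monoid" where
  "alt_group = \<lparr>carrier = UNIV, monoid.mult = (\<lambda>a b. Abs_alt (perm a \<circ> perm b)), one = Abs_alt id\<rparr>"

lemma carrier_alt [simp]: "carrier alt_group = UNIV" by (simp add: alt_group_def)

lemma perm_mult [simp]: "perm (a \<otimes>\<^bsub>alt_group\<^esub> b) = perm a \<circ> perm b"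
  by (simp add: alt_group_def perm_Abs permutation_compose evenperm_comp perm)

lemma perm_one [simp]: "perm \<one>\<^bsub>alt_group\<^esub> = id"
  by (simp add: alt_group_def perm_Abs)

lemma group_alt: "group alt_group"
proof (rule groupI)
  fix a assume "a \<in> carrier alt_group"
  have "permutation (inv_into UNIV (perm a))" "evenperm (inv_into UNIV (perm a))"
    by (simp_all add: permutation_inverse evenperm_inv perm)
  then have "Abs_alt (inv_into UNIV (perm a)) \<otimes>\<^bsub>alt_group\<^esub> a = \<one>\<^bsub>alt_group\<^esub>"
    by (intro alt_eqI) (simp add: perm_Abs permutation_inverse_works perm)
  then show "\<exists>b\<in>carrier alt_group. b \<otimes>\<^bsub>alt_group\<^esub> a = \<one>\<^bsub>alt_group\<^esub>" by auto
qed (auto intro!: alt_eqI)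

interpretation alt: ugroup alt_group
  by (intro ugroup.intro ugroup_axioms.intro group_alt) simp

section \<open>Supports of even permutations\<close>

definition supp :: "alt \<Rightarrow> nat set" where "supp a = {x. perm a x \<noteq> x}"

lemma finite_supp: "finite (supp a)"
  using permutation_finite_support[OF perm(1)] by (simp add: supp_def)

lemma inj_perm: "perm a x = perm a y \<longleftrightarrow> x = y"
  using permutation_bijective[OF perm(1)] by (metis bij_pointE)

lemma perm_inv [simp]: "perm a (perm (inv\<^bsub>alt_group\<^esub> a) x) = x" "perm (inv\<^bsub>alt_group\<^esub> a) (perm a x) = x"
proof -
  show "perm a (perm (inv\<^bsub>alt_group\<^esub> a) x) = x"
    by (metis alt.r_inv alt.carrier_UNIV UNIV_I perm_mult perm_one comp_apply id_apply)
  show "perm (inv\<^bsub>alt_group\<^esub> a) (perm a x) = x"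
    by (metis alt.l_inv alt.carrier_UNIV UNIV_I perm_mult perm_one comp_apply id_apply)
qed

lemma supp_moves: "x \<in> supp a \<Longrightarrow> perm a x \<in> supp a"
  by (simp add: supp_def inj_perm)

lemma supp_empty: "supp a \<subseteq> {p} \<Longrightarrow> a = \<one>\<^bsub>alt_group\<^esub>"
proof (rule alt_eqI, rule ext)
  fix x assume "supp a \<subseteq> {p}"
  then show "perm a x = perm \<one>\<^bsub>alt_group\<^esub> x"
    using supp_moves[of x a] by (auto simp: supp_def)
qed

lemma supp_mult: "supp (a \<otimes>\<^bsub>alt_group\<^esub> b) \<subseteq> supp a \<union> supp b"
  by (auto simp: supp_def)

lemma supp_inv: "supp (inv\<^bsub>alt_group\<^esub> a) = supp a"
  by (auto simp: supp_def) (metis perm_inv)+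

lemma supp_conj: "supp (c \<otimes>\<^bsub>alt_group\<^esub> a \<otimes>\<^bsub>alt_group\<^esub> inv\<^bsub>alt_group\<^esub> c) = perm c ` supp a"
proof -
  have "x \<in> perm c ` supp a \<longleftrightarrow> perm (inv\<^bsub>alt_group\<^esub> c) x \<in> supp a" for x
    by (metis (no_types) image_iff perm_inv)
  moreover have "perm c (perm a (perm (inv\<^bsub>alt_group\<^esub> c) x)) = x \<longleftrightarrow>
      perm a (perm (inv\<^bsub>alt_group\<^esub> c) x) = perm (inv\<^bsub>alt_group\<^esub> c) x" for x
    by (metis perm_inv)
  ultimately show ?thesis by (auto simp: supp_def)
qed

text \<open>The transposition of \<open>m\<close> and \<open>n\<close> is odd; a second one, with a
  fresh point \<open>n'\<close>, repairs the parity and disturbs neither the image of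
  \<open>m\<close> nor the points of \<open>F\<close>.\<close>

lemma alt_fixing_moving:
  assumes "finite F" "m \<notin> F" "n \<notin> F" "n \<noteq> m"
  shows "\<exists>c. perm c m = n \<and> (\<forall>x\<in>F. perm c x = x)"
proof -
  obtain n' where n': "n' \<notin> insert m (insert n F)"
    using ex_new_if_finite[of "insert m (insert n F)"] assms(1) infinite_UNIV_nat by auto
  define q where "q = Transposition.transpose m n' \<circ> Transposition.transpose m n"
  have "permutation q" "evenperm q"
    using assms n' by (auto simp: q_def permutation_compose permutation_swap_id evenperm_comp evenperm_swap)
  then have "perm (Abs_alt q) = q" by (rule perm_Abs)
  moreover have "q m = n" "\<forall>x\<in>F. q x = x" using assms n' by (auto simp: q_def Transposition.transpose_def)
  ultimately show ?thesis by metis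
qed

lemma alt_commute:
  assumes "\<forall>x\<in>supp a. perm c x = x"
  shows "c \<otimes>\<^bsub>alt_group\<^esub> a = a \<otimes>\<^bsub>alt_group\<^esub> c"
proof (rule alt_eqI, rule ext)
  fix x show "perm (c \<otimes>\<^bsub>alt_group\<^esub> a) x = perm (a \<otimes>\<^bsub>alt_group\<^esub> c) x"
  proof (cases "x \<in> supp a")
    case True then show ?thesis using assms supp_moves[OF True] by simp
  next
    case False
    then have "perm c x \<notin> supp a" using assms by (metis inj_perm)
    then show ?thesis using False by (simp add: supp_def)
  qed
qed

text \<open>\<open>q1\<close> swaps the blocks \<open>[0, n)\<close> and \<open>[n, 2n)\<close>,
  which takes \<open>F'\<close> away from \<open>F\<close>, and a transposition brings the image of
  \<open>m'\<close> back to \<open>m\<close>. If the result is odd, swapping \<open>2n\<close> and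
  \<open>2n + 1\<close>, beyond all relevant points, makes it even.\<close>

lemma alt_separating:
  assumes "finite F" "finite F'"
  shows "\<exists>c. perm c m' = m \<and> perm c ` F' \<inter> F \<subseteq> {m}"
proof -
  have "finite (insert m (insert m' (F \<union> F')))" using assms by simp
  then obtain n where n: "\<And>x. x \<in> insert m (insert m' (F \<union> F')) \<Longrightarrow> x < n"
    using finite_nat_set_iff_bounded by meson
  define q1 where "q1 j = (if j < n then j + n else if j < 2 * n then j - n else j)" for j
  have "q1 \<circ> q1 = id" by (auto simp: q1_def fun_eq_iff)
  then have "bij q1" by (rule o_bij) fact
  moreover have "finite {x. q1 x \<noteq> x}" by (rule finite_subset[of _ "{..<2 * n}"]) (auto simp: q1_def)
  ultimately have q1: "permutation q1" by (simp add: permutation)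
  define q where "q = Transposition.transpose (m' + n) m \<circ> q1"
  have q: "permutation q" by (simp add: q_def permutation_compose permutation_swap_id q1)
  have qm: "q m' = m" using n by (simp add: q_def q1_def)
  have qF: "q x \<ge> n" "q x < 2 * n" if "x \<in> F'" "x \<noteq> m'" for x
    using n[of x] n[of m] that by (auto simp: q_def q1_def Transposition.transpose_def)
  define q' where "q' = (if evenperm q then q else Transposition.transpose (2 * n) (2 * n + 1) \<circ> q)"
  have "permutation q'" "evenperm q'"
    using q by (auto simp: q'_def permutation_compose permutation_swap_id evenperm_comp evenperm_swap)
  then have c: "perm (Abs_alt q') = q'" by (rule perm_Abs)
  have "q' m' = m" using n[of m] qm by (auto simp: q'_def Transposition.transpose_def)
  moreover have "q' ` F' \<inter> F \<subseteq> {m}"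
  proof
    fix y assume y: "y \<in> q' ` F' \<inter> F"
    then obtain x where x: "x \<in> F'" "y = q' x" by auto
    show "y \<in> {m}"
    proof (cases "x = m'")
      case False
      then have "q' x \<ge> n" using qF[OF x(1)] by (auto simp: q'_def Transposition.transpose_def)
      then show ?thesis using y x n[of y] by auto
    qed (use x \<open>q' m' = m\<close> in simp)
  qed
  ultimately show ?thesis using c by metis
qed

section \<open>The product group and the supports of the expectations\<close>

locale alt_prod = B: ugroup B for B :: "('b, 'm) monoid_scheme" +
  assumes infinite_B: "infinite (UNIV :: 'b set)"
    and two_classes: "x \<noteq> \<one>\<^bsub>B\<^esub> \<Longrightarrow> y \<noteq> \<one>\<^bsub>B\<^esub> \<Longrightarrow> \<exists>g. y = g \<otimes>\<^bsub>B\<^esub> x \<otimes>\<^bsub>B\<^esub> inv\<^bsub>B\<^esub> g"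
begin

definition G where "G = alt_group \<times>\<times> B"

lemma mult_G [simp]: "(a, b) \<otimes>\<^bsub>G\<^esub> (a', b') = (a \<otimes>\<^bsub>alt_group\<^esub> a', b \<otimes>\<^bsub>B\<^esub> b')"
  by (simp add: G_def)

lemma one_G: "\<one>\<^bsub>G\<^esub> = (\<one>\<^bsub>alt_group\<^esub>, \<one>\<^bsub>B\<^esub>)"
  by (simp add: G_def)

lemma inv_G [simp]: "inv\<^bsub>G\<^esub> (a, b) = (inv\<^bsub>alt_group\<^esub> a, inv\<^bsub>B\<^esub> b)"
  by (simp add: G_def inv_DirProd group_alt B.is_group)

sublocale ugroup G
  by (intro ugroup.intro ugroup_axioms.intro) (auto simp: G_def intro: DirProd_group group_alt B.is_group)

lemma fst_mult: "fst (x \<otimes>\<^bsub>G\<^esub> y) = fst x \<otimes>\<^bsub>alt_group\<^esub> fst y" by (cases x; cases y) simp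
lemma snd_mult: "snd (x \<otimes>\<^bsub>G\<^esub> y) = snd x \<otimes>\<^bsub>B\<^esub> snd y" by (cases x; cases y) simp
lemma fst_inv: "fst (inv\<^bsub>G\<^esub> x) = inv\<^bsub>alt_group\<^esub> fst x" by (cases x) simp
lemma snd_inv: "snd (inv\<^bsub>G\<^esub> x) = inv\<^bsub>B\<^esub> snd x" by (cases x) simp

lemmas comps = fst_mult snd_mult fst_inv snd_inv

definition \<Gamma> where "\<Gamma> = {x :: alt \<times> 'b. fst x = \<one>\<^bsub>alt_group\<^esub>}"

lemma infinite_class: assumes "b \<noteq> \<one>\<^bsub>B\<^esub>" shows "infinite ((\<lambda>d. d \<otimes>\<^bsub>B\<^esub> b \<otimes>\<^bsub>B\<^esub> inv\<^bsub>B\<^esub> d) ` UNIV)"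
proof
  assume fin: "finite ((\<lambda>d. d \<otimes>\<^bsub>B\<^esub> b \<otimes>\<^bsub>B\<^esub> inv\<^bsub>B\<^esub> d) ` UNIV)"
  have "UNIV - {\<one>\<^bsub>B\<^esub>} \<subseteq> (\<lambda>d. d \<otimes>\<^bsub>B\<^esub> b \<otimes>\<^bsub>B\<^esub> inv\<^bsub>B\<^esub> d) ` UNIV"
    using two_classes[OF assms] by auto
  then have "finite (UNIV - {\<one>\<^bsub>B\<^esub>})" using fin finite_subset by blast
  then show False using infinite_B by simp
qed

text \<open>Elements outside \<open>\<Gamma>\<close> are covered too, since it is also needed for
  vectors \<open>xi g\<close> that are fixed under conjugation by \<open>\<Gamma>\<close> but not
  supported there.\<close>

lemma infinite_orbit_snd:
  assumes "snd x \<noteq> \<one>\<^bsub>B\<^esub>"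
  shows "infinite ((\<lambda>g. g \<otimes>\<^bsub>G\<^esub> x \<otimes>\<^bsub>G\<^esub> inv\<^bsub>G\<^esub> g) ` \<Gamma>)"
proof
  assume "finite ((\<lambda>g. g \<otimes>\<^bsub>G\<^esub> x \<otimes>\<^bsub>G\<^esub> inv\<^bsub>G\<^esub> g) ` \<Gamma>)"
  then have "finite (snd ` ((\<lambda>g. g \<otimes>\<^bsub>G\<^esub> x \<otimes>\<^bsub>G\<^esub> inv\<^bsub>G\<^esub> g) ` \<Gamma>))" by (rule finite_imageI)
  moreover have "(\<lambda>d. d \<otimes>\<^bsub>B\<^esub> snd x \<otimes>\<^bsub>B\<^esub> inv\<^bsub>B\<^esub> d) ` UNIV \<subseteq> snd ` ((\<lambda>g. g \<otimes>\<^bsub>G\<^esub> x \<otimes>\<^bsub>G\<^esub> inv\<^bsub>G\<^esub> g) ` \<Gamma>)"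
  proof
    fix y assume "y \<in> (\<lambda>d. d \<otimes>\<^bsub>B\<^esub> snd x \<otimes>\<^bsub>B\<^esub> inv\<^bsub>B\<^esub> d) ` UNIV"
    then obtain d where "y = d \<otimes>\<^bsub>B\<^esub> snd x \<otimes>\<^bsub>B\<^esub> inv\<^bsub>B\<^esub> d" by auto
    then have "y = snd ((\<one>\<^bsub>alt_group\<^esub>, d) \<otimes>\<^bsub>G\<^esub> x \<otimes>\<^bsub>G\<^esub> inv\<^bsub>G\<^esub> (\<one>\<^bsub>alt_group\<^esub>, d))"
      unfolding comps by simp
    moreover have "(\<one>\<^bsub>alt_group\<^esub>, d) \<in> \<Gamma>" by (simp add: \<Gamma>_def)
    ultimately show "y \<in> snd ` ((\<lambda>g. g \<otimes>\<^bsub>G\<^esub> x \<otimes>\<^bsub>G\<^esub> inv\<^bsub>G\<^esub> g) ` \<Gamma>)" by blast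
  qed
  ultimately show False using infinite_class[OF assms] finite_subset by blast
qed

sublocale icc_subgroup G \<Gamma>
proof (intro icc_subgroup.intro icc_subgroup_axioms.intro ugroup_axioms)
  show "subgroup \<Gamma> G"
    by (rule subgroupI) (auto simp: \<Gamma>_def comps one_G intro: exI[of _ "\<one>\<^bsub>G\<^esub>"])
  fix x assume "x \<in> \<Gamma>" "x \<noteq> \<one>\<^bsub>G\<^esub>"
  then have "snd x \<noteq> \<one>\<^bsub>B\<^esub>" by (auto simp: \<Gamma>_def one_G prod_eq_iff)
  then show "infinite ((\<lambda>g. g \<otimes>\<^bsub>G\<^esub> x \<otimes>\<^bsub>G\<^esub> inv\<^bsub>G\<^esub> g) ` \<Gamma>)" by (rule infinite_orbit_snd)
qed

lemma \<Gamma>_conj: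
  assumes "x \<in> \<Gamma>" "y \<in> \<Gamma>" "x \<noteq> \<one>\<^bsub>G\<^esub>" "y \<noteq> \<one>\<^bsub>G\<^esub>"
  shows "\<exists>g. y = g \<otimes>\<^bsub>G\<^esub> x \<otimes>\<^bsub>G\<^esub> inv\<^bsub>G\<^esub> g"
proof -
  have "snd x \<noteq> \<one>\<^bsub>B\<^esub>" "snd y \<noteq> \<one>\<^bsub>B\<^esub>" using assms by (auto simp: \<Gamma>_def one_G prod_eq_iff)
  then obtain d where "snd y = d \<otimes>\<^bsub>B\<^esub> snd x \<otimes>\<^bsub>B\<^esub> inv\<^bsub>B\<^esub> d" using two_classes by blast
  then have "y = (\<one>\<^bsub>alt_group\<^esub>, d) \<otimes>\<^bsub>G\<^esub> x \<otimes>\<^bsub>G\<^esub> inv\<^bsub>G\<^esub> (\<one>\<^bsub>alt_group\<^esub>, d)"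
    using assms(1,2) by (simp add: prod_eq_iff comps \<Gamma>_def)
  then show ?thesis by blast
qed

text \<open>The centralizer of an element contains all even permutations fixing its support.\<close>

lemma supp_xi:
  assumes P: "inv_alg G P" and nz: "coef (inv_alg.xi G P g) x \<noteq> 0"
  shows "supp (fst x) \<subseteq> supp (fst g)"
proof (rule ccontr)
  interpret P: inv_alg G P by fact
  assume "\<not> ?thesis"
  then obtain m where m: "m \<in> supp (fst x)" "m \<notin> supp (fst g)" by auto
  define N where "N = UNIV - insert m (supp (fst g))"
  have infN: "infinite N" using finite_supp by (simp add: N_def Diff_infinite_finite)
  have "\<exists>c. perm c m = n \<and> (\<forall>y\<in>supp (fst g). perm c y = y)" if "n \<in> N" for n
    using that m(2) by (intro alt_fixing_moving finite_supp) (auto simp: N_def)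
  then obtain c where c: "\<And>n. n \<in> N \<Longrightarrow> perm (c n) m = n"
    "\<And>n y. n \<in> N \<Longrightarrow> y \<in> supp (fst g) \<Longrightarrow> perm (c n) y = y" by metis
  define d where "d n = (c n, \<one>\<^bsub>B\<^esub>)" for n
  define y where "y n = d n \<otimes>\<^bsub>G\<^esub> x \<otimes>\<^bsub>G\<^esub> inv\<^bsub>G\<^esub> (d n)" for n
  have const: "coef (P.xi g) (y n) = coef (P.xi g) x" if n: "n \<in> N" for n
  proof -
    have comm: "c n \<otimes>\<^bsub>alt_group\<^esub> fst g = fst g \<otimes>\<^bsub>alt_group\<^esub> c n" using c(2)[OF n] by (intro alt_commute) auto
    have "inv\<^bsub>G\<^esub> (d n) \<otimes>\<^bsub>G\<^esub> g \<otimes>\<^bsub>G\<^esub> inv\<^bsub>G\<^esub> (inv\<^bsub>G\<^esub> (d n)) = g"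
      by (simp add: prod_eq_iff comps d_def alt.m_assoc comm[symmetric]) (simp add: alt.m_assoc[symmetric])
    then have "cj (inv\<^bsub>G\<^esub> (d n)) (P.xi g) = P.xi g" by (simp add: P.cj_xi)
    then have "coef (cj (inv\<^bsub>G\<^esub> (d n)) (P.xi g)) x = coef (P.xi g) x" by simp
    then show ?thesis by (simp add: y_def)
  qed
  have "infinite (y ` N)"
  proof
    assume "finite (y ` N)"
    then have "finite (\<Union>z\<in>y ` N. supp (fst z))" by (rule finite_UN_I) (rule finite_supp)
    moreover have "n \<in> supp (fst (y n))" if "n \<in> N" for n
    proof -
      have "perm (c n) m \<in> perm (c n) ` supp (fst x)" using m by blast
      then show ?thesis using c(1)[OF that] by (simp add: y_def comps d_def supp_conj)
    qed
    then have "N \<subseteq> (\<Union>z\<in>y ` N. supp (fst z))" by auto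
    ultimately show False using infN finite_subset by blast
  qed
  then have "coef (P.xi g) x = 0"
    by (rule l2_constant_on_infinite[where v = "P.xi g"]) (auto simp: const)
  then show False using nz by simp
qed

text \<open>If the supports of the two permutation parts meet only in a point moved by both \<open>s\<close> and \<open>t\<close>,
  the coefficient of the product at \<open>s t\<close> comes from a single coset of \<open>\<Gamma>\<close>, while
  in the opposite product it vanishes.\<close>

lemma commuting_xi_aux:
  assumes P: "inv_alg G P" and Q: "inv_alg G Q" and PQ: "comm_set P Q"
    and x: "coef (inv_alg.xi G P g) \<sigma> \<noteq> 0" and y: "coef (inv_alg.xi G Q g') \<tau> \<noteq> 0"
    and p: "supp (fst g) \<inter> supp (fst g') \<subseteq> {p}" "p \<in> supp (fst \<sigma>)" "p \<in> supp (fst \<tau>)"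
  shows False
proof -
  interpret P: inv_alg G P by fact
  interpret Q: inv_alg G Q by fact
  define F where "F = supp (fst g)"
  define F' where "F' = supp (fst g')"
  have FF: "z = p" if "z \<in> F" "z \<in> F'" for z using p(1) that by (auto simp: F_def F'_def)
  define X where "X = P.xi g"
  define Y where "Y = Q.xi g'"
  have X_supp: "supp (fst z) \<subseteq> F" if "coef X z \<noteq> 0" for z
    using supp_xi[OF P] that by (simp add: X_def F_def)
  have Y_supp: "supp (fst z) \<subseteq> F'" if "coef Y z \<noteq> 0" for z
    using supp_xi[OF Q] that by (simp add: Y_def F'_def)
  define s where "s = fst \<sigma>"
  define t where "t = fst \<tau>"
  have st: "supp s \<subseteq> F" "supp t \<subseteq> F'" using X_supp x Y_supp y by (simp_all add: s_def t_def X_def Y_def)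
  \<comment> \<open>At \<one> the vector \<open>v\<close> has coefficient
    \<open>coef Y \<tau>\<close>, and \<open>w\<close> has the conjugate of
    \<open>coef X \<sigma>\<close>. Their pairing, with \<open>v\<close> conjugated by
    \<open>\<beta>\<close>, is the part over \<open>\<Gamma>\<close> of a convolution sum.
    \<open>mixing\<close> needs \<open>v\<close> to be supported in \<open>\<Gamma>\<close>, hence
    the truncation.\<close>
  define v where "v = trunc \<Gamma> (rt \<tau> Y)"
  define w where "w = J (lt (inv\<^bsub>G\<^esub> \<sigma>) X)"
  have cin0: "cin (cj \<beta> v) w = 0" if \<beta>: "\<beta> \<in> \<Gamma>" for \<beta>
  proof -
    define \<rho> where "\<rho> = \<beta> \<otimes>\<^bsub>G\<^esub> \<tau> \<otimes>\<^bsub>G\<^esub> inv\<^bsub>G\<^esub> \<beta>"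
    define r where "r = \<sigma> \<otimes>\<^bsub>G\<^esub> \<rho>"
    have fst_r: "fst r = s \<otimes>\<^bsub>alt_group\<^esub> t" using \<beta> by (simp add: r_def \<rho>_def comps \<Gamma>_def s_def t_def)
    define S where "S = Ad \<beta> (Q.E g')"
    have S: "S \<in> Q" "S (ket \<one>\<^bsub>G\<^esub>) = cj \<beta> Y"
      by (simp_all add: S_def Q.P_Ad Q.E Ad_hat Q.PL Y_def)
    have comm: "P.E g (S (ket \<one>\<^bsub>G\<^esub>)) = S (P.E g (ket \<one>\<^bsub>G\<^esub>))"
      using PQ P.E(1) S(1) unfolding comm_set_def by (metis comp_apply)
    \<comment> \<open>In this order a nonzero term needs \<open>s t = t' s'\<close> with
      \<open>supp t' \<subseteq> F'\<close> and \<open>supp s' \<subseteq> F\<close>, which the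
      one-point overlap excludes.\<close>
    have "coef (S (P.E g (ket \<one>\<^bsub>G\<^esub>))) r = (\<Sum>\<^sub>\<infinity>h. coef X h * coef (cj \<beta> Y) (r \<otimes>\<^bsub>G\<^esub> inv\<^bsub>G\<^esub> h))"
      by (simp add: coef_LG[OF Q.PL[OF S(1)]] S(2) P.E X_def del: coef_cj)
    also have "\<dots> = 0"
    proof (rule infsum_0)
      fix h
      show "coef X h * coef (cj \<beta> Y) (r \<otimes>\<^bsub>G\<^esub> inv\<^bsub>G\<^esub> h) = 0"
      proof (rule ccontr)
        assume nz: "\<not> ?thesis"
        define s' where "s' = fst h"
        define t' where "t' = s \<otimes>\<^bsub>alt_group\<^esub> t \<otimes>\<^bsub>alt_group\<^esub> inv\<^bsub>alt_group\<^esub> s'"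
        have s': "supp s' \<subseteq> F" using nz X_supp[of h] by (auto simp: s'_def)
        have "coef Y (inv\<^bsub>G\<^esub> \<beta> \<otimes>\<^bsub>G\<^esub> (r \<otimes>\<^bsub>G\<^esub> inv\<^bsub>G\<^esub> h) \<otimes>\<^bsub>G\<^esub> \<beta>) \<noteq> 0" using nz by simp
        from Y_supp[OF this] have t': "supp t' \<subseteq> F'"
          using \<beta> by (simp add: comps fst_r \<Gamma>_def t'_def s'_def)
        have "t' \<otimes>\<^bsub>alt_group\<^esub> s' = s \<otimes>\<^bsub>alt_group\<^esub> t" by (simp add: t'_def alt.m_assoc)
        then have eq: "perm t' (perm s' u) = perm s (perm t u)" for u
          by (metis perm_mult comp_apply)
        \<comment> \<open>The point \<open>u\<close> is in \<open>F'\<close> and is not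
          \<open>p\<close>, so it lies outside \<open>F\<close> and \<open>s'\<close> fixes it.
          Hence \<open>t'\<close> sends it to the image of \<open>p\<close> under \<open>s\<close>,
          a point of \<open>F \<inter> F'\<close>, that is \<open>p\<close>; but \<open>s\<close>
          moves \<open>p\<close>.\<close>
        define u where "u = perm (inv\<^bsub>alt_group\<^esub> t) p"
        have tu: "perm t u = p" by (simp add: u_def)
        have up: "u \<noteq> p" using tu p(3) by (auto simp: supp_def t_def)
        have "u \<in> supp t" using tu up by (auto simp: supp_def)
        then have uF': "u \<in> F'" using st by blast
        then have "u \<notin> F" using FF up by blast
        then have "perm s' u = u" using s' by (auto simp: supp_def)
        then have "perm t' u = perm s p" using eq[of u] tu by simp
        moreover have "perm t' u \<in> F'"
        proof (cases "perm t' u = u")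
          case False
          then have "u \<in> supp t'" by (simp add: supp_def)
          then show ?thesis using supp_moves t' by blast
        qed (simp add: uF')
        moreover have "perm s p \<in> F" using supp_moves[of p s] p(2) st by (auto simp: s_def)
        ultimately have "perm s p = p" using FF by metis
        then show False using p(2) by (simp add: supp_def s_def)
      qed
    qed
    finally have zero: "coef (P.E g (S (ket \<one>\<^bsub>G\<^esub>))) r = 0" by (simp add: comm)
    \<comment> \<open>In the opposite order a nonzero term forces \<open>fst z\<close> to be
      supported in both \<open>F\<close> and \<open>F'\<close>, hence to be trivial: the truncation
      to \<open>\<Gamma>\<close> loses nothing.\<close>
    have cv: "coef (cj \<beta> v) z * cnj (coef w z) = coef (cj \<beta> Y) (z \<otimes>\<^bsub>G\<^esub> \<rho>) * coef X (r \<otimes>\<^bsub>G\<^esub> inv\<^bsub>G\<^esub> (z \<otimes>\<^bsub>G\<^esub> \<rho>))" for z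
    proof -
      have e1: "r \<otimes>\<^bsub>G\<^esub> inv\<^bsub>G\<^esub> (z \<otimes>\<^bsub>G\<^esub> \<rho>) = \<sigma> \<otimes>\<^bsub>G\<^esub> inv\<^bsub>G\<^esub> z"
        by (simp add: r_def inv_mult_group m_assoc) (simp add: m_assoc[symmetric])
      have e2: "inv\<^bsub>G\<^esub> \<beta> \<otimes>\<^bsub>G\<^esub> (z \<otimes>\<^bsub>G\<^esub> \<rho>) \<otimes>\<^bsub>G\<^esub> \<beta> = inv\<^bsub>G\<^esub> \<beta> \<otimes>\<^bsub>G\<^esub> z \<otimes>\<^bsub>G\<^esub> \<beta> \<otimes>\<^bsub>G\<^esub> \<tau>"
        by (simp add: \<rho>_def m_assoc)
      have in\<Gamma>: "inv\<^bsub>G\<^esub> \<beta> \<otimes>\<^bsub>G\<^esub> z \<otimes>\<^bsub>G\<^esub> \<beta> \<in> \<Gamma> \<longleftrightarrow> fst z = \<one>\<^bsub>alt_group\<^esub>"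
        using \<beta> by (simp add: \<Gamma>_def comps)
      show ?thesis
      proof (cases "fst z = \<one>\<^bsub>alt_group\<^esub>")
        case True
        then show ?thesis unfolding coef_cj v_def w_def e1 e2 using in\<Gamma> by simp
      next
        case False
        have "coef Y (inv\<^bsub>G\<^esub> \<beta> \<otimes>\<^bsub>G\<^esub> z \<otimes>\<^bsub>G\<^esub> \<beta> \<otimes>\<^bsub>G\<^esub> \<tau>) * coef X (\<sigma> \<otimes>\<^bsub>G\<^esub> inv\<^bsub>G\<^esub> z) = 0"
        proof (rule ccontr)
          assume "\<not> ?thesis"
          then have nz: "coef Y (inv\<^bsub>G\<^esub> \<beta> \<otimes>\<^bsub>G\<^esub> z \<otimes>\<^bsub>G\<^esub> \<beta> \<otimes>\<^bsub>G\<^esub> \<tau>) \<noteq> 0" "coef X (\<sigma> \<otimes>\<^bsub>G\<^esub> inv\<^bsub>G\<^esub> z) \<noteq> 0" by auto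
          define a where "a = fst z"
          have "supp (a \<otimes>\<^bsub>alt_group\<^esub> t) \<subseteq> F'"
            using Y_supp[OF nz(1)] \<beta> by (simp add: comps \<Gamma>_def a_def t_def)
          moreover have "a = (a \<otimes>\<^bsub>alt_group\<^esub> t) \<otimes>\<^bsub>alt_group\<^esub> inv\<^bsub>alt_group\<^esub> t" by (simp add: alt.m_assoc)
          ultimately have aF': "supp a \<subseteq> F'"
            using supp_mult[of "a \<otimes>\<^bsub>alt_group\<^esub> t" "inv\<^bsub>alt_group\<^esub> t"] st(2) unfolding supp_inv by auto
          have "supp (s \<otimes>\<^bsub>alt_group\<^esub> inv\<^bsub>alt_group\<^esub> a) \<subseteq> F"
            using X_supp[OF nz(2)] by (simp add: comps a_def s_def)
          moreover have "inv\<^bsub>alt_group\<^esub> a = inv\<^bsub>alt_group\<^esub> s \<otimes>\<^bsub>alt_group\<^esub> (s \<otimes>\<^bsub>alt_group\<^esub> inv\<^bsub>alt_group\<^esub> a)"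
            by (simp add: alt.m_assoc[symmetric])
          ultimately have aF: "supp a \<subseteq> F"
            using supp_mult[of "inv\<^bsub>alt_group\<^esub> s" "s \<otimes>\<^bsub>alt_group\<^esub> inv\<^bsub>alt_group\<^esub> a"] st(1)
            unfolding supp_inv by (metis Un_least order_trans supp_inv)
          have "supp a \<subseteq> {p}" using aF aF' FF by blast
          then show False using supp_empty False by (auto simp: a_def)
        qed
        then show ?thesis unfolding coef_cj v_def w_def e1 e2 using in\<Gamma> False by auto
      qed
    qed
    have "cin (cj \<beta> v) w = (\<Sum>\<^sub>\<infinity>z. coef (cj \<beta> Y) (z \<otimes>\<^bsub>G\<^esub> \<rho>) * coef X (r \<otimes>\<^bsub>G\<^esub> inv\<^bsub>G\<^esub> (z \<otimes>\<^bsub>G\<^esub> \<rho>)))"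
      unfolding cin_def cv ..
    also have "\<dots> = (\<Sum>\<^sub>\<infinity>h. coef (cj \<beta> Y) h * coef X (r \<otimes>\<^bsub>G\<^esub> inv\<^bsub>G\<^esub> h))"
      by (rule infsum_reindex_bij_betw[OF bij_right])
    also have "\<dots> = coef (P.E g (S (ket \<one>\<^bsub>G\<^esub>))) r"
      by (simp add: coef_LG[OF P.PL[OF P.E(1)]] S(2) P.E X_def del: coef_cj)
    finally show ?thesis by (simp add: zero)
  qed
  define q where "q = coef v \<one>\<^bsub>G\<^esub> * cnj (coef w \<one>\<^bsub>G\<^esub>)"
  have "\<one>\<^bsub>G\<^esub> \<in> \<Gamma>" by (rule \<Gamma>_one)
  then have "q \<noteq> 0" using x y by (simp add: q_def v_def w_def X_def Y_def)
  obtain b where "b \<noteq> \<one>\<^bsub>B\<^esub>" using infinite_B ex_new_if_finite[of "{\<one>\<^bsub>B\<^esub>}"] by auto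
  then have b: "(\<one>\<^bsub>alt_group\<^esub>, b) \<in> \<Gamma>" "(\<one>\<^bsub>alt_group\<^esub>, b) \<noteq> \<one>\<^bsub>G\<^esub>" by (auto simp: \<Gamma>_def one_G)
  \<comment> \<open>An inner product within \<open>cmod q\<close> of \<open>q\<close> is nonzero,
    which contradicts \<open>cin0\<close>.\<close>
  have "\<exists>\<beta>\<in>\<Gamma>. \<beta> \<noteq> \<one>\<^bsub>G\<^esub> \<and> (\<forall>i\<in>{()}. cmod (cin (cj \<beta> v) w - coef v \<one>\<^bsub>G\<^esub> * cnj (coef w \<one>\<^bsub>G\<^esub>)) < cmod q)"
    by (rule mixing[OF _ _ b]) (use \<open>q \<noteq> 0\<close> in \<open>auto simp: v_def\<close>)
  then show False using cin0 by (auto simp: q_def[symmetric])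
qed

lemma commuting_xi:
  assumes P: "inv_alg G P" and Q: "inv_alg G Q" and PQ: "comm_set P Q"
  shows "(\<forall>g x. x \<notin> \<Gamma> \<longrightarrow> coef (inv_alg.xi G P g) x = 0) \<or> (\<forall>g x. x \<notin> \<Gamma> \<longrightarrow> coef (inv_alg.xi G Q g) x = 0)"
proof (rule ccontr)
  interpret P: inv_alg G P by fact
  interpret Q: inv_alg G Q by fact
  assume "\<not> ?thesis"
  then obtain g \<sigma> g' \<tau> where nz: "\<sigma> \<notin> \<Gamma>" "coef (P.xi g) \<sigma> \<noteq> 0" "\<tau> \<notin> \<Gamma>" "coef (Q.xi g') \<tau> \<noteq> 0" by blast
  have "supp (fst \<sigma>) \<noteq> {}" "supp (fst \<tau>) \<noteq> {}"
    using nz supp_empty[of "fst \<sigma>"] supp_empty[of "fst \<tau>"] by (auto simp: \<Gamma>_def)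
  then obtain m m' where m: "m \<in> supp (fst \<sigma>)" "m' \<in> supp (fst \<tau>)" by auto
  obtain c where c: "perm c m' = m" "perm c ` supp (fst g') \<inter> supp (fst g) \<subseteq> {m}"
    using alt_separating[OF finite_supp finite_supp] by blast
  define d where "d = (c, \<one>\<^bsub>B\<^esub>)"
  show False
  proof (rule commuting_xi_aux[OF P Q PQ nz(2)])
    show "coef (Q.xi (d \<otimes>\<^bsub>G\<^esub> g' \<otimes>\<^bsub>G\<^esub> inv\<^bsub>G\<^esub> d)) (d \<otimes>\<^bsub>G\<^esub> \<tau> \<otimes>\<^bsub>G\<^esub> inv\<^bsub>G\<^esub> d) \<noteq> 0"
    proof -
      have "inv\<^bsub>G\<^esub> d \<otimes>\<^bsub>G\<^esub> (d \<otimes>\<^bsub>G\<^esub> \<tau> \<otimes>\<^bsub>G\<^esub> inv\<^bsub>G\<^esub> d) \<otimes>\<^bsub>G\<^esub> d = \<tau>"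
        by (simp add: m_assoc) (simp add: m_assoc[symmetric])
      then show ?thesis using nz(4) by (simp add: Q.cj_xi[symmetric])
    qed
    show "supp (fst g) \<inter> supp (fst (d \<otimes>\<^bsub>G\<^esub> g' \<otimes>\<^bsub>G\<^esub> inv\<^bsub>G\<^esub> d)) \<subseteq> {m}"
      using c(2) by (auto simp: comps d_def supp_conj)
    show "m \<in> supp (fst (d \<otimes>\<^bsub>G\<^esub> \<tau> \<otimes>\<^bsub>G\<^esub> inv\<^bsub>G\<^esub> d))"
      using c(1) m(2) by (auto simp: comps d_def supp_conj)
  qed (rule m)
qed

text \<open>For \<open>Q\<close> commuting with itself both alternatives of
  \<open>commuting_xi\<close> coincide, so \<open>Q\<close> lives over \<open>\<Gamma>\<close> and
  \<open>abelian_trivial\<close> applies.\<close>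

lemma center_trivial:
  assumes Q: "inv_alg G Q" and ab: "comm_set Q Q"
  shows "trivial_alg Q"
proof (rule abelian_trivial[OF Q ab _ \<Gamma>_conj])
  interpret Q: inv_alg G Q by fact
  fix T x assume T: "T \<in> Q" and x: "x \<notin> \<Gamma>"
  have "coef (Q.xi x) x = 0" using commuting_xi[OF Q Q ab] x by blast
  then have "Q.xi x = 0" by (rule Q.xi_eq_0I)
  then show "coef (T (ket \<one>\<^bsub>G\<^esub>)) x = 0" using Q.coef_K[OF Q.hat_K[OF T], of x] by simp
qed

section \<open>The dichotomy for translations\<close>

lemma xi_\<Gamma>_eq_0:
  assumes Q: "inv_alg G Q" and "inv_alg.xi G Q a = 0" "a \<in> \<Gamma>" "a \<noteq> \<one>\<^bsub>G\<^esub>" "b \<in> \<Gamma>" "b \<noteq> \<one>\<^bsub>G\<^esub>"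
  shows "inv_alg.xi G Q b = 0"
proof -
  interpret Q: inv_alg G Q by fact
  obtain g where "b = g \<otimes>\<^bsub>G\<^esub> a \<otimes>\<^bsub>G\<^esub> inv\<^bsub>G\<^esub> g" using \<Gamma>_conj assms by blast
  then have "norm (Q.xi b) = norm (Q.xi a)" by (simp add: Q.norm_xi_conj)
  then show ?thesis using assms by simp
qed

text \<open>Under \<open>sc\<close> the vector \<open>xi g\<close> is \<open>l\<close> times
  \<open>ket g\<close>. If \<open>l\<close> is nonzero, \<open>ket g\<close> belongs to
  \<open>K\<close>, and closedness puts \<open>lt g\<close> into \<open>P\<close>.\<close>

lemma translation_or_orthogonal_aux:
  assumes P: "inv_alg G P"
    and sc: "\<And>h. h \<noteq> \<one>\<^bsub>G\<^esub> \<Longrightarrow> coef (lt (inv\<^bsub>G\<^esub> g) (inv_alg.xi G P g)) h = 0"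
  shows "inv_alg.xi G P g = 0 \<or> lt g \<in> P"
proof -
  interpret P: inv_alg G P by fact
  define l where "l = coef (P.xi g) g"
  have xi: "P.xi g = cscale l (ket g)"
  proof (rule l2_eqI)
    fix x
    have "coef (P.xi g) x = 0" if "x \<noteq> g"
    proof -
      have "inv\<^bsub>G\<^esub> g \<otimes>\<^bsub>G\<^esub> x \<noteq> \<one>\<^bsub>G\<^esub>" using that by (simp add: mult_eq_iff)
      from sc[OF this] show ?thesis by (simp add: m_assoc[symmetric])
    qed
    then show "coef (P.xi g) x = coef (cscale l (ket g)) x" by (auto simp: l_def)
  qed
  show ?thesis
  proof (cases "l = 0")
    case True then show ?thesis using xi by simp
  next
    case False
    have "cscale (1 / l) (P.xi g) \<in> P.K" using csubspaceD(3)[OF P.cs.sub] by simp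
    then have "ket g \<in> P.K" using False by (simp add: xi)
    then have "lt g \<in> P" by (intro P.P_closed LG_lt) (simp add: P.K_def)
    then show ?thesis ..
  qed
qed

text \<open>The vector of \<open>lt (inv g) \<circ> E g\<close> belongs to \<open>cm P\<close>, so
  its coefficient at \<open>h\<close> vanishes whenever \<open>N.xi h = 0\<close>. At the remaining
  \<open>h\<close> the argument uses where \<open>P.xi g\<close> itself is supported.\<close>

lemma translation_or_orthogonal:
  assumes P: "inv_alg G P"
  shows "lt g \<in> P \<or> (\<forall>T\<in>P. coef (T (ket \<one>\<^bsub>G\<^esub>)) g = 0)"
proof -
  interpret P: inv_alg G P by fact
  have N: "inv_alg G (cm P)" by (rule inv_alg_cm[OF P])
  interpret N: inv_alg G "cm P" by (rule N)
  have N2: "inv_alg G (cm (cm P))" by (rule inv_alg_cm[OF N])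
  interpret N2: inv_alg G "cm (cm P)" by (rule N2)
  have off\<Gamma>: "inv_alg.xi G Q h = 0"
    if Q: "inv_alg G Q" and supp: "\<forall>g x. x \<notin> \<Gamma> \<longrightarrow> coef (inv_alg.xi G Q g) x = 0" and h: "h \<notin> \<Gamma>" for Q h
    using inv_alg.xi_eq_0I[OF Q] supp h by blast
  have orth: "coef (s (ket \<one>\<^bsub>G\<^esub>)) h = 0" if "s \<in> cm Q" "inv_alg G Q" "inv_alg.xi G (cm Q) h = 0" for s h Q
    using inv_alg.coef_K[OF inv_alg_cm[OF that(2)] inv_alg.hat_K[OF inv_alg_cm[OF that(2)] that(1)], of h] that(3) by simp
  have shift: "coef (lt (inv\<^bsub>G\<^esub> k) (inv_alg.xi G Q k)) h = 0"
    if "inv_alg G Q" "inv_alg.xi G (cm Q) h = 0" for k h Q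
    using orth[OF inv_alg.shift_E_cm[OF that(1), of k] that] inv_alg.E(2)[OF that(1)] by simp
  have in\<Gamma>: "x \<otimes>\<^bsub>G\<^esub> y \<in> \<Gamma> \<longleftrightarrow> y \<in> \<Gamma>" if "x \<in> \<Gamma>" for x y
    using that by (simp add: \<Gamma>_def comps)
  have "P.xi g = 0 \<or> lt g \<in> P"
  proof (cases "g = \<one>\<^bsub>G\<^esub>")
    case True
    have "lt \<one>\<^bsub>G\<^esub> = id" by (rule ext) simp
    then show ?thesis using True P.P_id by simp
  next
    case g: False
    have PN: "comm_set P (cm P)" by (auto simp: comm_set_def intro: cmD[symmetric])
    consider (P_\<Gamma>) "\<forall>g x. x \<notin> \<Gamma> \<longrightarrow> coef (P.xi g) x = 0" | (N_\<Gamma>) "\<forall>g x. x \<notin> \<Gamma> \<longrightarrow> coef (N.xi g) x = 0"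
      using commuting_xi[OF P N PN] by blast
    then show ?thesis
    proof cases
      \<comment> \<open>A nonzero \<open>xi g\<close> puts \<open>g\<close> into
        \<open>\<Gamma>\<close>; the alternative for the two expectations then makes
        \<open>N.xi\<close> vanish on all of \<open>\<Gamma>\<close> except \<one>, and off
        \<open>\<Gamma>\<close> the support of \<open>P.xi g\<close> decides.\<close>
      case supp: P_\<Gamma>
      show ?thesis
      proof (cases "P.xi g = 0")
        case False
        then have g\<Gamma>: "g \<in> \<Gamma>" using off\<Gamma>[OF P supp] by blast
        have "N.xi g = 0" using xi_or_xi_cm_eq_0[OF P g center_trivial] False by blast
        then have N0: "N.xi h = 0" if "h \<in> \<Gamma>" "h \<noteq> \<one>\<^bsub>G\<^esub>" for h
          using xi_\<Gamma>_eq_0[OF N _ g\<Gamma> g] that by blast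
        show ?thesis
        proof (rule translation_or_orthogonal_aux[OF P])
          fix h assume h: "h \<noteq> \<one>\<^bsub>G\<^esub>"
          show "coef (lt (inv\<^bsub>G\<^esub> g) (P.xi g)) h = 0"
          proof (cases "h \<in> \<Gamma>")
            case True then show ?thesis using shift[OF P N0] h by blast
          next
            case False
            then have "coef (P.xi g) (g \<otimes>\<^bsub>G\<^esub> h) = 0" using supp in\<Gamma>[OF g\<Gamma>] by blast
            then show ?thesis by simp
          qed
        qed
      qed simp
    next
      case supp: N_\<Gamma>
      show ?thesis
      proof (cases "\<forall>h\<in>\<Gamma>. h \<noteq> \<one>\<^bsub>G\<^esub> \<longrightarrow> N.xi h = 0")
        case True
        \<comment> \<open>In this case \<open>cm P\<close> is scalar, so \<open>shift\<close> alone
          is enough.\<close>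
        then have "N.xi h = 0" if "h \<noteq> \<one>\<^bsub>G\<^esub>" for h using off\<Gamma>[OF N supp] that by blast
        then show ?thesis using shift[OF P] by (intro translation_or_orthogonal_aux[OF P]) blast
      next
        case False
        then have N_nz: "N.xi h \<noteq> 0" if "h \<in> \<Gamma>" "h \<noteq> \<one>\<^bsub>G\<^esub>" for h
          using xi_\<Gamma>_eq_0[OF N _ that] by blast
        \<comment> \<open>This is the previous alternative with \<open>cm P\<close> in the role of
          \<open>P\<close>. Now \<open>cm P\<close> contains all translations by
          \<open>\<Gamma>\<close>, so \<open>P.xi g\<close> is fixed under conjugation by
          \<open>\<Gamma>\<close> and therefore lives on the alternating factor.\<close>
        have ltN: "lt h \<in> cm P" if h: "h \<in> \<Gamma>" "h \<noteq> \<one>\<^bsub>G\<^esub>" for h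
        proof -
          have "N2.xi k = 0" if "k \<in> \<Gamma>" "k \<noteq> \<one>\<^bsub>G\<^esub>" for k
            using xi_or_xi_cm_eq_0[OF N that(2) center_trivial] N_nz[OF that] by blast
          then have "N.xi h = 0 \<or> lt h \<in> cm P"
            using shift[OF N, of _ h] supp in\<Gamma>[OF h(1)]
            by (intro translation_or_orthogonal_aux[OF N]) (metis coef_lt inv_inv carrier_UNIV UNIV_I)
          then show ?thesis using N_nz[OF h] by blast
        qed
        have fixed: "cj h (P.xi g) = P.xi g" if h: "h \<in> \<Gamma>" for h
        proof (cases "h = \<one>\<^bsub>G\<^esub>")
          case False
          have "lt h \<circ> P.E g = P.E g \<circ> lt h" by (rule cmD[OF ltN[OF h False] P.E(1)])
          then have "Ad h (P.E g) = P.E g" by (simp add: Ad_def fun_eq_iff)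
          then show ?thesis using Ad_hat[OF P.PL[OF P.E(1)], of h g] by (simp add: P.E)
        qed simp
        have xi_A: "coef (P.xi g) x = 0" if "snd x \<noteq> \<one>\<^bsub>B\<^esub>" for x
        proof (rule l2_constant_on_infinite[OF infinite_orbit_snd[OF that]])
          fix y assume "y \<in> (\<lambda>g. g \<otimes>\<^bsub>G\<^esub> x \<otimes>\<^bsub>G\<^esub> inv\<^bsub>G\<^esub> g) ` \<Gamma>"
          then obtain k where k: "k \<in> \<Gamma>" "y = k \<otimes>\<^bsub>G\<^esub> x \<otimes>\<^bsub>G\<^esub> inv\<^bsub>G\<^esub> k" by auto
          have "coef (cj (inv\<^bsub>G\<^esub> k) (P.xi g)) x = coef (P.xi g) x" using fixed[OF \<Gamma>_inv[OF k(1)]] by simp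
          then show "coef (P.xi g) y = coef (P.xi g) x" by (simp add: k(2))
        qed
        show ?thesis
        proof (cases "snd g = \<one>\<^bsub>B\<^esub>")
          case False then show ?thesis using P.xi_eq_0I[OF xi_A] by blast
        next
          case True
          show ?thesis
          proof (rule translation_or_orthogonal_aux[OF P])
            fix h assume h: "h \<noteq> \<one>\<^bsub>G\<^esub>"
            show "coef (lt (inv\<^bsub>G\<^esub> g) (P.xi g)) h = 0"
            proof (cases "h \<in> \<Gamma>")
              case False then show ?thesis using shift[OF P off\<Gamma>[OF N supp]] by blast
            next
              case h\<Gamma>: True
              then have "snd h \<noteq> \<one>\<^bsub>B\<^esub>" using h by (auto simp: \<Gamma>_def one_G prod_eq_iff)
              then show ?thesis using True by (simp add: xi_A comps)
            qed
          qed
        qed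
      qed
    qed
  qed
  then show ?thesis using P.coef_K[OF P.hat_K, of _ g] by auto
qed

end

section \<open>Transport to operators on a carrier\<close>

text \<open>Bridges extensional operators on \<open>ell2 (carrier D)\<close> and operators on a
  type: \<open>V\<close> and \<open>W\<close> are mutually inverse isometries, and
  \<open>low\<close> and \<open>up\<close> conjugate operators by them.\<close>

locale group_transport = ugroup G + D: group D
  for G :: "('g, 'n) monoid_scheme" (structure) and D :: "('a, 'm) monoid_scheme" +
  fixes \<theta> :: "'g \<Rightarrow> 'a"
  assumes \<theta>_iso: "\<theta> \<in> iso G D"
begin

abbreviation S where "S \<equiv> carrier D"

lemma \<theta>_bij: "bij_betw \<theta> UNIV S" using \<theta>_iso by (simp add: iso_def)

lemma \<theta>_S [simp]: "\<theta> x \<in> S" using \<theta>_bij by (auto simp: bij_betw_def)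

lemma \<theta>_mult: "\<theta> (x \<otimes> y) = \<theta> x \<otimes>\<^bsub>D\<^esub> \<theta> y"
  using \<theta>_iso by (simp add: iso_def hom_def)

lemma \<theta>_inv: "\<theta> (inv x) = inv\<^bsub>D\<^esub> (\<theta> x)"
proof -
  have "group_hom G D \<theta>"
    using \<theta>_iso by (intro group_hom.intro group_hom_axioms.intro D.is_group is_group) (auto simp: iso_def)
  then show ?thesis using group_hom.hom_inv[of G D \<theta> x] by simp
qed

definition \<phi> where "\<phi> = inv_into UNIV \<theta>"

lemma \<phi>_\<theta> [simp]: "\<phi> (\<theta> x) = x" using \<theta>_bij by (simp add: \<phi>_def bij_betw_def)
lemma \<theta>_\<phi> [simp]: "y \<in> S \<Longrightarrow> \<theta> (\<phi> y) = y"
  using \<theta>_bij by (simp add: \<phi>_def bij_betw_def f_inv_into_f)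

lemma \<theta>_cases: "y \<in> S \<Longrightarrow> \<exists>x. y = \<theta> x" by (metis \<theta>_\<phi>)

definition V :: "('a \<Rightarrow> complex) \<Rightarrow> 'g l2" where "V f = Abs_l2 (\<lambda>x. f (\<theta> x))"
definition W :: "'g l2 \<Rightarrow> 'a \<Rightarrow> complex" where "W v y = (if y \<in> S then coef v (\<phi> y) else 0)"

lemma coef_V: assumes "f \<in> ell2 S" shows "coef (V f) x = f (\<theta> x)"
proof -
  have "(\<lambda>x. (cmod (f x))\<^sup>2) summable_on S"
    using assms by (auto simp: ell2_def elim: summable_on_subset_banach)
  then have "(\<lambda>x. (cmod (f (\<theta> x)))\<^sup>2) summable_on UNIV"
    using summable_on_reindex_bij_betw[OF \<theta>_bij, of "\<lambda>x. (cmod (f x))\<^sup>2"] by simp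
  then show ?thesis by (simp add: V_def coef_Abs)
qed

lemma W_ell2: "W v \<in> ell2 S"
proof -
  have "(\<lambda>x. (cmod (W v x))\<^sup>2) summable_on S"
    using summable_on_reindex_bij_betw[OF \<theta>_bij, of "\<lambda>x. (cmod (W v x))\<^sup>2"] coef_summable[of v]
    by (simp add: W_def)
  then show ?thesis by (simp add: ell2_def W_def)
qed

lemma W_V: "f \<in> ell2 S \<Longrightarrow> W (V f) = f"
  by (rule ext) (auto simp: W_def coef_V ell2_def)

lemma V_W: "V (W v) = v"
  by (rule l2_eqI) (simp add: coef_V[OF W_ell2] W_def)

lemma ell2_add: "f \<in> ell2 S \<Longrightarrow> g \<in> ell2 S \<Longrightarrow> (\<lambda>x. f x + g x) \<in> ell2 S"
  by (simp add: ell2_def sq_summable_add)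

lemma ell2_cmult: "f \<in> ell2 S \<Longrightarrow> (\<lambda>x. c * f x) \<in> ell2 S"
  by (simp add: ell2_def sq_summable_cmult)

lemma V_add: "f \<in> ell2 S \<Longrightarrow> g \<in> ell2 S \<Longrightarrow> V (\<lambda>x. f x + g x) = V f + V g"
  by (rule l2_eqI) (simp add: coef_V ell2_add)

lemma V_cmult: "f \<in> ell2 S \<Longrightarrow> V (\<lambda>x. c * f x) = cscale c (V f)"
  by (rule l2_eqI) (simp add: coef_V ell2_cmult)

lemma W_add: "W (v + w) = (\<lambda>x. W v x + W w x)" by (rule ext) (simp add: W_def)
lemma W_cscale: "W (cscale c v) = (\<lambda>x. c * W v x)" by (rule ext) (simp add: W_def)

lemma ell2_inner_V: assumes "f \<in> ell2 S" "g \<in> ell2 S" shows "ell2_inner S f g = cin (V f) (V g)"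
  unfolding ell2_inner_def cin_def
  using infsum_reindex_bij_betw[OF \<theta>_bij, of "\<lambda>x. f x * cnj (g x)"] assms by (simp add: coef_V)

lemma ell2_norm_V: assumes "f \<in> ell2 S" shows "ell2_norm S f = norm (V f)"
proof -
  have "ell2_norm S f = sqrt ((norm (V f))\<^sup>2)"
    unfolding ell2_norm_def norm_l2_sq
    using infsum_reindex_bij_betw[OF \<theta>_bij, of "\<lambda>x. (cmod (f x))\<^sup>2"] assms by (simp add: coef_V)
  then show ?thesis by simp
qed

section \<open>Transport of operators and algebra operations\<close>

definition low :: "'a operator \<Rightarrow> 'g l2 \<Rightarrow> 'g l2" where "low T v = V (T (W v))"
definition up :: "('g l2 \<Rightarrow> 'g l2) \<Rightarrow> 'a operator" where "up X = (\<lambda>f\<in>ell2 S. W (X (V f)))"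

lemma bounded_operators_ell2: "T \<in> bounded_operators S \<Longrightarrow> f \<in> ell2 S \<Longrightarrow> T f \<in> ell2 S"
  by (auto simp: bounded_operators_def)

lemma V_apply: "f \<in> ell2 S \<Longrightarrow> V (T f) = low T (V f)"
  by (simp add: low_def W_V)

lemma low_bop: assumes "T \<in> bounded_operators S" shows "bop (low T)"
proof -
  obtain C where C: "\<forall>f\<in>ell2 S. ell2_norm S (T f) \<le> C * ell2_norm S f"
    using assms unfolding bounded_operators_def by blast
  show ?thesis
  proof (rule bopI)
    fix v w c
    show "low T (v + w) = low T v + low T w"
      using assms W_ell2 by (simp add: low_def W_add bounded_operators_def V_add[symmetric] PiE_def Pi_def)
    show "low T (cscale c v) = cscale c (low T v)"
      using assms W_ell2 by (simp add: low_def W_cscale bounded_operators_def V_cmult[symmetric] PiE_def Pi_def)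
    show "norm (low T v) \<le> C * norm v"
      using bspec[OF C W_ell2, of v] bounded_operators_ell2[OF assms W_ell2]
      by (simp add: low_def ell2_norm_V W_ell2 V_W)
  qed
qed

lemma up_bounded: assumes "bop X" shows "up X \<in> bounded_operators S"
proof -
  obtain C where "\<And>v. norm (X v) \<le> C * norm v" using bop_bound[OF assms] by blast
  then have "\<forall>f\<in>ell2 S. ell2_norm S (up X f) \<le> C * ell2_norm S f"
    by (simp add: up_def ell2_norm_V W_ell2 V_W)
  then show ?thesis
    unfolding bounded_operators_def
    by (auto simp: up_def W_ell2 ell2_add ell2_cmult V_add V_cmult bop_simps[OF assms] W_add W_cscale)
qed

lemma low_up: "low (up X) = X"
  by (rule ext) (simp add: low_def up_def W_ell2 V_W)

lemma up_low: assumes "T \<in> bounded_operators S" shows "up (low T) = T"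
proof
  fix f show "up (low T) f = T f"
  proof (cases "f \<in> ell2 S")
    case True then show ?thesis using assms by (simp add: up_def low_def W_V bounded_operators_ell2)
  next
    case False then show ?thesis using assms by (auto simp: up_def bounded_operators_def PiE_def extensional_def)
  qed
qed

lemma op_id_up: "op_id S = up id"
  unfolding op_id_def up_def by (rule restrict_ext) (simp add: W_V)

lemma op_comp_up: "op_comp S (up X) (up Y) = up (X \<circ> Y)"
  unfolding op_comp_def up_def compose_def by (rule restrict_ext) (simp add: W_ell2 V_W)

lemma op_add_up: "op_add S (up X) (up Y) = up (\<lambda>v. X v + Y v)"
  unfolding op_add_def by (subst (3) up_def, rule restrict_ext) (simp add: up_def W_add)

lemma op_scale_up: "op_scale S c (up X) = up (\<lambda>v. cscale c (X v))"
  unfolding op_scale_def by (subst (2) up_def, rule restrict_ext) (simp add: up_def W_cscale)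

lemma op_adjoint_up: assumes X: "bop X" shows "op_adjoint S (up X) = up (adj X)"
  unfolding op_adjoint_def
proof (rule the_equality)
  show "up (adj X) \<in> bounded_operators S \<and>
      (\<forall>f\<in>ell2 S. \<forall>g\<in>ell2 S. ell2_inner S (up X f) g = ell2_inner S f (up (adj X) g))"
    using up_bounded[OF bop_adj[OF X]]
    by (auto simp: ell2_inner_V bounded_operators_ell2 up_bounded X V_apply low_up cin_adj_right)
  fix T assume T: "T \<in> bounded_operators S \<and>
      (\<forall>f\<in>ell2 S. \<forall>g\<in>ell2 S. ell2_inner S (up X f) g = ell2_inner S f (T g))"
  have "adj X = low T"
  proof (rule adj_eqI[OF X])
    fix v w
    have "ell2_inner S (up X (W v)) (W w) = ell2_inner S (W v) (T (W w))" using T W_ell2 by blast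
    then show "cin (X v) w = cin v (low T w)"
      using T by (simp add: ell2_inner_V W_ell2 bounded_operators_ell2 up_bounded X V_apply low_up V_W)
  qed
  then show "T = up (adj X)" using T up_low by auto
qed

lemma left_translation_up: "left_translation D (\<theta> g) = up (lt g)"
  unfolding left_translation_def up_def
proof (rule restrict_ext)
  fix f assume f: "f \<in> ell2 S"
  show "(\<lambda>x. if x \<in> S then f (inv\<^bsub>D\<^esub> \<theta> g \<otimes>\<^bsub>D\<^esub> x) else 0) = W (lt g (V f))"
    by (rule ext) (auto simp: W_def coef_V f \<theta>_mult \<theta>_inv)
qed

lemma commutant_up:
  assumes "M \<subseteq> bounded_operators S"
  shows "up X \<in> commutant S M \<longleftrightarrow> up X \<in> bounded_operators S \<and> (\<forall>R\<in>M. X \<circ> low R = low R \<circ> X)"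
proof -
  have "op_comp S (up X) R = op_comp S R (up X) \<longleftrightarrow> X \<circ> low R = low R \<circ> X" if "R \<in> M" for R
  proof -
    have "up (low R) = R" using that assms by (intro up_low) blast
    then have "op_comp S (up X) R = up (X \<circ> low R)" "op_comp S R (up X) = up (low R \<circ> X)"
      using op_comp_up[of X "low R"] op_comp_up[of "low R" X] by simp_all
    then show ?thesis using low_up by metis
  qed
  then show ?thesis by (auto simp: commutant_def)
qed

lemma commutant_subset: "commutant S M \<subseteq> bounded_operators S"
  by (auto simp: commutant_def)

lemma subset_bicommutant: "M \<subseteq> bounded_operators S \<Longrightarrow> M \<subseteq> commutant S (commutant S M)"
  by (auto simp: commutant_def)

text \<open>The right translations lie in the commutant, so everything in the bicommutant commutes
  with them.\<close>

lemma von_neumann_LG: "von_neumann_algebra S (up ` LG)"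
proof -
  have bd: "up ` LG \<subseteq> bounded_operators S" by (auto intro: up_bounded LG_bop)
  have "commutant S (commutant S (up ` LG)) \<subseteq> up ` LG"
  proof
    fix T assume T: "T \<in> commutant S (commutant S (up ` LG))"
    then have TB: "T \<in> bounded_operators S" using commutant_subset by blast
    have "up (rt h) \<in> commutant S (up ` LG)" for h
      using bd by (auto simp: commutant_up up_bounded low_up LG_rt fun_eq_iff)
    then have "low T \<circ> rt h = rt h \<circ> low T" for h
      using T commutant_up[OF commutant_subset, of "low T" "up ` LG"] by (metis TB low_up up_low)
    then have "low T \<in> LG" by (simp add: LG_def low_bop[OF TB] fun_eq_iff)
    then show "T \<in> up ` LG" using up_low[OF TB] by (metis imageI)
  qed
  with subset_bicommutant[OF bd] have "commutant S (commutant S (up ` LG)) = up ` LG" by blast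
  then show ?thesis
    unfolding von_neumann_algebra_def using bd
    by (auto simp: op_id_up op_add_up op_scale_up op_comp_up op_adjoint_up LG_bop
        intro!: imageI LG_id LG_add LG_cscale LG_comp LG_adj)
qed

lemma group_vN_LG: "group_vN D S \<subseteq> up ` LG"
proof -
  have "left_translation D ` S \<subseteq> up ` LG"
    using \<theta>_cases by (auto simp: left_translation_up intro!: imageI LG_lt) (metis LG_lt imageI left_translation_up)
  then show ?thesis
    unfolding group_vN_def vN_generated_def using von_neumann_LG by blast
qed

text \<open>Formally \<open>X\<close> is the sum of \<open>c g\<close> times \<open>lt g\<close>, a
  series that need not converge strongly. Its matrix coefficients do converge, and within them
  \<open>R\<close> can be moved past each term with \<open>c g \<noteq> 0\<close>, after
  reindexing.\<close>

lemma commutes_of_support: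
  assumes X: "X \<in> LG" and R: "bop R"
    and supp: "\<And>g. coef (X (ket \<one>)) g \<noteq> 0 \<Longrightarrow> R \<circ> lt g = lt g \<circ> R"
  shows "X \<circ> R = R \<circ> X"
proof (rule bop_eqI)
  show "bop (X \<circ> R)" "bop (R \<circ> X)" using X R by (simp_all add: bop_comp LG_bop)
  fix x
  show "(X \<circ> R) (ket x) = (R \<circ> X) (ket x)"
  proof (rule l2_eqI)
    fix y
    define c where "c g = coef (X (ket \<one>)) g" for g
    have bij: "bij (\<lambda>g. inv g \<otimes> y)"
      using bij_comp[OF bij_inv bij_right[of y]] by (simp add: o_def)
    have "coef (X (R (ket x))) y = (\<Sum>\<^sub>\<infinity>h. coef (R (ket x)) h * c (y \<otimes> inv h))"
      unfolding c_def by (rule coef_LG[OF X])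
    also have "\<dots> = (\<Sum>\<^sub>\<infinity>g. coef (R (ket x)) (inv g \<otimes> y) * c g)"
      by (subst infsum_reindex_bij_betw[OF bij, symmetric]) (simp add: inv_mult_group m_assoc[symmetric])
    also have "\<dots> = (\<Sum>\<^sub>\<infinity>g. c g * coef (R (ket (g \<otimes> x))) y)"
    proof (rule infsum_cong)
      fix g
      show "coef (R (ket x)) (inv g \<otimes> y) * c g = c g * coef (R (ket (g \<otimes> x))) y"
      proof (cases "c g = 0")
        case False
        then have "R (lt g (ket x)) = lt g (R (ket x))"
          using fun_cong[OF supp[of g], of "ket x"] by (simp add: c_def del: lt_ket)
        then show ?thesis by simp
      qed simp
    qed
    also have "\<dots> = (\<Sum>\<^sub>\<infinity>k. c (k \<otimes> inv x) * coef (R (ket k)) y)"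
      by (subst infsum_reindex_bij_betw[OF bij_right[of x], symmetric]) (simp add: m_assoc)
    also have "\<dots> = (\<Sum>\<^sub>\<infinity>k. coef (X (ket x)) k * cnj (coef (adj R (ket y)) k))"
    proof (rule infsum_cong)
      fix k
      have "coef (X (ket x)) k = c (k \<otimes> inv x)" by (subst LG_ket[OF X]) (simp add: c_def)
      moreover have "cnj (coef (adj R (ket y)) k) = coef (R (ket k)) y"
        by (simp add: coef_adj[OF R] cin_ket_left)
      ultimately show "c (k \<otimes> inv x) * coef (R (ket k)) y = coef (X (ket x)) k * cnj (coef (adj R (ket y)) k)"
        by simp
    qed
    also have "\<dots> = coef (R (X (ket x))) y"
      by (simp add: cin_def[symmetric] cin_adj_right[OF R] cin_ket)
    finally show "coef ((X \<circ> R) (ket x)) y = coef ((R \<circ> X) (ket x)) y" by simp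
  qed
qed

text \<open>The bicommutant property is spent on \<open>P_closed\<close>: when vectors of elements
  of \<open>P\<close> converge to that of \<open>X\<close>, matrix coefficients converge, so
  \<open>X\<close> commutes with the commutant of \<open>P\<close>.\<close>

lemma inv_alg_low:
  assumes P: "invariant_subalgebra D P"
  shows "inv_alg G (low ` P)"
proof -
  have vn: "von_neumann_algebra S P" using P by (simp add: invariant_subalgebra_def)
  have bd: "T \<in> bounded_operators S" if "T \<in> P" for T
    using vn that by (auto simp: von_neumann_algebra_def)
  have up_in: "up X \<in> P" if "X \<in> low ` P" for X using that up_low[OF bd] by auto
  have in_low: "X \<in> low ` P" if "up X \<in> P" for X using that low_up by (metis imageI)
  have LG_low: "X \<in> LG" if "X \<in> low ` P" for X
  proof -
    have "up X \<in> up ` LG" using up_in[OF that] P group_vN_LG by (auto simp: invariant_subalgebra_def)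
    then show ?thesis using low_up by (metis imageE)
  qed
  show ?thesis
  proof
    show "low ` P \<subseteq> LG" using LG_low by blast
    show "id \<in> low ` P" using vn by (intro in_low) (simp add: von_neumann_algebra_def op_id_up)
    fix X assume X: "X \<in> low ` P"
    show "(\<lambda>v. cscale c (X v)) \<in> low ` P" for c
      using vn up_in[OF X] by (intro in_low) (auto simp: von_neumann_algebra_def op_scale_up[symmetric])
    show "adj X \<in> low ` P"
      using vn up_in[OF X] LG_bop[OF LG_low[OF X]]
      by (intro in_low) (auto simp: von_neumann_algebra_def op_adjoint_up[symmetric])
    show "Ad g X \<in> low ` P" for g
    proof (rule in_low)
      have "up (Ad g X) = op_comp S (op_comp S (left_translation D (\<theta> g)) (up X)) (op_adjoint S (left_translation D (\<theta> g)))"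
        by (simp add: left_translation_up op_comp_up op_adjoint_up adj_lt Ad_def)
      moreover have "(\<lambda>T. op_comp S (op_comp S (left_translation D (\<theta> g)) T)
          (op_adjoint S (left_translation D (\<theta> g)))) ` P = P"
        using P by (simp add: invariant_subalgebra_def)
      ultimately show "up (Ad g X) \<in> P" using up_in[OF X] by (metis imageI)
    qed
    fix Y assume Y: "Y \<in> low ` P"
    show "(\<lambda>v. X v + Y v) \<in> low ` P"
      using vn up_in[OF X] up_in[OF Y] by (intro in_low) (auto simp: von_neumann_algebra_def op_add_up[symmetric])
    show "X \<circ> Y \<in> low ` P"
      using vn up_in[OF X] up_in[OF Y] by (intro in_low) (auto simp: von_neumann_algebra_def op_comp_up[symmetric])
  next
    fix X assume X: "X \<in> LG" and cl: "X (ket \<one>) \<in> closure ((\<lambda>T. T (ket \<one>)) ` low ` P)"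
    obtain y where y: "\<And>n. y n \<in> (\<lambda>T. T (ket \<one>)) ` low ` P" "y \<longlonglongrightarrow> X (ket \<one>)"
      using cl unfolding closure_sequential by blast
    have "\<exists>T. T \<in> low ` P \<and> T (ket \<one>) = y n" for n using y(1)[of n] by force
    then obtain f where f: "\<And>n. f n \<in> low ` P" "\<And>n. f n (ket \<one>) = y n" by metis
    have f_lim: "(\<lambda>n. f n (ket \<one>)) \<longlonglongrightarrow> X (ket \<one>)" using y(2) f(2) by simp
    have "X \<circ> low R = low R \<circ> X" if R: "R \<in> commutant S P" for R
    proof (rule bop_eqI)
      have Rb: "bop (low R)" using R commutant_subset low_bop by blast
      then show "bop (X \<circ> low R)" "bop (low R \<circ> X)" using X by (simp_all add: bop_comp LG_bop)
      fix x
      show "(X \<circ> low R) (ket x) = (low R \<circ> X) (ket x)"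
      proof (rule l2_eqI)
        fix z
        have "(\<lambda>n. coef (f n (low R (ket x))) z) \<longlonglongrightarrow> coef (X (low R (ket x))) z"
          by (rule LG_tendsto_coef[OF LG_low[OF f(1)] X f_lim])
        moreover have "f n (low R (ket x)) = low R (f n (ket x))" for n
        proof -
          have "up (low R) \<in> commutant S P"
            using R up_low[OF subsetD[OF commutant_subset R]] by simp
          then have "low R \<circ> low (up (f n)) = low (up (f n)) \<circ> low R"
            using up_in[OF f(1)] commutant_up[of P "low R"] bd by blast
          then show ?thesis by (simp add: low_up fun_eq_iff)
        qed
        moreover have "(\<lambda>n. coef (low R (f n (ket x))) z) \<longlonglongrightarrow> coef (low R (X (ket x))) z"
        proof -
          have "(\<lambda>n. f n (ket x)) \<longlonglongrightarrow> X (ket x)"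
            unfolding LG_ket[OF LG_low[OF f(1)], of _ x] LG_ket[OF X, of x]
            by (rule bounded_linear.tendsto[OF bop_linear[OF bop_rt] f_lim])
          then show ?thesis
            unfolding cin_ket[symmetric]
            by (intro tendsto_cin tendsto_const bounded_linear.tendsto[OF bop_linear[OF Rb]])
        qed
        ultimately show "coef ((X \<circ> low R) (ket x)) z = coef ((low R \<circ> X) (ket x)) z"
          using LIMSEQ_unique by simp
      qed
    qed
    then have "up X \<in> commutant S (commutant S P)"
      using commutant_up[OF commutant_subset] up_bounded[OF LG_bop[OF X]] by blast
    then show "X \<in> low ` P" using vn by (intro in_low) (simp add: von_neumann_algebra_def)
  qed
qed

text \<open>\<open>H\<close> collects the translations in \<open>P\<close>. By the dichotomy the
  coefficients of an element of \<open>P\<close> live on \<open>H\<close>, so it commutes with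
  whatever commutes with these translations and lies in every von Neumann algebra containing
  them.\<close>

lemma subgroup_algebra:
  assumes P: "invariant_subalgebra D P"
    and dich: "\<And>g. lt g \<in> low ` P \<or> (\<forall>T\<in>low ` P. coef (T (ket \<one>)) g = 0)"
  shows "\<exists>H. H \<lhd> D \<and> P = group_vN D H"
proof -
  interpret A: inv_alg G "low ` P" by (rule inv_alg_low[OF P])
  have vn: "von_neumann_algebra S P" using P by (simp add: invariant_subalgebra_def)
  have bd: "P \<subseteq> bounded_operators S" using vn by (auto simp: von_neumann_algebra_def)
  define H' where "H' = {g. lt g \<in> low ` P}"
  define H where "H = \<theta> ` H'"
  have one: "\<one> \<in> H'"
  proof -
    have "lt \<one> = id" by (rule ext) simp
    then show ?thesis using A.P_id by (simp add: H'_def)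
  qed
  have mult: "x \<otimes> y \<in> H'" if "x \<in> H'" "y \<in> H'" for x y
  proof -
    have "lt (x \<otimes> y) = lt x \<circ> lt y" by (simp add: fun_eq_iff)
    then show ?thesis using that A.P_comp by (simp add: H'_def)
  qed
  have inv: "inv x \<in> H'" if "x \<in> H'" for x
    using that A.P_adj[of "lt x"] by (simp add: H'_def adj_lt)
  have conj: "g \<otimes> x \<otimes> inv g \<in> H'" if "x \<in> H'" for x g
  proof -
    have "lt (g \<otimes> x \<otimes> inv g) = Ad g (lt x)" by (simp add: fun_eq_iff Ad_apply m_assoc)
    then show ?thesis using that A.P_Ad by (simp add: H'_def)
  qed
  have sub: "subgroup H D"
  proof (rule D.subgroupI)
    show "H \<subseteq> S" "H \<noteq> {}" using one by (auto simp: H_def)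
    show "inv\<^bsub>D\<^esub> a \<in> H" if "a \<in> H" for a
      using that inv by (auto simp: H_def \<theta>_inv[symmetric])
    show "a \<otimes>\<^bsub>D\<^esub> b \<in> H" if "a \<in> H" "b \<in> H" for a b
      using that mult by (auto simp: H_def \<theta>_mult[symmetric])
  qed
  have "x \<otimes>\<^bsub>D\<^esub> h \<otimes>\<^bsub>D\<^esub> inv\<^bsub>D\<^esub> x \<in> H" if "x \<in> S" "h \<in> H" for x h
  proof -
    obtain y where "x = \<theta> y" using \<theta>_cases[OF \<open>x \<in> S\<close>] by blast
    then show ?thesis using that(2) conj by (auto simp: H_def \<theta>_inv[symmetric] \<theta>_mult[symmetric])
  qed
  then have "H \<lhd> D" using sub by (simp add: D.normal_inv_iff)
  moreover have "P = group_vN D H"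
  proof
    have "left_translation D ` H \<subseteq> P"
    proof
      fix T assume "T \<in> left_translation D ` H"
      then obtain g where g: "g \<in> H'" "T = up (lt g)" by (auto simp: H_def left_translation_up)
      then show "T \<in> P" using up_low bd by (auto simp: H'_def)
    qed
    then show "group_vN D H \<subseteq> P" unfolding group_vN_def vN_generated_def using vn by blast
    show "P \<subseteq> group_vN D H"
      unfolding group_vN_def vN_generated_def
    proof (rule subsetI, rule InterI, clarify)
      fix T M assume T: "T \<in> P" and M: "von_neumann_algebra S M" "left_translation D ` H \<subseteq> M"
      have TL: "low T \<in> LG" using T A.P_LG by blast
      have Mb: "M \<subseteq> bounded_operators S" using M by (simp add: von_neumann_algebra_def)
      have "low T \<circ> low R = low R \<circ> low T" if R: "R \<in> commutant S M" for R
      proof (rule commutes_of_support[OF TL])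
        have Rb: "R \<in> bounded_operators S" using R commutant_subset by blast
        then show "bop (low R)" by (rule low_bop)
        fix g assume "coef (low T (ket \<one>)) g \<noteq> 0"
        then have "g \<in> H'" using dich[of g] T by (auto simp: H'_def)
        then have "up (lt g) \<in> M" using M(2) by (auto simp: H_def left_translation_up[symmetric])
        moreover have "up (low R) \<in> commutant S M" using R up_low[OF Rb] by simp
        ultimately show "low R \<circ> lt g = lt g \<circ> low R"
          using commutant_up[OF Mb, of "low R"] low_up by metis
      qed
      then have "up (low T) \<in> commutant S (commutant S M)"
        using commutant_up[OF commutant_subset] up_bounded[OF LG_bop[OF TL]] by blast
      then show "T \<in> M" using M(1) up_low T bd by (auto simp: von_neumann_algebra_def)
    qed
  qed
  ultimately show ?thesis by blast
qed

end

section \<open>The main theorem\<close>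

text \<open>Normalized counting is an invariant mean; the contrapositive makes a non-amenable group
  infinite.\<close>

lemma finite_group_amenable:
  assumes "group G" "finite (carrier G)" shows "amenable G"
proof -
  interpret group G by fact
  have pos: "0 < card (carrier G)" using assms(2) one_closed by (auto simp: card_gt_0_iff)
  have "card (g <#\<^bsub>G\<^esub> A) = card A" if "g \<in> carrier G" "A \<subseteq> carrier G" for g A
  proof -
    have "g <#\<^bsub>G\<^esub> A = (\<lambda>x. g \<otimes>\<^bsub>G\<^esub> x) ` A" by (auto simp: l_coset_def)
    then show ?thesis
      using inj_on_subset[OF inj_on_cmult[OF that(1)] that(2)] by (simp add: card_image)
  qed
  moreover have "card (A \<union> A') = card A + card A'"
    if "A \<subseteq> carrier G" "A' \<subseteq> carrier G" "A \<inter> A' = {}" for A A'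
    using that assms(2) by (intro card_Un_disjoint) (auto intro: finite_subset)
  ultimately show ?thesis
    unfolding amenable_def using pos
    by (intro exI[of _ "\<lambda>A. real (card A) / real (card (carrier G))"]) (auto simp: add_divide_distrib)
qed

text \<open>The class of \<one> is a singleton, so non-conjugate \<open>x\<close> and
  \<open>y\<close> would produce a third class.\<close>

lemma two_conjugacy_classes:
  assumes "group G" "card (conjugacy_classes G) = 2"
    and x: "x \<in> carrier G" "x \<noteq> \<one>\<^bsub>G\<^esub>" and y: "y \<in> carrier G" "y \<noteq> \<one>\<^bsub>G\<^esub>"
  shows "\<exists>g\<in>carrier G. y = g \<otimes>\<^bsub>G\<^esub> x \<otimes>\<^bsub>G\<^esub> inv\<^bsub>G\<^esub> g"
proof (rule ccontr)
  interpret group G by fact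
  assume no: "\<not> ?thesis"
  define cl where "cl g = {h \<otimes>\<^bsub>G\<^esub> g \<otimes>\<^bsub>G\<^esub> inv\<^bsub>G\<^esub> h | h. h \<in> carrier G}" for g
  have self: "g \<in> cl g" if "g \<in> carrier G" for g
    unfolding cl_def using that by (auto intro!: exI[of _ "\<one>\<^bsub>G\<^esub>"])
  have "x \<notin> cl \<one>\<^bsub>G\<^esub>" "y \<notin> cl \<one>\<^bsub>G\<^esub>" using x y by (auto simp: cl_def)
  moreover have "y \<notin> cl x" using no by (auto simp: cl_def)
  ultimately have "cl \<one>\<^bsub>G\<^esub> \<noteq> cl x" "cl \<one>\<^bsub>G\<^esub> \<noteq> cl y" "cl x \<noteq> cl y"
    using self[OF x(1)] self[OF y(1)] by auto
  then have "card {cl \<one>\<^bsub>G\<^esub>, cl x, cl y} = 3" by simp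
  moreover have "{cl \<one>\<^bsub>G\<^esub>, cl x, cl y} \<subseteq> conjugacy_classes G"
    unfolding conjugacy_classes_def cl_def using x y by blast
  moreover have "finite (conjugacy_classes G)" using assms(2) by (simp add: card_ge_0_finite)
  ultimately have "3 \<le> card (conjugacy_classes G)" using card_mono by metis
  then show False using assms(2) by simp
qed

lemma carrier_alt_inf: "carrier alt_inf = range perm"
proof
  show "carrier alt_inf \<subseteq> range perm"
  proof
    fix p assume "p \<in> carrier alt_inf"
    then have "p = perm (Abs_alt p)" by (simp add: alt_inf_def perm_Abs)
    then show "p \<in> range perm" by (rule range_eqI)
  qed
qed (auto simp: alt_inf_def perm)

lemma perm_iso: "perm \<in> iso alt_group alt_inf"
  unfolding iso_def hom_def bij_betw_def mem_Collect_eq carrier_alt_inf carrier_alt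
  by (auto simp: alt_inf_def inj_def intro: alt_eqI)

lemma group_alt_inf: "group alt_inf"
proof -
  have "monoid alt_inf"
    by (unfold_locales) (auto simp: alt_inf_def permutation_compose evenperm_comp o_assoc)
  then show ?thesis
    using alt.iso_imp_group[of alt_inf] perm_iso by (auto simp: is_iso_def)
qed

theorem theorem5p7:
  fixes B :: "('b, 'm) monoid_scheme"
  assumes "group B"
    and "countable (carrier B)"
    and "\<not> amenable B"
    and "card (conjugacy_classes B) = 2"
  shows "ISR_property (alt_inf \<times>\<times> B)"
proof -
  interpret B: group B by fact
  have inf: "infinite (carrier B)" using finite_group_amenable assms by blast
  \<comment> \<open>\<open>carrier B\<close> may be a proper subset of its type, whereas
    \<open>ugroup\<close> requires the whole type. As \<open>B\<close> is countably infinite, its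
    multiplication is copied to \<open>nat\<close> along an enumeration.\<close>
  define \<beta> where "\<beta> = from_nat_into (carrier B)"
  have \<beta>: "bij_betw \<beta> UNIV (carrier B)" unfolding \<beta>_def using inf assms(2) by (rule bij_betw_from_nat_into[rotated])
  then have \<beta>_in: "\<beta> n \<in> carrier B" for n by (auto simp: bij_betw_def)
  define \<beta>' where "\<beta>' = inv_into UNIV \<beta>"
  have \<beta>': "\<beta>' (\<beta> n) = n" "b \<in> carrier B \<Longrightarrow> \<beta> (\<beta>' b) = b" for n b
    using \<beta> by (simp_all add: \<beta>'_def bij_betw_def f_inv_into_f)
  define N :: "nat monoid" where
    "N = \<lparr>carrier = UNIV, monoid.mult = (\<lambda>m n. \<beta>' (\<beta> m \<otimes>\<^bsub>B\<^esub> \<beta> n)), one = \<beta>' \<one>\<^bsub>B\<^esub>\<rparr>"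
  have N_mult: "\<beta> (m \<otimes>\<^bsub>N\<^esub> n) = \<beta> m \<otimes>\<^bsub>B\<^esub> \<beta> n" and N_one: "\<beta> \<one>\<^bsub>N\<^esub> = \<one>\<^bsub>B\<^esub>" for m n
    by (simp_all add: N_def \<beta>' \<beta>_in)
  have \<beta>_eqI: "m = n" if "\<beta> m = \<beta> n" for m n using that \<beta>'(1) by metis
  have N_group: "group N"
  proof (rule groupI)
    fix n assume "n \<in> carrier N"
    have "\<beta>' (inv\<^bsub>B\<^esub> \<beta> n) \<otimes>\<^bsub>N\<^esub> n = \<one>\<^bsub>N\<^esub>"
      by (rule \<beta>_eqI) (simp add: N_mult N_one \<beta>' \<beta>_in)
    then show "\<exists>m\<in>carrier N. m \<otimes>\<^bsub>N\<^esub> n = \<one>\<^bsub>N\<^esub>" by (auto simp: N_def)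
  qed (auto simp: N_mult N_one \<beta>_in B.m_assoc intro!: \<beta>_eqI, auto simp: N_def)
  have \<beta>_iso: "\<beta> \<in> iso N B" using \<beta> by (auto simp: iso_def hom_def N_mult \<beta>_in) (simp add: N_def)
  interpret N: ugroup N
    by (intro ugroup.intro ugroup_axioms.intro N_group) (simp add: N_def)
  have N_inv: "\<beta> (inv\<^bsub>N\<^esub> n) = inv\<^bsub>B\<^esub> (\<beta> n)" for n
    by (rule B.inv_equality[symmetric]) (simp_all add: N_mult[symmetric] N_one \<beta>_in)
  interpret AN: alt_prod N
  proof (intro alt_prod.intro alt_prod_axioms.intro N.ugroup_axioms infinite_UNIV_nat)
    fix x y assume "x \<noteq> \<one>\<^bsub>N\<^esub>" "y \<noteq> \<one>\<^bsub>N\<^esub>"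
    then have "\<beta> x \<noteq> \<one>\<^bsub>B\<^esub>" "\<beta> y \<noteq> \<one>\<^bsub>B\<^esub>" using \<beta>_eqI N_one by metis+
    then obtain g where "g \<in> carrier B" "\<beta> y = g \<otimes>\<^bsub>B\<^esub> \<beta> x \<otimes>\<^bsub>B\<^esub> inv\<^bsub>B\<^esub> g"
      using two_conjugacy_classes[OF assms(1,4) \<beta>_in _ \<beta>_in] by blast
    then have "y = \<beta>' g \<otimes>\<^bsub>N\<^esub> x \<otimes>\<^bsub>N\<^esub> inv\<^bsub>N\<^esub> (\<beta>' g)"
      by (intro \<beta>_eqI) (simp add: N_mult N_inv \<beta>')
    then show "\<exists>g. y = g \<otimes>\<^bsub>N\<^esub> x \<otimes>\<^bsub>N\<^esub> inv\<^bsub>N\<^esub> g" by blast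
  qed
  interpret T: group_transport AN.G "alt_inf \<times>\<times> B" "\<lambda>(a, n). (perm a, \<beta> n)"
  proof (intro group_transport.intro group_transport_axioms.intro AN.ugroup_axioms DirProd_group group_alt_inf assms(1))
    show "(\<lambda>(a, n). (perm a, \<beta> n)) \<in> iso AN.G (alt_inf \<times>\<times> B)"
      unfolding AN.G_def by (rule alt.DirProd_iso_set_trans[OF perm_iso \<beta>_iso])
  qed
  show ?thesis
    unfolding ISR_property_def
  proof (intro allI impI)
    fix P assume P: "invariant_subalgebra (alt_inf \<times>\<times> B) P"
    show "\<exists>H. H \<lhd> alt_inf \<times>\<times> B \<and> P = group_vN (alt_inf \<times>\<times> B) H"
      using T.subgroup_algebra[OF P] AN.translation_or_orthogonal[OF T.inv_alg_low[OF P]] by blast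
  qed
qed

end
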